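(* Let $X$ be a smooth manifold of dimension $m$. As $N$ becomes very large, depending on the topology of $X$, $$min.curv^\perp(X,B^N(1))<\sqrt{\frac{3(2m-1)}{2m+1}}.$$ In fact, $$\lim_{N\to\infty}min.curv^\perp(X,B^N(1))\leq\sqrt{\frac{3m}{m+2}}=\sqrt{3-\frac{6}{m+2}}.$$
   Context: $B^N(1)\subset\mathbb R^N$ is the unit ball. For an immersion $f:X\hookrightarrow Y$ into a Riemannian manifold $Y$, $curv^\perp_f(X)$ is the supremum of the $Y$-curvatures of the geodesics of $X$ for the induced metric (equivalently, the supremum of $\|\mathrm{II}(\tau,\tau)\|$ over unit tangent vectors $\tau$, where $\mathrm{II}$ is the second fundamental form). $min.curv^\perp(X,Y)$ is the infimum of $curv^\perp_f(X)$ over all immersions $f:X\hookrightarrow Y$.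
   Formalization: The first, strict inequality is stated only for m ≥ 2: for m = 1 its right-hand side is 1 and it fails for the circle, whose minimal curvature in the unit ball is exactly 1 (lines are dropped with it). The limit bound is stated for all m ≥ 1; the degenerate case m = 0 is excluded. *)

theory Defs
  imports "HOL-Analysis.Analysis"
begin

section \<open>Smooth functions and smooth manifolds\<close>

primrec Ck_on :: "nat \<Rightarrow> 'a::real_normed_vector set \<Rightarrow> ('a \<Rightarrow> 'b::real_normed_vector) \<Rightarrow> bool" where
  "Ck_on 0 S f \<longleftrightarrow> continuous_on S f"
| "Ck_on (Suc k) S f \<longleftrightarrow>
     (\<forall>x\<in>S. f differentiable at x) \<and> (\<forall>v. Ck_on k S (\<lambda>x. frechet_derivative f (at x) v))"

text \<open>Only meaningful for open \<open>S\<close> (and finite-dimensional domain), which is all we use.\<close>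

definition smooth_on :: "'a::real_normed_vector set \<Rightarrow> ('a \<Rightarrow> 'b::real_normed_vector) \<Rightarrow> bool" where
  "smooth_on S f \<longleftrightarrow> (\<forall>k. Ck_on k S f)"

type_synonym ('a, 'e) chart = "'a set \<times> ('a \<Rightarrow> 'e)"

abbreviation chart_image :: "('a, 'e) chart \<Rightarrow> 'e set" where
  "chart_image c \<equiv> snd c ` fst c"

abbreviation chart_inv :: "('a, 'e) chart \<Rightarrow> 'e \<Rightarrow> 'a" where
  "chart_inv c \<equiv> inv_into (fst c) (snd c)"

definition is_chart :: "'a topology \<Rightarrow> ('a, 'e::euclidean_space) chart \<Rightarrow> bool" where
  "is_chart X c \<longleftrightarrow>
     openin X (fst c) \<and> open (chart_image c) \<and>
     homeomorphic_map (subtopology X (fst c)) (top_of_set (chart_image c)) (snd c)"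

text \<open>A smooth manifold without boundary, of dimension \<open>DIM('e)\<close>, neither assumed compact nor
  connected; the smooth structure is given by an arbitrary (not necessarily maximal) atlas.\<close>

definition smooth_manifold :: "'a topology \<Rightarrow> ('a, 'e::euclidean_space) chart set \<Rightarrow> bool" where
  "smooth_manifold X A \<longleftrightarrow>
     Hausdorff_space X \<and> second_countable X \<and>
     (\<forall>c\<in>A. is_chart X c) \<and> (\<Union>c\<in>A. fst c) = topspace X \<and>
     (\<forall>c\<in>A. \<forall>d\<in>A. smooth_on (snd c ` (fst c \<inter> fst d)) (\<lambda>u. snd d (chart_inv c u)))"

section \<open>Immersions into subsets of Euclidean \<open>N\<close>-space\<close>

text \<open>Since \<open>N\<close> varies, \<open>\<real>\<^sup>N\<close> is \<^term>\<open>topspace (Euclidean_space N)\<close>, the set of all sequences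
  vanishing from index \<open>N\<close> on, with the standard inner product.\<close>

definition inner_N :: "nat \<Rightarrow> (nat \<Rightarrow> real) \<Rightarrow> (nat \<Rightarrow> real) \<Rightarrow> real" where
  "inner_N N x y = (\<Sum>i<N. x i * y i)"

definition norm_N :: "nat \<Rightarrow> (nat \<Rightarrow> real) \<Rightarrow> real" where
  "norm_N N x = sqrt (inner_N N x x)"

definition unit_ball :: "nat \<Rightarrow> (nat \<Rightarrow> real) set" where
  "unit_ball N = {x \<in> topspace (Euclidean_space N). norm_N N x \<le> 1}"

definition local_rep :: "('a, 'e) chart \<Rightarrow> ('a \<Rightarrow> nat \<Rightarrow> real) \<Rightarrow> 'e \<Rightarrow> nat \<Rightarrow> real" where
  "local_rep c f u = f (chart_inv c u)"

definition dir_deriv :: "('e::euclidean_space \<Rightarrow> nat \<Rightarrow> real) \<Rightarrow> 'e \<Rightarrow> 'e \<Rightarrow> nat \<Rightarrow> real" where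
  "dir_deriv F u v = (\<lambda>i. frechet_derivative (\<lambda>p. F p i) (at u) v)"

definition dir_deriv2 :: "('e::euclidean_space \<Rightarrow> nat \<Rightarrow> real) \<Rightarrow> 'e \<Rightarrow> 'e \<Rightarrow> 'e \<Rightarrow> nat \<Rightarrow> real" where
  "dir_deriv2 F u v w = dir_deriv (\<lambda>p. dir_deriv F p v) u w"

definition immersion ::
  "'a topology \<Rightarrow> ('a, 'e::euclidean_space) chart set \<Rightarrow> nat \<Rightarrow> (nat \<Rightarrow> real) set
    \<Rightarrow> ('a \<Rightarrow> nat \<Rightarrow> real) \<Rightarrow> bool" where
  "immersion X A N Y f \<longleftrightarrow>
     Y \<subseteq> topspace (Euclidean_space N) \<and> f ` topspace X \<subseteq> Y \<and>
     (\<forall>c\<in>A. \<forall>i<N. smooth_on (chart_image c) (\<lambda>u. local_rep c f u i)) \<and>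
     (\<forall>c\<in>A. \<forall>u\<in>chart_image c. inj (dir_deriv (local_rep c f) u))"

section \<open>Second fundamental form and minimal curvature\<close>

text \<open>The orthogonal projection of \<open>y\<close> to the complement in \<open>\<real>\<^sup>N\<close> of the subspace \<open>T\<close>.\<close>

definition normal_part :: "nat \<Rightarrow> (nat \<Rightarrow> real) set \<Rightarrow> (nat \<Rightarrow> real) \<Rightarrow> nat \<Rightarrow> real" where
  "normal_part N T y =
     (THE n. n \<in> topspace (Euclidean_space N) \<and> (\<forall>t\<in>T. inner_N N n t = 0) \<and>
             (\<exists>t\<in>T. y = (\<lambda>i. n i + t i)))"

text \<open>The ambient connection is flat, so in a chart the second fundamental form is the normal part
  of the second derivative. Tangent vectors of \<open>X\<close> are written in the coordinates of the chart.\<close>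

definition second_fundamental_form ::
  "nat \<Rightarrow> ('e::euclidean_space \<Rightarrow> nat \<Rightarrow> real) \<Rightarrow> 'e \<Rightarrow> 'e \<Rightarrow> 'e \<Rightarrow> nat \<Rightarrow> real" where
  "second_fundamental_form N F u v w =
     normal_part N (range (dir_deriv F u)) (dir_deriv2 F u v w)"

text \<open>The supremum runs over all tangent vectors \<open>v\<close> of unit length for the induced metric. It may be
  infinite, whence the type. For \<open>Y \<subseteq> \<real>\<^sup>N\<close> with non-empty interior and the flat metric, as for the
  ball, the curvature in \<open>Y\<close> is the Euclidean one.\<close>

definition curv_perp ::
  "('a, 'e::euclidean_space) chart set \<Rightarrow> nat \<Rightarrow> ('a \<Rightarrow> nat \<Rightarrow> real) \<Rightarrow> ennreal" where
  "curv_perp A N f =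
     Sup {ennreal (norm_N N (second_fundamental_form N (local_rep c f) u v v)) | c u v.
            c \<in> A \<and> u \<in> chart_image c \<and> norm_N N (dir_deriv (local_rep c f) u v) = 1}"

definition min_curv_perp ::
  "'a topology \<Rightarrow> ('a, 'e::euclidean_space) chart set \<Rightarrow> nat \<Rightarrow> (nat \<Rightarrow> real) set \<Rightarrow> ennreal" where
  "min_curv_perp X A N Y = (INF f \<in> {f. immersion X A N Y f}. curv_perp A N f)"

end

theory Submission
  imports Defs
begin

text \<open>
  The immersions of small curvature are oscillating maps. Let \<open>u\<close> range over a finite set of vectors
  of \<open>\<real>\<^sup>m\<close> with weights \<open>w u\<close> of sum \<open>1\<close>, and suppose that, for all \<open>y\<close>, the weighted sums of
  \<open>(u \<bullet> y)\<^sup>2\<close> and of \<open>(u \<bullet> y)\<^sup>4\<close> are \<open>|y|\<^sup>2\<close> and \<open>c |y|\<^sup>4\<close>. The map of \<open>\<real>\<^sup>m\<close> with the complex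
  components \<open>sqrt (w u) exp (i (u \<bullet> y))\<close> goes to the unit sphere and is isometric, and its second derivative
  in a unit direction has the norm \<open>sqrt c\<close>. The least possible value of \<open>c\<close> is
  \<open>3 m / (m + 2)\<close>, the fourth moment of the sphere of radius \<open>sqrt m\<close>; it is attained by the vertices
  of a cube and of a cross-polytope (\<open>spherical_design\<close>).

  On a manifold embedded in a Euclidean space, charts of a very small size are almost isometric to
  pieces of \<open>\<real>\<^sup>m\<close>. With functions \<open>\<kappa>\<close> whose squares form a partition of unity, one takes the
  components \<open>\<kappa> sqrt (w u) exp (i (u \<bullet> T y) / r)\<close>, where \<open>T\<close> is the projection to a tangent space and \<open>r\<close> a
  small scale. If \<open>\<kappa>\<close> varies slowly in the unit of length \<open>r\<close>, the cross terms are negligible, and since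
  both the squares of the first derivatives and those of the second derivatives are averaged with
  the weights \<open>\<kappa>\<^sup>2\<close>, the curvature stays close to \<open>sqrt c\<close>. The cells that carry the \<open>\<kappa>\<close> come from a
  cubical partition of the ambient space with two colours for each coordinate, so that finitely
  many components suffice: within one colour the cells are disjoint.

  The manifold need not be compact, and this is felt twice. First, the scale \<open>r\<close> has to tend to \<open>0\<close>
  at infinity. It must do so slowly, because components of very different scales
  on the same cell would spoil the ratio of the fourth moment to the square of the second one; the
  ambient space is therefore cut into layers on which the scale is constant, with a ratio close to \<open>1\<close>
  between neighbouring layers (\<open>slowly_varying_function\<close>, \<open>colour_jets\<close>, \<open>oscillating_map\<close>). Second, there has to
  be an embedding, proper and into a space of finite dimension. A manifold is covered by \<open>m + 1\<close>
  families of disjoint coordinate domains (\<open>generic_levels\<close>), and each family can be handled by a fixed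
  number of coordinates (\<open>blockwise_embedding\<close>).

  The second fundamental form is compared with second derivatives along curves with a suitable
  acceleration (\<open>jet2_smooth_compose\<close>, \<open>norm_normal_part_le\<close>); this makes all the estimates independent of charts.
\<close>

section \<open>Calculus of smooth functions\<close>

lemma Ck_on_subset: "Ck_on k S f \<Longrightarrow> T \<subseteq> S \<Longrightarrow> Ck_on k T f"
proof (induction k arbitrary: f)
  case 0 then show ?case by (auto intro: continuous_on_subset)
next
  case (Suc k) then show ?case by auto
qed

lemma Ck_on_cong:
  assumes "open S" "\<And>x. x \<in> S \<Longrightarrow> f x = g x" "Ck_on k S f"
  shows "Ck_on k S g"
  using assms(2,3)
proof (induction k arbitrary: f g)
  case 0 then show ?case by (simp cong: continuous_on_cong)
next
  case (Suc k)
  have d: "g differentiable at x" if "x \<in> S" for x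
  proof -
    have "(f has_derivative frechet_derivative f (at x)) (at x)"
      using Suc.prems that by (auto simp: frechet_derivative_works[symmetric])
    then have "(g has_derivative frechet_derivative f (at x)) (at x)"
      by (rule has_derivative_transform_within_open[OF _ assms(1) that]) (use Suc.prems in auto)
    then show ?thesis by (auto simp: differentiable_def)
  qed
  have "Ck_on k S (\<lambda>x. frechet_derivative g (at x) v)" for v
  proof (rule Suc.IH[of "\<lambda>x. frechet_derivative f (at x) v"])
    show "Ck_on k S (\<lambda>x. frechet_derivative f (at x) v)" using Suc.prems by simp
    show "frechet_derivative f (at x) v = frechet_derivative g (at x) v" if "x \<in> S" for x
      using frechet_derivative_transform_within_open[of f x S g] Suc.prems assms(1) that by simp
  qed
  then show ?case using d by simp
qed

lemma Ck_on_Suc_imp: "Ck_on (Suc k) S f \<Longrightarrow> Ck_on k S f"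
proof (induction k arbitrary: f)
  case 0
  then show ?case
    by (auto intro!: continuous_at_imp_continuous_on differentiable_imp_continuous_within)
next
  case (Suc k)
  then show ?case using Ck_on.simps(2) by blast
qed

lemma Ck_on_SucI:
  assumes "open S" "\<And>x. x \<in> S \<Longrightarrow> (f has_derivative D x) (at x)" "\<And>v. Ck_on k S (\<lambda>x. D x v)"
  shows "Ck_on (Suc k) S f"
proof -
  have "Ck_on k S (\<lambda>x. frechet_derivative f (at x) v)" for v
    by (rule Ck_on_cong[OF assms(1) _ assms(3)[of v]])
      (metis assms(2) frechet_derivative_at)
  then show ?thesis using assms(2) by (auto simp: differentiable_def)
qed

lemma Ck_on_const: "open S \<Longrightarrow> Ck_on k S (\<lambda>x. c)"
  by (induction k arbitrary: c) (auto simp: frechet_derivative_const)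

lemma Ck_on_bounded_linear: "open S \<Longrightarrow> bounded_linear L \<Longrightarrow> Ck_on k S L"
proof (cases k)
  case 0
  assume "bounded_linear L" then show ?thesis using 0 by (simp add: linear_continuous_on)
next
  case (Suc j)
  assume a: "open S" "bounded_linear L"
  show ?thesis unfolding Suc
    by (rule Ck_on_SucI[OF a(1), where D="\<lambda>x. L"])
       (use a in \<open>auto intro: bounded_linear_imp_has_derivative Ck_on_const\<close>)
qed

lemma Ck_on_add:
  "open S \<Longrightarrow> Ck_on k S f \<Longrightarrow> Ck_on k S g \<Longrightarrow> Ck_on k S (\<lambda>x. f x + g x)"
proof (induction k arbitrary: f g)
  case 0 then show ?case by (auto intro: continuous_intros)
next
  case (Suc k)
  show ?case
    by (rule Ck_on_SucI[OF Suc.prems(1), where D="\<lambda>x v. frechet_derivative f (at x) v + frechet_derivative g (at x) v"])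
      (use Suc in \<open>auto intro!: has_derivative_add simp: frechet_derivative_works[symmetric]\<close>)
qed

lemma Ck_on_bilinear:
  assumes "bounded_bilinear pr" and "open S"
  shows "Ck_on k S f \<Longrightarrow> Ck_on k S g \<Longrightarrow> Ck_on k S (\<lambda>x. pr (f x) (g x))"
proof (induction k arbitrary: f g)
  case 0 then show ?case using bounded_bilinear.continuous_on[OF assms(1)] by simp
next
  case (Suc k)
  show ?case
  proof (rule Ck_on_SucI[OF assms(2), where D="\<lambda>x v. pr (f x) (frechet_derivative g (at x) v) + pr (frechet_derivative f (at x) v) (g x)"])
    fix x assume "x \<in> S"
    then show "((\<lambda>x. pr (f x) (g x)) has_derivative
         (\<lambda>v. pr (f x) (frechet_derivative g (at x) v) + pr (frechet_derivative f (at x) v) (g x))) (at x)"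
      using Suc.prems by (intro bounded_bilinear.FDERIV[OF assms(1)]) (auto simp: frechet_derivative_works[symmetric])
  next
    fix v
    show "Ck_on k S (\<lambda>x. pr (f x) (frechet_derivative g (at x) v) + pr (frechet_derivative f (at x) v) (g x))"
      using Suc.prems[THEN Ck_on_Suc_imp] Suc.prems by (intro Ck_on_add Suc.IH assms(2)) auto
  qed
qed

lemma Ck_on_linear_compose:
  assumes "bounded_linear L" "open S"
  shows "Ck_on k S f \<Longrightarrow> Ck_on k S (\<lambda>x. L (f x))"
proof (induction k arbitrary: f)
  case 0 then show ?case using bounded_linear.continuous_on[OF assms(1)] by simp
next
  case (Suc k)
  show ?case
    by (rule Ck_on_SucI[OF assms(2), where D="\<lambda>x v. L (frechet_derivative f (at x) v)"])
      (use Suc in \<open>auto intro!: bounded_linear.has_derivative[OF assms(1)] simp: frechet_derivative_works[symmetric]\<close>)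
qed

lemma Ck_on_sum:
  assumes "open S"
  shows "(\<And>i. i \<in> I \<Longrightarrow> Ck_on k S (f i)) \<Longrightarrow> Ck_on k S (\<lambda>x. \<Sum>i\<in>I. f i x)"
  by (induction I rule: infinite_finite_induct) (auto intro: Ck_on_add Ck_on_const assms)

text \<open>The chain rule is written in the basis of the intermediate space, which turns the derivative of the
  composition into a sum of products of functions that are one order smoother.\<close>

lemma Ck_on_compose:
  fixes f :: "'a::real_normed_vector \<Rightarrow> 'b::euclidean_space" and g :: "'b \<Rightarrow> 'c::real_normed_vector"
  assumes "open S" "open T" "f ` S \<subseteq> T"
  shows "Ck_on k S f \<Longrightarrow> Ck_on k T g \<Longrightarrow> Ck_on k S (\<lambda>x. g (f x))"
proof (induction k arbitrary: g)
  case 0 then show ?case using assms(3) continuous_on_compose2 by (metis Ck_on.simps(1))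
next
  case (Suc k)
  let ?D = "\<lambda>x v. frechet_derivative g (at (f x)) (frechet_derivative f (at x) v)"
  show ?case
  proof (rule Ck_on_SucI[OF assms(1), where D="?D"])
    fix x assume x: "x \<in> S"
    have "(f has_derivative frechet_derivative f (at x)) (at x)"
      using Suc.prems x by (auto simp: frechet_derivative_works[symmetric])
    moreover have "(g has_derivative frechet_derivative g (at (f x))) (at (f x))"
      using Suc.prems x assms(3) by (auto simp: frechet_derivative_works[symmetric])
    ultimately show "((\<lambda>x. g (f x)) has_derivative ?D x) (at x)"
      by (rule has_derivative_compose)
  next
    fix v
    let ?E = "\<lambda>x. \<Sum>b\<in>Basis. (frechet_derivative f (at x) v \<bullet> b) *\<^sub>R frechet_derivative g (at (f x)) b"
    have "Ck_on k S ?E"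
    proof (rule Ck_on_sum[OF assms(1)])
      fix b :: 'b assume "b \<in> Basis"
      have "Ck_on k S (\<lambda>x. frechet_derivative f (at x) v)" using Suc.prems(1) by simp
      then have "Ck_on k S (\<lambda>x. frechet_derivative f (at x) v \<bullet> b)"
        by (rule Ck_on_linear_compose[OF bounded_linear_inner_left assms(1)])
      moreover have "Ck_on k T (\<lambda>y. frechet_derivative g (at y) b)" using Suc.prems(2) by simp
      then have "Ck_on k S (\<lambda>x. frechet_derivative g (at (f x)) b)"
        by (rule Suc.IH[OF Ck_on_Suc_imp[OF Suc.prems(1)]])
      ultimately show "Ck_on k S (\<lambda>x. (frechet_derivative f (at x) v \<bullet> b) *\<^sub>R frechet_derivative g (at (f x)) b)"
        by (rule Ck_on_bilinear[OF bounded_bilinear_scaleR assms(1)])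
    qed
    then show "Ck_on k S (\<lambda>x. ?D x v)"
    proof (rule Ck_on_cong[OF assms(1), rotated])
      fix x assume "x \<in> S"
      then have "g differentiable at (f x)" using Suc.prems assms(3) by auto
      then have "linear (frechet_derivative g (at (f x)))"
        by (simp add: linear_frechet_derivative)
      then have "?E x = frechet_derivative g (at (f x)) (\<Sum>b\<in>Basis. (frechet_derivative f (at x) v \<bullet> b) *\<^sub>R b)"
        by (simp add: linear_sum linear_scale)
      then show "?E x = ?D x v"
        by (simp only: euclidean_representation)
    qed
  qed
qed

lemma Ck_on_local:
  assumes "\<And>x. x \<in> S \<Longrightarrow> \<exists>T. open T \<and> x \<in> T \<and> Ck_on k T f"
  shows "Ck_on k S f"
  using assms
proof (induction k arbitrary: f)
  case 0
  show ?case
  proof (simp, rule continuous_at_imp_continuous_on, rule ballI)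
    fix x assume "x \<in> S"
    then obtain T where "open T" "x \<in> T" "continuous_on T f" using 0 by auto
    then show "isCont f x" using continuous_on_eq_continuous_at by blast
  qed
next
  case (Suc k)
  have "f differentiable at x" if "x \<in> S" for x using Suc.prems[OF that] by auto
  moreover have "Ck_on k S (\<lambda>x. frechet_derivative f (at x) v)" for v
  proof (rule Suc.IH)
    fix x assume "x \<in> S"
    then show "\<exists>T. open T \<and> x \<in> T \<and> Ck_on k T (\<lambda>x. frechet_derivative f (at x) v)"
      using Suc.prems[of x] by auto
  qed
  ultimately show ?case by simp
qed

lemma smooth_on_subset: "smooth_on S f \<Longrightarrow> T \<subseteq> S \<Longrightarrow> smooth_on T f"
  by (auto simp: smooth_on_def intro: Ck_on_subset)

lemma smooth_on_cong:
  "open S \<Longrightarrow> (\<And>x. x \<in> S \<Longrightarrow> f x = g x) \<Longrightarrow> smooth_on S f \<Longrightarrow> smooth_on S g"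
  by (auto simp: smooth_on_def intro: Ck_on_cong)

lemma smooth_on_local:
  assumes "\<And>x. x \<in> S \<Longrightarrow> \<exists>T g. open T \<and> x \<in> T \<and> smooth_on T g \<and> (\<forall>y\<in>T. g y = f y)"
  shows "smooth_on S f"
  unfolding smooth_on_def
proof (intro allI Ck_on_local)
  fix k x assume "x \<in> S"
  then obtain T g where "open T" "x \<in> T" "smooth_on T g" "\<forall>y\<in>T. g y = f y" using assms by blast
  then show "\<exists>T. open T \<and> x \<in> T \<and> Ck_on k T f"
    by (intro exI[of _ T]) (auto simp: smooth_on_def intro: Ck_on_cong)
qed

lemma smooth_on_const: "open S \<Longrightarrow> smooth_on S (\<lambda>x. c)"
  unfolding smooth_on_def by (rule allI, rule Ck_on_const) auto

lemma smooth_on_bounded_linear: "open S \<Longrightarrow> bounded_linear L \<Longrightarrow> smooth_on S L"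
  unfolding smooth_on_def by (rule allI, rule Ck_on_bounded_linear) auto

lemma smooth_on_id: "open S \<Longrightarrow> smooth_on S (\<lambda>x. x)"
  using smooth_on_bounded_linear[OF _ bounded_linear_ident] .

lemma smooth_on_linear_compose:
  "bounded_linear L \<Longrightarrow> open S \<Longrightarrow> smooth_on S f \<Longrightarrow> smooth_on S (\<lambda>x. L (f x))"
  unfolding smooth_on_def by (rule allI, rule Ck_on_linear_compose[where L=L and f=f]) auto

lemma smooth_on_bilinear:
  "bounded_bilinear pr \<Longrightarrow> open S \<Longrightarrow> smooth_on S f \<Longrightarrow> smooth_on S g \<Longrightarrow> smooth_on S (\<lambda>x. pr (f x) (g x))"
  unfolding smooth_on_def by (rule allI, rule Ck_on_bilinear[where pr=pr and f=f and g=g]) auto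

lemma smooth_on_add:
  "open S \<Longrightarrow> smooth_on S f \<Longrightarrow> smooth_on S g \<Longrightarrow> smooth_on S (\<lambda>x. f x + g x)"
  unfolding smooth_on_def by (rule allI, rule Ck_on_add[where f=f and g=g]) auto

lemma smooth_on_sum:
  "open S \<Longrightarrow> (\<And>i. i \<in> I \<Longrightarrow> smooth_on S (f i)) \<Longrightarrow> smooth_on S (\<lambda>x. \<Sum>i\<in>I. f i x)"
  unfolding smooth_on_def by (rule allI, rule Ck_on_sum[where f=f]) auto

lemma smooth_on_minus:
  "open S \<Longrightarrow> smooth_on S f \<Longrightarrow> smooth_on S (\<lambda>x. - f x)"
  by (rule smooth_on_linear_compose[OF bounded_linear_minus[OF bounded_linear_ident], where f=f])

lemma smooth_on_diff:
  "open S \<Longrightarrow> smooth_on S f \<Longrightarrow> smooth_on S g \<Longrightarrow> smooth_on S (\<lambda>x. f x - g x)"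
  using smooth_on_add[of S f "\<lambda>x. - g x"] smooth_on_minus[of S g] by simp

lemma smooth_on_mult:
  fixes f g :: "'a::real_normed_vector \<Rightarrow> real"
  shows "open S \<Longrightarrow> smooth_on S f \<Longrightarrow> smooth_on S g \<Longrightarrow> smooth_on S (\<lambda>x. f x * g x)"
  by (rule smooth_on_bilinear[OF bounded_bilinear_mult, where f=f and g=g])

lemma smooth_on_inner:
  fixes f g :: "'a::real_normed_vector \<Rightarrow> 'b::euclidean_space"
  shows "open S \<Longrightarrow> smooth_on S f \<Longrightarrow> smooth_on S g \<Longrightarrow> smooth_on S (\<lambda>x. f x \<bullet> g x)"
  by (rule smooth_on_bilinear[OF bounded_bilinear_inner, where f=f and g=g])

lemma smooth_on_prod:
  fixes f :: "'i \<Rightarrow> 'a::real_normed_vector \<Rightarrow> real"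
  assumes "open S"
  shows "(\<And>i. i \<in> I \<Longrightarrow> smooth_on S (f i)) \<Longrightarrow> smooth_on S (\<lambda>x. \<Prod>i\<in>I. f i x)"
proof (induction I rule: infinite_finite_induct)
  case (insert i I)
  have "smooth_on S (\<lambda>x. f i x * (\<Prod>i\<in>I. f i x))"
    by (rule smooth_on_mult[OF assms]) (use insert in auto)
  with insert.hyps show ?case by simp
qed (use smooth_on_const[OF assms] in auto)

lemma smooth_on_compose:
  fixes f :: "'a::real_normed_vector \<Rightarrow> 'b::euclidean_space" and g :: "'b \<Rightarrow> 'c::real_normed_vector"
  assumes "open S" "open T" "f ` S \<subseteq> T" "smooth_on S f" "smooth_on T g"
  shows "smooth_on S (\<lambda>x. g (f x))"
  unfolding smooth_on_def
proof
  fix k show "Ck_on k S (\<lambda>x. g (f x))"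
    by (rule Ck_on_compose[OF assms(1-3)]) (use assms(4,5) in \<open>simp_all only: smooth_on_def\<close>)
qed

lemma smooth_on_imp_differentiable: "smooth_on S f \<Longrightarrow> x \<in> S \<Longrightarrow> f differentiable at x"
  unfolding smooth_on_def by (drule spec[where x="Suc 0"]) simp

lemma smooth_on_imp_continuous_on: "smooth_on S f \<Longrightarrow> continuous_on S f"
  unfolding smooth_on_def by (drule spec[where x=0]) simp

lemma smooth_on_derivative: "smooth_on S f \<Longrightarrow> smooth_on S (\<lambda>x. frechet_derivative f (at x) v)"
  unfolding smooth_on_def
proof
  fix k assume "\<forall>k. Ck_on k S f"
  then have "Ck_on (Suc k) S f" ..
  then show "Ck_on k S (\<lambda>x. frechet_derivative f (at x) v)" by simp
qed

lemma smooth_on_has_derivative: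
  "smooth_on S f \<Longrightarrow> x \<in> S \<Longrightarrow> (f has_derivative frechet_derivative f (at x)) (at x)"
  using smooth_on_imp_differentiable frechet_derivative_works by blast

text \<open>By induction on the order of differentiability: the derivatives never leave the span of the family.\<close>

lemma smooth_on_family:
  fixes F :: "'i \<Rightarrow> real \<Rightarrow> real"
  assumes "open S"
    and d: "\<And>i x. i \<in> I \<Longrightarrow> x \<in> S \<Longrightarrow> (F i has_real_derivative (\<Sum>j\<in>J i. a i j * F j x)) (at x)"
    and J: "\<And>i. i \<in> I \<Longrightarrow> J i \<subseteq> I" and "i \<in> I"
  shows "smooth_on S (F i)"
proof -
  have "\<forall>i\<in>I. Ck_on k S (F i)" for k
  proof (induction k)
    case 0
    then show ?case
      using d by (auto intro!: continuous_at_imp_continuous_on DERIV_isCont)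
  next
    case (Suc k)
    show ?case
    proof
      fix i assume i: "i \<in> I"
      show "Ck_on (Suc k) S (F i)"
      proof (rule Ck_on_SucI[OF assms(1), where D="\<lambda>x v. (\<Sum>j\<in>J i. a i j * F j x) * v"])
        show "(F i has_derivative (*) (\<Sum>j\<in>J i. a i j * F j x)) (at x)" if "x \<in> S" for x
          using d[OF i that] by (simp add: has_field_derivative_def)
        show "Ck_on k S (\<lambda>x. (\<Sum>j\<in>J i. a i j * F j x) * v)" for v
          using J[OF i] Suc assms(1)
          by (intro Ck_on_bilinear[OF bounded_bilinear_mult] Ck_on_sum Ck_on_const) auto
      qed
    qed
  qed
  then show ?thesis using \<open>i \<in> I\<close> by (auto simp: smooth_on_def)
qed

lemma smooth_on_sin: "smooth_on UNIV (sin :: real \<Rightarrow> real)" and smooth_on_cos: "smooth_on UNIV (cos :: real \<Rightarrow> real)"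
proof -
  define F :: "nat \<Rightarrow> real \<Rightarrow> real" where "F i = (if i = 0 then sin else cos)" for i
  have "smooth_on UNIV (F i)" if "i \<in> {0,1}" for i
    by (rule smooth_on_family[where I="{0,1}" and J="\<lambda>i. {1-i}" and a="\<lambda>i j. if i = 0 then 1 else -1"])
       (use that in \<open>auto simp: F_def intro!: derivative_eq_intros\<close>)
  from this[of 0] this[of 1] show "smooth_on UNIV (sin :: real \<Rightarrow> real)" "smooth_on UNIV (cos :: real \<Rightarrow> real)"
    by (simp_all add: F_def)
qed

lemma smooth_on_inverse: "smooth_on {0<..} (inverse :: real \<Rightarrow> real)"
proof -
  have "smooth_on {0<..} ((\<lambda>n x. inverse x ^ n :: real) 1)"
  proof (rule smooth_on_family[where I=UNIV and J="\<lambda>n. {Suc n}" and a="\<lambda>n j. - real n"])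
    fix n and x :: real assume "x \<in> {0<..}"
    then have "((\<lambda>x. inverse x ^ n) has_real_derivative real n * (- (inverse x ^ Suc (Suc 0)) * inverse x ^ (n - Suc 0))) (at x)"
      by (intro DERIV_power DERIV_inverse) auto
    moreover have "real n * (- (inverse x ^ Suc (Suc 0)) * inverse x ^ (n - Suc 0)) = (\<Sum>j\<in>{Suc n}. - real n * inverse x ^ j)"
      by (cases n) (auto simp: algebra_simps)
    ultimately show "((\<lambda>x. inverse x ^ n) has_real_derivative (\<Sum>j\<in>{Suc n}. - real n * inverse x ^ j)) (at x)"
      by (simp only:)
  qed auto
  then show ?thesis by simp
qed

lemma smooth_on_ln: "smooth_on {0<..} (ln :: real \<Rightarrow> real)"
  unfolding smooth_on_def
proof
  fix k show "Ck_on k {0<..} (ln :: real \<Rightarrow> real)"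
  proof (cases k)
    case 0 then show ?thesis by (auto intro!: continuous_intros)
  next
    case (Suc j)
    show ?thesis unfolding Suc
    proof (rule Ck_on_SucI[where D="\<lambda>x v. inverse x * v"])
      show "(ln has_derivative (*) (inverse x)) (at x)" if "x \<in> {0<..}" for x :: real
        using that DERIV_ln[of x] by (simp add: has_field_derivative_def)
      show "Ck_on j {0<..} (\<lambda>x. inverse x * v)" for v :: real
        using smooth_on_inverse by (intro Ck_on_bilinear[OF bounded_bilinear_mult] Ck_on_const) (auto simp: smooth_on_def)
    qed simp
  qed
qed

lemma smooth_on_real_has_derivs:
  fixes f :: "real \<Rightarrow> real"
  assumes "smooth_on S f" "open S"
  obtains f1 f2 where "\<And>x. x \<in> S \<Longrightarrow> (f has_real_derivative f1 x) (at x)"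
    "\<And>x. x \<in> S \<Longrightarrow> (f1 has_real_derivative f2 x) (at x)" "continuous_on S f1" "continuous_on S f2"
proof -
  have *: "\<exists>g'. (\<forall>x\<in>S. (g has_real_derivative g' x) (at x)) \<and> smooth_on S g'" if "smooth_on S g" for g :: "real \<Rightarrow> real"
  proof (intro exI conjI ballI)
    show "smooth_on S (\<lambda>x. frechet_derivative g (at x) 1)" by (rule smooth_on_derivative[OF that])
    fix x assume "x \<in> S"
    then have "g differentiable at x" by (rule smooth_on_imp_differentiable[OF that])
    then obtain d where d: "(g has_real_derivative d) (at x)" by (elim real_differentiableE)
    then have "frechet_derivative g (at x) = (*) d"
      unfolding has_field_derivative_def by (metis frechet_derivative_at)
    with d show "(g has_real_derivative frechet_derivative g (at x) 1) (at x)" by simp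
  qed
  then show ?thesis 
  proof -
    obtain f1 where f1: "\<forall>x\<in>S. (f has_real_derivative f1 x) (at x)" "smooth_on S f1"
      using *[OF assms(1)] by blast
    obtain f2 where f2: "\<forall>x\<in>S. (f1 has_real_derivative f2 x) (at x)" "smooth_on S f2"
      using *[OF f1(2)] by blast
    show ?thesis
      by (rule that[of f1 f2]) (use f1 f2 smooth_on_imp_continuous_on in auto)
  qed
qed

section \<open>Cut-off functions on the line\<close>

text \<open>The derivatives of the flat function \<open>exp (- 1 / x)\<close> are combinations of the members of this
  family.\<close>

definition flat_exp :: "nat \<Rightarrow> real \<Rightarrow> real" where
  "flat_exp n x = (if x > 0 then inverse x ^ n * exp (- inverse x) else 0)"

lemma flat_exp_bound: "\<bar>flat_exp n x\<bar> \<le> fact (n + 2) * x\<^sup>2"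
proof (cases "x > 0")
  case True
  define y where "y = inverse x"
  have y: "y > 0" using True by (simp add: y_def)
  have "y ^ (n + 2) / fact (n + 2) \<le> exp y"
  proof -
    have s: "(\<lambda>k. y ^ k /\<^sub>R fact k) sums exp y" by (rule exp_converges)
    have "(\<Sum>k\<in>{n+2}. y ^ k /\<^sub>R fact k) \<le> exp y"
      by (rule sum_le_suminf[of "\<lambda>k. y ^ k /\<^sub>R fact k" "{n+2}", unfolded sums_unique[OF s, symmetric]])
        (use s y in \<open>auto simp: sums_iff\<close>)
    then show ?thesis by (simp add: divide_inverse mult.commute)
  qed
  then have "y ^ (n+2) \<le> fact (n+2) * exp y" by (simp add: field_simps del: fact_Suc power_Suc)
  then have "y ^ (n+2) * (exp (-y) * x\<^sup>2) \<le> fact (n+2) * exp y * (exp (-y) * x\<^sup>2)"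
    by (rule mult_right_mono) auto
  moreover have "y ^ (n+2) * (exp (-y) * x\<^sup>2) = flat_exp n x"
    using True by (simp add: flat_exp_def y_def power_add power_inverse power2_eq_square field_simps)
  moreover have "fact (n+2) * exp y * (exp (-y) * x\<^sup>2) = fact (n+2) * x\<^sup>2"
    by (simp add: exp_minus field_simps)
  ultimately have "flat_exp n x \<le> fact (n+2) * x\<^sup>2" by (simp only:)
  moreover have "flat_exp n x \<ge> 0" by (simp add: flat_exp_def)
  ultimately show ?thesis by simp
qed (simp add: flat_exp_def)

lemma flat_exp_deriv:
  "(flat_exp n has_real_derivative (- real n * flat_exp (Suc n) x + flat_exp (Suc (Suc n)) x)) (at x)"
proof -
  consider "x > 0" | "x < 0" | "x = 0" by linarith
  then show ?thesis
  proof cases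
    case 1
    have "((\<lambda>x. inverse x ^ n * exp (- inverse x)) has_real_derivative
        (real n * (- (inverse x ^ Suc (Suc 0)) * inverse x ^ (n - Suc 0))) * exp (- inverse x)
        + exp (- inverse x) * inverse x ^ 2 * inverse x ^ n) (at x)"
      using 1 by (auto intro!: derivative_eq_intros simp: power2_eq_square)
    moreover have "(real n * (- (inverse x ^ Suc (Suc 0)) * inverse x ^ (n - Suc 0))) * exp (- inverse x)
        + exp (- inverse x) * inverse x ^ 2 * inverse x ^ n
        = - real n * flat_exp (Suc n) x + flat_exp (Suc (Suc n)) x"
      using 1 by (cases n) (auto simp: flat_exp_def algebra_simps power2_eq_square)
    ultimately have "((\<lambda>x. inverse x ^ n * exp (- inverse x)) has_real_derivative
        - real n * flat_exp (Suc n) x + flat_exp (Suc (Suc n)) x) (at x)" by simp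
    then show ?thesis
      by (rule has_field_derivative_transform_within_open[where S="{0<..}"]) (use 1 in \<open>auto simp: flat_exp_def\<close>)
  next
    case 2
    have "((\<lambda>x. 0) has_real_derivative 0) (at x)" by simp
    then have "(flat_exp n has_real_derivative 0) (at x)"
      by (rule has_field_derivative_transform_within_open[where S="{..<0}"]) (use 2 in \<open>auto simp: flat_exp_def\<close>)
    then show ?thesis using 2 by (simp add: flat_exp_def)
  next
    case 3
    have "((\<lambda>h. flat_exp n h / h) \<longlongrightarrow> 0) (at 0)"
    proof (rule Lim_null_comparison)
      show "\<forall>\<^sub>F h in at 0. norm (flat_exp n h / h) \<le> fact (n + 2) * \<bar>h\<bar>"
      proof (rule always_eventually, rule allI)
        fix h :: real
        have "\<bar>flat_exp n h\<bar> / \<bar>h\<bar> \<le> fact (n + 2) * h\<^sup>2 / \<bar>h\<bar>"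
          by (rule divide_right_mono[OF flat_exp_bound]) simp
        also have "\<dots> = fact (n + 2) * \<bar>h\<bar>" by (cases "h = 0") (auto simp: power2_eq_square abs_if)
        finally show "norm (flat_exp n h / h) \<le> fact (n + 2) * \<bar>h\<bar>" by (simp add: abs_divide)
      qed
      show "((\<lambda>h. fact (n + 2) * \<bar>h\<bar>) \<longlongrightarrow> 0) (at (0::real))"
        by (auto intro!: tendsto_eq_intros)
    qed
    then show ?thesis using 3 by (simp add: DERIV_def flat_exp_def)
  qed
qed

lemma smooth_flat_exp: "smooth_on UNIV (flat_exp n)"
proof (rule smooth_on_family[where I=UNIV and J="\<lambda>n. {Suc n, Suc (Suc n)}" and a="\<lambda>n j. if j = Suc n then - real n else 1"])
  fix n x
  show "(flat_exp n has_real_derivative (\<Sum>j\<in>{Suc n, Suc (Suc n)}. (if j = Suc n then - real n else 1) * flat_exp j x)) (at x)"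
    using flat_exp_deriv[of n x] by simp
qed auto

definition smooth_step :: "real \<Rightarrow> real" where
  "smooth_step x = flat_exp 0 x * inverse (flat_exp 0 x + flat_exp 0 (1 - x))"

lemma flat_exp_sum_pos: "flat_exp 0 x + flat_exp 0 (1 - x) > 0"
  by (cases "x > 0") (auto simp: flat_exp_def add_pos_nonneg add_nonneg_pos)

lemma smooth_step_smooth: "smooth_on UNIV smooth_step"
proof -
  have 1: "smooth_on UNIV (\<lambda>x::real. 1 - x)"
    by (intro smooth_on_diff smooth_on_const smooth_on_id open_UNIV)
  have 2: "smooth_on UNIV (\<lambda>x. flat_exp 0 (1 - x))"
    by (rule smooth_on_compose[OF open_UNIV open_UNIV _ 1 smooth_flat_exp]) simp
  have 3: "smooth_on UNIV (\<lambda>x. flat_exp 0 x + flat_exp 0 (1 - x))"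
    by (rule smooth_on_add[OF open_UNIV smooth_flat_exp 2])
  have "smooth_on UNIV (\<lambda>x. inverse (flat_exp 0 x + flat_exp 0 (1 - x)))"
    by (rule smooth_on_compose[OF open_UNIV _ _ 3 smooth_on_inverse]) (auto simp: flat_exp_sum_pos)
  then show ?thesis
    unfolding smooth_step_def[abs_def] by (rule smooth_on_mult[OF open_UNIV smooth_flat_exp])
qed

lemma smooth_step_0: "x \<le> 0 \<Longrightarrow> smooth_step x = 0"
  by (simp add: smooth_step_def flat_exp_def)

lemma smooth_step_1: "x \<ge> 1 \<Longrightarrow> smooth_step x = 1"
  using flat_exp_sum_pos[of x] by (simp add: smooth_step_def flat_exp_def)

lemma smooth_step_pos: "x > 0 \<Longrightarrow> smooth_step x > 0"
  using flat_exp_sum_pos[of x] by (simp add: smooth_step_def flat_exp_def)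

lemma smooth_step_range: "0 \<le> smooth_step x" "smooth_step x \<le> 1"
  using flat_exp_sum_pos[of x] by (auto simp: smooth_step_def flat_exp_def field_simps)

lemma smooth_step_sym: "smooth_step (1 - x) = 1 - smooth_step x"
  using flat_exp_sum_pos[of x] by (auto simp: smooth_step_def field_simps)

text \<open>A function of period \<open>2\<close>, equal to \<open>1\<close> near the even and to \<open>0\<close> near the odd integers, whose square
  and that of its translate by \<open>1\<close> form a partition of unity.\<close>

definition bump :: "real \<Rightarrow> real" where
  "bump s = cos (pi / 2 * smooth_step (2 * (sin (pi * s / 2))\<^sup>2 - 1 / 2))"

lemma bump_smooth: "smooth_on UNIV bump"
proof -
  have a: "smooth_on UNIV (\<lambda>s::real. pi / 2 * s)" and b: "smooth_on UNIV (\<lambda>s::real. 2 * (s * s) - 1 / 2)"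
    by (intro smooth_on_mult smooth_on_diff smooth_on_const smooth_on_id open_UNIV)+
  have 1: "smooth_on UNIV (\<lambda>s::real. sin (pi / 2 * s))"
    by (rule smooth_on_compose[OF open_UNIV open_UNIV _ a smooth_on_sin]) simp
  have 2: "smooth_on UNIV (\<lambda>s::real. 2 * (sin (pi / 2 * s) * sin (pi / 2 * s)) - 1 / 2)"
    by (rule smooth_on_compose[OF open_UNIV open_UNIV _ 1 b]) simp
  have 3: "smooth_on UNIV (\<lambda>s::real. smooth_step (2 * (sin (pi / 2 * s) * sin (pi / 2 * s)) - 1 / 2))"
    by (rule smooth_on_compose[OF open_UNIV open_UNIV _ 2 smooth_step_smooth]) simp
  have 4: "smooth_on UNIV (\<lambda>s::real. pi / 2 * smooth_step (2 * (sin (pi / 2 * s) * sin (pi / 2 * s)) - 1 / 2))"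
    by (rule smooth_on_compose[OF open_UNIV open_UNIV _ 3 a]) simp
  have "smooth_on UNIV (\<lambda>s::real. cos (pi / 2 * smooth_step (2 * (sin (pi / 2 * s) * sin (pi / 2 * s)) - 1 / 2)))"
    by (rule smooth_on_compose[OF open_UNIV open_UNIV _ 4 smooth_on_cos]) simp
  then show ?thesis unfolding bump_def[abs_def] by (simp add: power2_eq_square)
qed

lemma bump_le_1: "\<bar>bump s\<bar> \<le> 1" by (simp add: bump_def)

lemma bump_squares: "(bump s)\<^sup>2 + (bump (s - 1))\<^sup>2 = 1"
proof -
  define q where "q = 2 * (sin (pi * s / 2))\<^sup>2 - 1 / 2"
  have "pi * (s - 1) / 2 = pi * s / 2 - pi / 2" by (simp add: field_simps)
  then have "sin (pi * (s - 1) / 2) = - cos (pi * s / 2)" by (simp only: sin_diff) simp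
  then have "2 * (sin (pi * (s - 1) / 2))\<^sup>2 - 1 / 2 = 1 - q"
    by (simp add: q_def cos_squared_eq)
  then have "bump (s - 1) = cos (pi / 2 - pi / 2 * smooth_step q)"
    by (simp add: bump_def smooth_step_sym right_diff_distrib)
  also have "\<dots> = sin (pi / 2 * smooth_step q)" by (simp add: cos_diff)
  finally show ?thesis by (simp add: bump_def q_def)
qed

lemma bump_eq_0: "(sin (pi * s / 2))\<^sup>2 \<ge> 3 / 4 \<Longrightarrow> bump s = 0"
  by (simp add: bump_def smooth_step_1)

lemma sin_sq_eq_1_iff: "(sin (pi * s / 2))\<^sup>2 = 1 \<longleftrightarrow> (\<exists>i::int. s = 2 * of_int i + 1)"
proof -
  have "(sin (pi * s / 2))\<^sup>2 = 1 \<longleftrightarrow> cos (pi * s / 2) = 0"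
    by (simp add: sin_squared_eq)
  also have "\<dots> \<longleftrightarrow> (\<exists>i::int. s = 2 * of_int i + 1)"
  proof -
    have "pi * s / 2 = of_int i * pi + pi / 2 \<longleftrightarrow> s = 2 * of_int i + 1" for i :: int
    proof -
      have "pi * s / 2 = of_int i * pi + pi / 2 \<longleftrightarrow> pi * s = pi * (2 * of_int i + 1)" by (auto simp: field_simps)
      also have "\<dots> \<longleftrightarrow> s = 2 * of_int i + 1" by (subst mult_cancel_left) simp
      finally show ?thesis .
    qed
    then show ?thesis by (simp add: cos_zero_iff_int2)
  qed
  finally show ?thesis .
qed

lemma bump_periodic: "bump (s + 2 * of_int k) = bump s"
proof -
  have "pi * (s + 2 * of_int k) / 2 = pi * s / 2 + pi * of_int k" by (simp add: field_simps)
  moreover have "(cos (pi * of_int k))\<^sup>2 = 1" by (simp add: cos_squared_eq)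
  ultimately have "(sin (pi * (s + 2 * of_int k) / 2))\<^sup>2 = (sin (pi * s / 2))\<^sup>2"
    by (simp only: sin_add) (simp add: power_mult_distrib)
  then show ?thesis by (simp add: bump_def)
qed

lemma bump_derivs:
  obtains A1 A2 C where "\<And>x. (bump has_real_derivative A1 x) (at x)"
    "\<And>x. (A1 has_real_derivative A2 x) (at x)" "\<And>x. \<bar>A1 x\<bar> \<le> C" "\<And>x. \<bar>A2 x\<bar> \<le> C"
proof -
  obtain A1 A2 where A: "\<And>x. (bump has_real_derivative A1 x) (at x)"
    "\<And>x. (A1 has_real_derivative A2 x) (at x)" and cont: "continuous_on UNIV A1" "continuous_on UNIV A2"
    using smooth_on_real_has_derivs[OF bump_smooth open_UNIV] by auto
  have p1: "A1 (s + 2 * of_int k) = A1 s" for s k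
  proof -
    have "((\<lambda>s. bump (s + 2 * of_int k)) has_real_derivative A1 (s + 2 * of_int k)) (at s)"
      using A(1)[of "s + 2 * of_int k"] by (simp add: DERIV_shift)
    then have "(bump has_real_derivative A1 (s + 2 * of_int k)) (at s)" by (simp add: bump_periodic)
    then show ?thesis using A(1) DERIV_unique by blast
  qed
  have p2: "A2 (s + 2 * of_int k) = A2 s" for s k
  proof -
    have "((\<lambda>s. A1 (s + 2 * of_int k)) has_real_derivative A2 (s + 2 * of_int k)) (at s)"
      using A(2)[of "s + 2 * of_int k"] by (simp add: DERIV_shift)
    then have "(A1 has_real_derivative A2 (s + 2 * of_int k)) (at s)" by (simp add: p1)
    then show ?thesis using A(2) DERIV_unique by blast
  qed
  have bdd: "\<exists>C. \<forall>x. \<bar>B x\<bar> \<le> C" if "continuous_on UNIV B" "\<And>s k. B (s + 2 * of_int k) = B s" for B :: "real \<Rightarrow> real"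
  proof -
    have "bounded (B ` {0..2})"
      by (intro compact_imp_bounded compact_continuous_image continuous_on_subset[OF that(1)]) auto
    then obtain C where C: "\<forall>x\<in>{0..2}. \<bar>B x\<bar> \<le> C" by (auto simp: bounded_iff)
    have "\<bar>B x\<bar> \<le> C" for x
    proof -
      have "x + 2 * of_int (- \<lfloor>x / 2\<rfloor>) \<in> {0..2}" using of_int_floor_le[of "x / 2"] floor_correct[of "x/2"] by (simp, linarith)
      then show ?thesis using C that(2)[of x "- \<lfloor>x / 2\<rfloor>"] by metis
    qed
    then show ?thesis by blast
  qed
  obtain C1 C2 where "\<forall>x. \<bar>A1 x\<bar> \<le> C1" "\<forall>x. \<bar>A2 x\<bar> \<le> C2" using bdd[OF cont(1) p1] bdd[OF cont(2) p2] by blast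
  then show ?thesis using that[of A1 A2 "max C1 C2"] A by (meson max.coboundedI1 max.coboundedI2)
qed

text \<open>For an integer \<open>i\<close>, the integer of the parity of \<open>i\<close> that is nearest to \<open>s\<close> is \<open>i + 2 * cell i s\<close>.
  The function \<open>bump (s - i)\<close> vanishes where this integer jumps, which is what makes the cellwise
  definitions below smooth.\<close>

definition cell :: "real \<Rightarrow> real \<Rightarrow> int" where
  "cell i s = round ((s - i) / 2)"

lemma cell_local_const:
  assumes "(sin (pi * (s - i) / 2))\<^sup>2 < 1"
  shows "\<forall>\<^sub>F s' in nhds s. cell i s' = cell i s" and "\<bar>s - i - 2 * of_int (cell i s)\<bar> < 1"
proof -
  define k where "k = cell i s"
  have "\<bar>of_int k - (s - i) / 2\<bar> \<le> 1 / 2"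
    using of_int_round_abs_le[of "(s - i) / 2"] by (simp add: k_def cell_def)
  then have le: "\<bar>s - i - 2 * of_int k\<bar> \<le> 1" unfolding abs_le_iff by (simp add: field_simps)
  have "s - i \<noteq> 2 * of_int k + 1" "s - i \<noteq> 2 * of_int (k - 1) + 1"
    using assms sin_sq_eq_1_iff[of "s - i"] by (metis less_irrefl)+
  then show lt: "\<bar>s - i - 2 * of_int (cell i s)\<bar> < 1" using le by (simp add: k_def)
  have "\<forall>\<^sub>F s' in nhds s. s' \<in> {2 * of_int k + i - 1 <..< 2 * of_int k + i + 1}"
    by (rule eventually_nhds_in_open) (use lt in \<open>auto simp: k_def\<close>)
  then show "\<forall>\<^sub>F s' in nhds s. cell i s' = cell i s"
  proof eventually_elim
    case (elim s')
    then have "\<bar>(s' - i) / 2 - of_int k\<bar> < 1 / 2" by (auto simp: abs_less_iff field_simps)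
    then have "cell i s' = k" unfolding cell_def by (rule round_unique')
    then show ?case by (simp add: k_def)
  qed
qed

lemma bump_eventually_0:
  assumes "(sin (pi * s / 2))\<^sup>2 > 3 / 4"
  shows "\<forall>\<^sub>F s' in nhds s. bump s' = 0"
proof -
  have "open {s::real. (sin (pi * s / 2))\<^sup>2 > 3 / 4}"
    by (rule open_Collect_less) (auto intro!: continuous_intros)
  then have "\<forall>\<^sub>F s' in nhds s. s' \<in> {s::real. (sin (pi * s / 2))\<^sup>2 > 3 / 4}"
    by (rule eventually_nhds_in_open) (use assms in auto)
  then show ?thesis by eventually_elim (auto intro: bump_eq_0)
qed

text \<open>A positive function that decays as fast as prescribed and yet varies as slowly as prescribed:
  it descends by smooth steps along a rapidly decreasing sequence.\<close>

lemma slowly_varying_function: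
  fixes M :: "nat \<Rightarrow> real"
  assumes M: "\<And>k. M k > 0" and \<epsilon>: "\<epsilon> > 0"
  obtains R R1 R2 :: "real \<Rightarrow> real" where "smooth_on UNIV R" "\<And>s. 0 < R s" "\<And>s. R s \<le> 1"
    "\<And>k s. real k \<le> s \<Longrightarrow> R s \<le> M k"
    "\<And>s. (R has_real_derivative R1 s) (at s)" "\<And>s. (R1 has_real_derivative R2 s) (at s)"
    "\<And>s. s \<ge> 0 \<Longrightarrow> (1 + s) * \<bar>R1 s\<bar> \<le> \<epsilon>" "\<And>s. s \<ge> 0 \<Longrightarrow> (1 + s) * \<bar>R2 s\<bar> \<le> \<epsilon>"
proof -
  obtain S1 S2 where S: "\<And>x. (smooth_step has_real_derivative S1 x) (at x)"
    "\<And>x. (S1 has_real_derivative S2 x) (at x)" and cont: "continuous_on UNIV S1" "continuous_on UNIV S2"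
    using smooth_on_real_has_derivs[OF smooth_step_smooth open_UNIV] by auto
  have S10: "S1 x = 0" if "x \<notin> {0..1}" for x
  proof -
    define T where "T = (if x < 0 then {..<0::real} else {1<..})"
    have T: "open T" "x \<in> T" using that by (auto simp: T_def)
    have "smooth_step x = smooth_step y" if "y \<in> T" for y
      using that T(2) smooth_step_0 smooth_step_1 by (auto simp: T_def split: if_splits)
    then have "(smooth_step has_real_derivative 0) (at x)"
      using has_field_derivative_transform_within_open[OF DERIV_const T] by blast
    then show ?thesis using S(1) DERIV_unique by blast
  qed
  have S20: "S2 x = 0" if "x \<notin> {0..1}" for x
  proof -
    have "(S1 has_real_derivative 0) (at x)"
      by (rule has_field_derivative_transform_within_open[of "\<lambda>_. 0" _ _ "- {0..1}"])
        (use that S10 in auto)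
    then show ?thesis using S(2) DERIV_unique by blast
  qed
  have "bounded (S1 ` {0..1})" "bounded (S2 ` {0..1})"
    by (intro compact_imp_bounded compact_continuous_image continuous_on_subset[OF cont(1)]
        continuous_on_subset[OF cont(2)]; simp)+
  then obtain C1 C2 where C12: "\<forall>x\<in>{0..1}. \<bar>S1 x\<bar> \<le> C1" "\<forall>x\<in>{0..1}. \<bar>S2 x\<bar> \<le> C2"
    by (auto simp: bounded_iff)
  define C where "C = max 1 (max C1 C2)"
  have C: "C > 0" "\<And>x. x \<in> {0..1} \<Longrightarrow> \<bar>S1 x\<bar> \<le> C" "\<And>x. x \<in> {0..1} \<Longrightarrow> \<bar>S2 x\<bar> \<le> C"
    using C12 by (auto simp: C_def le_max_iff_disj)
  define d where "d k = min 1 (min (M k) (\<epsilon> * (1/2) ^ Suc k / (C * (real k + 2))))" for k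
  define c where "c k = Min (d ` {..k})" for k
  have d0: "d k > 0" for k using M[of k] C(1) \<epsilon> by (simp add: d_def)
  have c0: "c k > 0" for k using d0 by (simp add: c_def)
  have cd: "c k \<le> d j" if "j \<le> k" for j k using that by (simp add: c_def)
  have cmono: "c k \<le> c j" if "j \<le> k" for j k
    unfolding c_def using that by (intro Min_antimono) auto
  define e where "e k = c k - c (Suc k)" for k
  have e: "0 \<le> e k" "e k \<le> c k" for k using cmono[of k "Suc k"] c0[of "Suc k"] by (auto simp: e_def)
  define P where "P n s = c 0 - (\<Sum>k<n. e k * smooth_step (s - real k))" for n :: nat and s
  define R where "R s = P (nat \<lceil>s\<rceil>) s" for s
  have PR: "R s = P n s" if "s \<le> real n" for n s
  proof -
    have "(\<Sum>k<n. e k * smooth_step (s - real k)) = (\<Sum>k<nat \<lceil>s\<rceil>. e k * smooth_step (s - real k))"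
    proof (rule sum.mono_neutral_right)
      show "\<forall>i\<in>{..<n} - {..<nat \<lceil>s\<rceil>}. e i * smooth_step (s - real i) = 0"
        by (auto simp: nat_le_iff ceiling_le_iff smooth_step_0 not_less)
      show "{..<nat \<lceil>s\<rceil>} \<subseteq> {..<n}" using that by (auto simp: nat_le_iff ceiling_le_iff)
    qed simp
    then show ?thesis by (simp add: R_def P_def)
  qed
  have PR': "P n s = R s" if "s < real n" for n s using PR[of s n] that by simp
  have sm: "smooth_on UNIV (P n)" for n
    unfolding P_def[abs_def]
  proof (intro smooth_on_diff smooth_on_sum smooth_on_const open_UNIV smooth_on_mult)
    fix k show "smooth_on UNIV (\<lambda>s. smooth_step (s - real k))"
      by (rule smooth_on_compose[OF open_UNIV open_UNIV _ _ smooth_step_smooth])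
        (auto intro!: smooth_on_diff smooth_on_id smooth_on_const)
  qed
  have smR: "smooth_on UNIV R"
  proof (rule smooth_on_local)
    fix s :: real
    obtain n where n: "s < real n" using reals_Archimedean2 by blast
    show "\<exists>T g. open T \<and> s \<in> T \<and> smooth_on T g \<and> (\<forall>y\<in>T. g y = R y)"
      by (rule exI[of _ "{..<real n}"], rule exI[of _ "P n"])
        (use n PR' smooth_on_subset[OF sm] in auto)
  qed
  obtain R1 R2 where R12: "\<And>x. (R has_real_derivative R1 x) (at x)"
    "\<And>x. (R1 has_real_derivative R2 x) (at x)"
    by (rule smooth_on_real_has_derivs[OF smR open_UNIV]) auto
  have R1: "R1 s = - (\<Sum>k<n. e k * S1 (s - real k))" if "s < real n" for n s
  proof -
    have "((\<lambda>s. smooth_step (s - real k)) has_real_derivative S1 (s - real k)) (at s)" for k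
      using DERIV_shift[of smooth_step "S1 (s - real k)" s "- real k"] S(1) by simp
    then have "(P n has_real_derivative - (\<Sum>k<n. e k * S1 (s - real k))) (at s)"
      unfolding P_def[abs_def] by (auto intro!: derivative_eq_intros simp: mult.commute)
    then have "(R has_real_derivative - (\<Sum>k<n. e k * S1 (s - real k))) (at s)"
      by (rule has_field_derivative_transform_within_open[where S="{..<real n}"]) (use that PR' in auto)
    then show ?thesis using R12(1) DERIV_unique by blast
  qed
  have R2: "R2 s = - (\<Sum>k<n. e k * S2 (s - real k))" if "s < real n" for n s
  proof -
    have "((\<lambda>s. S1 (s - real k)) has_real_derivative S2 (s - real k)) (at s)" for k
      using DERIV_shift[of S1 "S2 (s - real k)" s "- real k"] S(2) by simp
    then have "((\<lambda>s. - (\<Sum>k<n. e k * S1 (s - real k))) has_real_derivative - (\<Sum>k<n. e k * S2 (s - real k))) (at s)"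
      by (auto intro!: derivative_eq_intros simp: mult.commute)
    then have "(R1 has_real_derivative - (\<Sum>k<n. e k * S2 (s - real k))) (at s)"
      by (rule has_field_derivative_transform_within_open[where S="{..<real n}"]) (use that R1 in auto)
    then show ?thesis using R12(2) DERIV_unique by blast
  qed
  have bnd: "(1 + s) * \<bar>- (\<Sum>k<n. e k * D (s - real k))\<bar> \<le> \<epsilon>"
    if "s \<ge> 0" "\<And>x. x \<in> {0..1} \<Longrightarrow> \<bar>D x\<bar> \<le> C" "\<And>x. x \<notin> {0..1} \<Longrightarrow> D x = 0" for D s and n :: nat
  proof -
    have t: "(1 + s) * \<bar>e k * D (s - real k)\<bar> \<le> \<epsilon> * (1/2) ^ Suc k" for k
    proof (cases "s - real k \<in> {0..1}")
      case True
      have "e k * (C * (real k + 2)) \<le> \<epsilon> * (1/2) ^ Suc k"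
      proof -
        have "e k \<le> \<epsilon> * (1/2) ^ Suc k / (C * (real k + 2))"
          using e(2)[of k] cd[of k k] by (simp add: d_def)
        moreover have "C * (real k + 2) > 0" using C(1) by simp
        ultimately show ?thesis by (simp only: pos_le_divide_eq)
      qed
      moreover have "(1 + s) * \<bar>e k * D (s - real k)\<bar> \<le> (real k + 2) * (e k * C)"
        unfolding abs_mult using True that e(1)[of k] C(1)
        by (intro mult_mono) auto
      moreover have "(real k + 2) * (e k * C) = e k * (C * (real k + 2))" by simp
      ultimately show ?thesis by linarith
    next
      case False
      then show ?thesis using that(3) \<epsilon> by simp
    qed
    have "(1 + s) * \<bar>- (\<Sum>k<n. e k * D (s - real k))\<bar> \<le> (1 + s) * (\<Sum>k<n. \<bar>e k * D (s - real k)\<bar>)"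
      using that(1) by (intro mult_left_mono) auto
    also have "\<dots> \<le> (\<Sum>k<n. \<epsilon> * (1/2) ^ Suc k)"
      unfolding sum_distrib_left by (rule sum_mono) (rule t)
    also have "\<dots> = \<epsilon> * (1 - (1/2) ^ n)"
    proof (induction n)
      case (Suc n) then show ?case by (simp add: algebra_simps)
    qed simp
    also have "\<dots> \<le> \<epsilon>" using \<epsilon> by (simp add: mult_le_cancel_left1)
    finally show ?thesis .
  qed
  have tele: "(\<Sum>k<n. e k) = c 0 - c n" for n
    by (induction n) (auto simp: e_def)
  show ?thesis
  proof (rule that[OF smR _ _ _ R12])
    show "0 < R s" for s
    proof -
      obtain n where n: "s \<le> real n" using real_arch_simple by blast
      have "(\<Sum>k<n. e k * smooth_step (s - real k)) \<le> (\<Sum>k<n. e k)"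
        by (rule sum_mono) (simp add: mult_left_le e smooth_step_range)
      then show ?thesis using PR[OF n] c0[of n] by (simp add: P_def tele)
    qed
    show "R s \<le> M k" if "real k \<le> s" for k s
    proof -
      obtain n where n: "s \<le> real n" using real_arch_simple by blast
      then have kn: "k \<le> n" using that by linarith
      have "(\<Sum>j<k. e j) = (\<Sum>j<k. e j * smooth_step (s - real j))"
        by (rule sum.cong) (use that in \<open>auto simp: smooth_step_1\<close>)
      also have "\<dots> \<le> (\<Sum>j<n. e j * smooth_step (s - real j))"
        by (rule sum_mono2) (use kn in \<open>auto simp: e smooth_step_range\<close>)
      finally have "R s \<le> c k" using PR[OF n] by (simp add: P_def tele)
      then show ?thesis using cd[of k k] by (simp add: d_def)
    qed
    show "R s \<le> 1" for s
    proof -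
      have "0 \<le> (\<Sum>k<nat \<lceil>s\<rceil>. e k * smooth_step (s - real k))"
        by (rule sum_nonneg) (simp add: e smooth_step_range)
      then show ?thesis using cd[of 0 0] by (simp add: R_def P_def d_def)
    qed
    fix s :: real assume s: "s \<ge> 0"
    obtain n where n: "s < real n" using reals_Archimedean2 by blast
    show "(1 + s) * \<bar>R1 s\<bar> \<le> \<epsilon>" unfolding R1[OF n] using s C(2) S10 by (rule bnd)
    show "(1 + s) * \<bar>R2 s\<bar> \<le> \<epsilon>" unfolding R2[OF n] using s C(3) S20 by (rule bnd)
  qed
qed

section \<open>Two-jets of curves\<close>

text \<open>Second derivatives of maps are handled through the curves on which they act, so that all the
  estimates are those of functions of one variable; \<open>p\<close> and \<open>q\<close> are the velocity and the
  acceleration of the curve at time \<open>0\<close>.\<close>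

definition jet2 :: "(real \<Rightarrow> 'b::real_normed_vector) \<Rightarrow> 'b \<Rightarrow> 'b \<Rightarrow> bool" where
  "jet2 g p q \<longleftrightarrow> (\<exists>g'. (\<forall>\<^sub>F s in nhds 0. (g has_vector_derivative g' s) (at s)) \<and> g' 0 = p \<and>
     (g' has_vector_derivative q) (at 0))"

lemma jet2I:
  assumes "\<forall>\<^sub>F s in nhds 0. (g has_vector_derivative g' s) (at s)" "g' 0 = p" "(g' has_vector_derivative q) (at 0)"
  shows "jet2 g p q"
  using assms unfolding jet2_def by blast

lemma jet2_has_vector_derivative: "jet2 g p q \<Longrightarrow> (g has_vector_derivative p) (at 0)"
  unfolding jet2_def using eventually_nhds_x_imp_x by blast

lemma jet2_isCont: "jet2 g p q \<Longrightarrow> isCont g 0"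
  using jet2_has_vector_derivative has_vector_derivative_continuous by blast

lemma eventually_nhds_isCont:
  "isCont f y \<Longrightarrow> \<forall>\<^sub>F s in nhds (f y). P s \<Longrightarrow> \<forall>\<^sub>F y' in nhds y. P (f y')"
  unfolding isCont_def tendsto_at_iff_tendsto_nhds unfolding filterlim_iff by blast

lemma has_vector_derivative_ev_cong:
  assumes "(f has_vector_derivative d) (at (x::real))" "\<forall>\<^sub>F s in nhds x. f s = g s"
  shows "(g has_vector_derivative d) (at x)"
proof -
  obtain T where "open T" "x \<in> T" "\<And>s. s \<in> T \<Longrightarrow> f s = g s" using assms(2) by (auto simp: eventually_nhds)
  then show ?thesis using has_vector_derivative_transform_within_open[OF assms(1)] by blast
qed

lemma jet2_cong:
  assumes "jet2 f p q" "\<forall>\<^sub>F s in nhds 0. f s = g s"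
  shows "jet2 g p q"
proof -
  obtain f' where f: "\<forall>\<^sub>F s in nhds 0. (f has_vector_derivative f' s) (at s)" "f' 0 = p"
     "(f' has_vector_derivative q) (at 0)" using assms(1) by (auto simp: jet2_def)
  have "\<forall>\<^sub>F s in nhds 0. \<forall>\<^sub>F t in nhds s. f t = g t" using assms(2) by (simp add: eventually_eventually)
  with f(1) have "\<forall>\<^sub>F s in nhds 0. (g has_vector_derivative f' s) (at s)"
    by eventually_elim (rule has_vector_derivative_ev_cong)
  then show ?thesis using f by (auto intro: jet2I)
qed

lemma jet2_unique:
  assumes "jet2 g p q" "jet2 g r s"
  shows "p = r \<and> q = s"
proof -
  obtain g1 where 1: "\<forall>\<^sub>F s in nhds 0. (g has_vector_derivative g1 s) (at s)" "g1 0 = p"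
     "(g1 has_vector_derivative q) (at 0)" using assms(1) by (auto simp: jet2_def)
  obtain g2 where 2: "\<forall>\<^sub>F s in nhds 0. (g has_vector_derivative g2 s) (at s)" "g2 0 = r"
     "(g2 has_vector_derivative s) (at 0)" using assms(2) by (auto simp: jet2_def)
  from 1(1) 2(1) have ev: "\<forall>\<^sub>F s in nhds 0. g1 s = g2 s"
    by eventually_elim (rule vector_derivative_unique_at)
  then have "g1 0 = g2 0" by (rule eventually_nhds_x_imp_x)
  moreover have "q = s" using has_vector_derivative_ev_cong[OF 1(3) ev] 2(3) vector_derivative_unique_at by blast
  ultimately show ?thesis using 1 2 by simp
qed

lemma jet2_const: "jet2 (\<lambda>s. c) 0 0"
  by (rule jet2I[where g'="\<lambda>_. 0"]) auto

lemma jet2_bounded_linear: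
  assumes "bounded_linear L" "jet2 g p q"
  shows "jet2 (\<lambda>s. L (g s)) (L p) (L q)"
proof -
  obtain g' where g: "\<forall>\<^sub>F s in nhds 0. (g has_vector_derivative g' s) (at s)" "g' 0 = p"
     "(g' has_vector_derivative q) (at 0)" using assms(2) by (auto simp: jet2_def)
  show ?thesis
  proof (rule jet2I[where g'="\<lambda>s. L (g' s)"])
    show "\<forall>\<^sub>F s in nhds 0. ((\<lambda>s. L (g s)) has_vector_derivative L (g' s)) (at s)"
      using g(1) by eventually_elim (rule bounded_linear.has_vector_derivative[OF assms(1)])
  qed (use g bounded_linear.has_vector_derivative[OF assms(1)] in auto)
qed

lemma jet2_add:
  assumes "jet2 f p q" "jet2 g r s"
  shows "jet2 (\<lambda>t. f t + g t) (p + r) (q + s)"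
proof -
  obtain f' where f: "\<forall>\<^sub>F s in nhds 0. (f has_vector_derivative f' s) (at s)" "f' 0 = p"
     "(f' has_vector_derivative q) (at 0)" using assms(1) by (auto simp: jet2_def)
  obtain g' where g: "\<forall>\<^sub>F s in nhds 0. (g has_vector_derivative g' s) (at s)" "g' 0 = r"
     "(g' has_vector_derivative s) (at 0)" using assms(2) by (auto simp: jet2_def)
  show ?thesis
  proof (rule jet2I[where g'="\<lambda>s. f' s + g' s"])
    show "\<forall>\<^sub>F s in nhds 0. ((\<lambda>t. f t + g t) has_vector_derivative f' s + g' s) (at s)"
      using f(1) g(1) by eventually_elim (rule has_vector_derivative_add)
  qed (use f g in \<open>auto intro: has_vector_derivative_add\<close>)
qed

lemma jet2_bilinear:
  assumes "bounded_bilinear pr" "jet2 f p q" "jet2 g r s"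
  shows "jet2 (\<lambda>t. pr (f t) (g t)) (pr (f 0) r + pr p (g 0)) (pr (f 0) s + 2 *\<^sub>R pr p r + pr q (g 0))"
proof -
  obtain f' where f: "\<forall>\<^sub>F s in nhds 0. (f has_vector_derivative f' s) (at s)" "f' 0 = p"
     "(f' has_vector_derivative q) (at 0)" using assms(2) by (auto simp: jet2_def)
  obtain g' where g: "\<forall>\<^sub>F s in nhds 0. (g has_vector_derivative g' s) (at s)" "g' 0 = r"
     "(g' has_vector_derivative s) (at 0)" using assms(3) by (auto simp: jet2_def)
  note bil = bounded_bilinear.has_vector_derivative[OF assms(1)]
  have f0: "(f has_vector_derivative p) (at 0)" and g0: "(g has_vector_derivative r) (at 0)"
    using assms jet2_has_vector_derivative by blast+
  show ?thesis
  proof (rule jet2I[where g'="\<lambda>s. pr (f s) (g' s) + pr (f' s) (g s)"])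
    show "\<forall>\<^sub>F s in nhds 0. ((\<lambda>t. pr (f t) (g t)) has_vector_derivative pr (f s) (g' s) + pr (f' s) (g s)) (at s)"
      using f(1) g(1) by eventually_elim (rule bil)
    have "((\<lambda>s. pr (f s) (g' s) + pr (f' s) (g s)) has_vector_derivative
        (pr (f 0) s + pr p (g' 0)) + (pr (f' 0) r + pr q (g 0))) (at 0)"
      by (rule has_vector_derivative_add[OF bil[OF f0 g(3)] bil[OF f(3) g0]])
    then show "((\<lambda>s. pr (f s) (g' s) + pr (f' s) (g s)) has_vector_derivative
        pr (f 0) s + 2 *\<^sub>R pr p r + pr q (g 0)) (at 0)"
      using f(2) g(2) by (simp add: scaleR_2 algebra_simps)
  qed (use f g in auto)
qed

lemma jet2_mult:
  fixes f g :: "real \<Rightarrow> real"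
  assumes "jet2 f p q" "jet2 g r s"
  shows "jet2 (\<lambda>t. f t * g t) (f 0 * r + p * g 0) (f 0 * s + 2 * (p * r) + q * g 0)"
  using jet2_bilinear[OF bounded_bilinear_mult assms] by simp

lemma jet2_compose:
  fixes f :: "real \<Rightarrow> real"
  assumes "jet2 f p q" "open S" "f 0 \<in> S"
    and d: "\<And>x. x \<in> S \<Longrightarrow> (h has_real_derivative h1 x) (at x)"
    and d2: "(h1 has_real_derivative h2) (at (f 0))"
  shows "jet2 (\<lambda>t. h (f t)) (h1 (f 0) * p) (h2 * p\<^sup>2 + h1 (f 0) * q)"
proof -
  obtain f' where f: "\<forall>\<^sub>F s in nhds 0. (f has_vector_derivative f' s) (at s)" "f' 0 = p"
     "(f' has_vector_derivative q) (at 0)" using assms(1) by (auto simp: jet2_def)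
  have f0: "(f has_real_derivative p) (at 0)"
    using jet2_has_vector_derivative[OF assms(1)] by (simp add: has_real_derivative_iff_has_vector_derivative)
  have ev: "\<forall>\<^sub>F s in nhds 0. f s \<in> S"
    using jet2_isCont[OF assms(1)] assms(2,3)
    by (simp add: isCont_def eventually_nhds_conv_at topological_tendstoD)
  show ?thesis
  proof (rule jet2I[where g'="\<lambda>s. h1 (f s) * f' s"])
    show "\<forall>\<^sub>F s in nhds 0. ((\<lambda>t. h (f t)) has_vector_derivative h1 (f s) * f' s) (at s)"
      using f(1) ev
    proof eventually_elim
      case (elim s)
      then show ?case
        using DERIV_chain2[where f=h and g=f and x=s and Da="h1 (f s)" and Db="f' s"] d[of "f s"] by (simp add: has_real_derivative_iff_has_vector_derivative)
    qed
    have "((\<lambda>s. h1 (f s)) has_real_derivative h2 * p) (at 0)" by (rule DERIV_chain2[OF d2 f0])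
    moreover have "(f' has_real_derivative q) (at 0)" using f(3) by (simp add: has_real_derivative_iff_has_vector_derivative)
    ultimately have "((\<lambda>s. h1 (f s) * f' s) has_real_derivative h2 * p * f' 0 + q * h1 (f 0)) (at 0)"
      by (rule DERIV_mult)
    then show "((\<lambda>s. h1 (f s) * f' s) has_vector_derivative h2 * p\<^sup>2 + h1 (f 0) * q) (at 0)"
      using f(2) by (simp add: has_real_derivative_iff_has_vector_derivative power2_eq_square algebra_simps)
  qed (use f in auto)
qed

text \<open>The differential is linear in the direction at all points near \<open>u\<close>, and this identity can be
  differentiated.\<close>

lemma second_derivative_linear:
  fixes F :: "'e::euclidean_space \<Rightarrow> 'b::real_normed_vector"
  assumes sm: "smooth_on S F" and S: "open S" "u \<in> S"
  shows "frechet_derivative (\<lambda>p. frechet_derivative F (at p) v) (at u) x =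
    (\<Sum>b\<in>Basis. (v \<bullet> b) *\<^sub>R frechet_derivative (\<lambda>p. frechet_derivative F (at p) b) (at u) x)"
proof -
  have "((\<lambda>p. \<Sum>b\<in>Basis. (v \<bullet> b) *\<^sub>R frechet_derivative F (at p) b) has_derivative
      (\<lambda>x. \<Sum>b\<in>Basis. (v \<bullet> b) *\<^sub>R frechet_derivative (\<lambda>p. frechet_derivative F (at p) b) (at u) x)) (at u)"
    by (intro has_derivative_sum has_derivative_scaleR_right smooth_on_has_derivative[OF smooth_on_derivative[OF sm] S(2)])
  then have "((\<lambda>p. frechet_derivative F (at p) v) has_derivative
      (\<lambda>x. \<Sum>b\<in>Basis. (v \<bullet> b) *\<^sub>R frechet_derivative (\<lambda>p. frechet_derivative F (at p) b) (at u) x)) (at u)"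
  proof (rule has_derivative_transform_within_open[OF _ S])
    fix p assume "p \<in> S"
    then have lin: "linear (frechet_derivative F (at p))"
      by (intro linear_frechet_derivative smooth_on_imp_differentiable[OF sm])
    have "(\<Sum>b\<in>Basis. (v \<bullet> b) *\<^sub>R frechet_derivative F (at p) b) = frechet_derivative F (at p) (\<Sum>b\<in>Basis. (v \<bullet> b) *\<^sub>R b)"
      using lin by (simp add: linear_sum linear_scale)
    then show "(\<Sum>b\<in>Basis. (v \<bullet> b) *\<^sub>R frechet_derivative F (at p) b) = frechet_derivative F (at p) v"
      by (simp only: euclidean_representation)
  qed
  from fun_cong[OF frechet_derivative_at[OF this], of x] show ?thesis by (rule sym)
qed

text \<open>A curve of acceleration \<open>q\<close> sees a first derivative in the direction \<open>q\<close> besides the second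
  derivative; by the choice of \<open>q\<close> a tangential part of the second derivative can thus be
  removed, which is what passing to the second fundamental form does.\<close>

lemma jet2_smooth_compose:
  fixes F :: "'e::euclidean_space \<Rightarrow> 'b::real_normed_vector"
  assumes sm: "smooth_on S F" and S: "open S" "\<gamma> 0 \<in> S" and j: "jet2 \<gamma> p q"
  shows "jet2 (\<lambda>s. F (\<gamma> s)) (frechet_derivative F (at (\<gamma> 0)) p)
    (frechet_derivative (\<lambda>x. frechet_derivative F (at x) p) (at (\<gamma> 0)) p + frechet_derivative F (at (\<gamma> 0)) q)"
proof -
  define D where "D b x = frechet_derivative F (at x) b" for x b
  have lin: "linear (\<lambda>b. D b x)" if "x \<in> S" for x
    unfolding D_def using smooth_on_imp_differentiable[OF sm that] by (rule linear_frechet_derivative)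
  have rep: "D v x = (\<Sum>b\<in>Basis. (v \<bullet> b) *\<^sub>R D b x)" if "x \<in> S" for v x
  proof -
    have "(\<Sum>b\<in>Basis. (v \<bullet> b) *\<^sub>R D b x) = D (\<Sum>b\<in>Basis. (v \<bullet> b) *\<^sub>R b) x"
      using linear_sum[OF lin[OF that], of "\<lambda>b. (v \<bullet> b) *\<^sub>R b" Basis] linear_scale[OF lin[OF that]] by simp
    then show ?thesis by (simp only: euclidean_representation)
  qed
  obtain g where g: "\<forall>\<^sub>F s in nhds 0. (\<gamma> has_vector_derivative g s) (at s)" "g 0 = p"
     "(g has_vector_derivative q) (at 0)" using j by (auto simp: jet2_def)
  have ev: "\<forall>\<^sub>F s in nhds 0. \<gamma> s \<in> S"
    by (rule eventually_nhds_isCont[OF jet2_isCont[OF j]]) (use S eventually_nhds_in_open in blast)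
  show ?thesis
  proof (rule jet2I[where g'="\<lambda>s. \<Sum>b\<in>Basis. (g s \<bullet> b) *\<^sub>R D b (\<gamma> s)"])
    show "\<forall>\<^sub>F s in nhds 0. ((\<lambda>s. F (\<gamma> s)) has_vector_derivative (\<Sum>b\<in>Basis. (g s \<bullet> b) *\<^sub>R D b (\<gamma> s))) (at s)"
      using g(1) ev
    proof eventually_elim
      case (elim s)
      have "(F has_derivative (\<lambda>v. D v (\<gamma> s))) (at (\<gamma> s))"
        unfolding D_def by (rule smooth_on_has_derivative[OF sm elim(2)])
      from vector_derivative_diff_chain_within[OF elim(1) has_derivative_at_withinI[OF this]]
      show ?case using rep[OF elim(2), of "g s"] by (simp add: o_def)
    qed
    show "(\<Sum>b\<in>Basis. (g 0 \<bullet> b) *\<^sub>R D b (\<gamma> 0)) = frechet_derivative F (at (\<gamma> 0)) p"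
      using rep[OF S(2), of p] g(2) by (simp add: D_def)
    have Dd: "((\<lambda>s. D b (\<gamma> s)) has_vector_derivative frechet_derivative (D b) (at (\<gamma> 0)) p) (at 0)" for b
    proof -
      have "(D b has_derivative frechet_derivative (D b) (at (\<gamma> 0))) (at (\<gamma> 0))"
        using smooth_on_has_derivative[OF smooth_on_derivative[OF sm, of b] S(2)] by (simp add: D_def[abs_def])
      from vector_derivative_diff_chain_within[OF jet2_has_vector_derivative[OF j] has_derivative_at_withinI[OF this]]
      show ?thesis by (simp add: o_def)
    qed
    have gd: "((\<lambda>s. g s \<bullet> b) has_real_derivative q \<bullet> b) (at 0)" for b
      using bounded_linear.has_vector_derivative[OF bounded_linear_inner_left g(3)]
      by (simp add: has_real_derivative_iff_has_vector_derivative)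
    have "((\<lambda>s. \<Sum>b\<in>Basis. (g s \<bullet> b) *\<^sub>R D b (\<gamma> s)) has_vector_derivative
        (\<Sum>b\<in>Basis. (g 0 \<bullet> b) *\<^sub>R frechet_derivative (D b) (at (\<gamma> 0)) p + (q \<bullet> b) *\<^sub>R D b (\<gamma> 0))) (at 0)"
      by (intro has_vector_derivative_sum has_vector_derivative_scaleR gd Dd)
    moreover have "(\<Sum>b\<in>Basis. (g 0 \<bullet> b) *\<^sub>R frechet_derivative (D b) (at (\<gamma> 0)) p + (q \<bullet> b) *\<^sub>R D b (\<gamma> 0)) =
       frechet_derivative (D p) (at (\<gamma> 0)) p + D q (\<gamma> 0)"
      using second_derivative_linear[OF sm S, of p p] rep[OF S(2), of q] g(2)
      by (simp add: sum.distrib D_def[abs_def])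
    ultimately show "((\<lambda>s. \<Sum>b\<in>Basis. (g s \<bullet> b) *\<^sub>R D b (\<gamma> s)) has_vector_derivative
       frechet_derivative (\<lambda>x. frechet_derivative F (at x) p) (at (\<gamma> 0)) p + frechet_derivative F (at (\<gamma> 0)) q) (at 0)"
      by (simp add: D_def[abs_def])
  qed
qed

lemma jet2_parabola: "jet2 (\<lambda>s. u + s *\<^sub>R v + (s\<^sup>2 / 2) *\<^sub>R w) v w"
proof (rule jet2I[where g'="\<lambda>s. v + s *\<^sub>R w"])
  have "((\<lambda>s. u + s *\<^sub>R v + (s\<^sup>2 / 2) *\<^sub>R w) has_vector_derivative v + s *\<^sub>R w) (at s)" for s
    unfolding has_vector_derivative_def by (auto intro!: derivative_eq_intros simp: algebra_simps)
  then show "\<forall>\<^sub>F s in nhds 0. ((\<lambda>s. u + s *\<^sub>R v + (s\<^sup>2 / 2) *\<^sub>R w) has_vector_derivative v + s *\<^sub>R w) (at s)"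
    by simp
  show "((\<lambda>s. v + s *\<^sub>R w) has_vector_derivative w) (at 0)"
    unfolding has_vector_derivative_def by (auto intro!: derivative_eq_intros)
qed simp

section \<open>A spherical design\<close>

lemma sum_Pow_insert:
  fixes g :: "'b set \<Rightarrow> real"
  assumes "finite B" "x \<notin> B"
  shows "(\<Sum>A\<in>Pow (insert x B). g A) = (\<Sum>A\<in>Pow B. g A + g (insert x A))"
proof -
  have "inj_on (insert x) (Pow B)" using assms(2) by (auto simp: inj_on_def)
  moreover have "Pow B \<inter> insert x ` Pow B = {}" using assms(2) by auto
  ultimately show ?thesis
    using assms(1) by (simp add: Pow_insert sum.union_disjoint sum.reindex sum.distrib)
qed

lemma sign_sum_moments:
  fixes f :: "'b \<Rightarrow> real"
  assumes "finite B"
  defines "t \<equiv> \<lambda>B A. \<Sum>b\<in>B. (if b \<in> A then 1 else - 1) * f b"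
  shows "(\<Sum>A\<in>Pow B. (t B A)\<^sup>2) = 2 ^ card B * (\<Sum>b\<in>B. (f b)\<^sup>2)"
    and "(\<Sum>A\<in>Pow B. (t B A) ^ 4) = 2 ^ card B * (3 * (\<Sum>b\<in>B. (f b)\<^sup>2)\<^sup>2 - 2 * (\<Sum>b\<in>B. f b ^ 4))"
proof -
  have "(\<Sum>A\<in>Pow B. (t B A)\<^sup>2) = 2 ^ card B * (\<Sum>b\<in>B. (f b)\<^sup>2) \<and>
     (\<Sum>A\<in>Pow B. (t B A) ^ 4) = 2 ^ card B * (3 * (\<Sum>b\<in>B. (f b)\<^sup>2)\<^sup>2 - 2 * (\<Sum>b\<in>B. f b ^ 4))"
    using assms(1)
  proof (induction B rule: finite_induct)
    case empty then show ?case by (simp add: t_def)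
  next
    case (insert x B)
    have t1: "t (insert x B) A = t B A - f x" if "A \<in> Pow B" for A
      using that insert.hyps by (auto simp: t_def)
    have t2: "t (insert x B) (insert x A) = t B A + f x" if "A \<in> Pow B" for A
    proof -
      have "(\<Sum>b\<in>B. (if b \<in> insert x A then 1 else - 1) * f b) = t B A"
        unfolding t_def using insert.hyps by (intro sum.cong) auto
      then show ?thesis using insert.hyps by (simp add: t_def)
    qed
    have e2: "(s - a)\<^sup>2 + (s + a)\<^sup>2 = 2 * s\<^sup>2 + 2 * a\<^sup>2" and
      e4: "(s - a) ^ 4 + (s + a) ^ 4 = 2 * s ^ 4 + (12 * a\<^sup>2) * s\<^sup>2 + 2 * a ^ 4" for s a :: real
      by (simp_all add: power2_eq_square power4_eq_xxxx algebra_simps)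
    have "(\<Sum>A\<in>Pow (insert x B). (t (insert x B) A)\<^sup>2) = (\<Sum>A\<in>Pow B. 2 * (t B A)\<^sup>2 + 2 * (f x)\<^sup>2)"
      unfolding sum_Pow_insert[OF insert.hyps] by (rule sum.cong) (simp_all add: t1 t2 e2)
    also have "\<dots> = 2 * (2 ^ card B * (\<Sum>b\<in>B. (f b)\<^sup>2)) + 2 ^ card B * (2 * (f x)\<^sup>2)"
      using insert.IH insert.hyps by (simp add: sum.distrib sum_distrib_left[symmetric] card_Pow)
    finally have 1: "(\<Sum>A\<in>Pow (insert x B). (t (insert x B) A)\<^sup>2) = 2 ^ card (insert x B) * (\<Sum>b\<in>insert x B. (f b)\<^sup>2)"
      using insert.hyps by (simp add: algebra_simps)
    have "(\<Sum>A\<in>Pow (insert x B). (t (insert x B) A) ^ 4) = (\<Sum>A\<in>Pow B. 2 * (t B A) ^ 4 + (12 * (f x)\<^sup>2) * (t B A)\<^sup>2 + 2 * f x ^ 4)"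
      unfolding sum_Pow_insert[OF insert.hyps] by (rule sum.cong) (simp_all add: t1 t2 e4)
    also have "\<dots> = 2 * (2 ^ card B * (3 * (\<Sum>b\<in>B. (f b)\<^sup>2)\<^sup>2 - 2 * (\<Sum>b\<in>B. f b ^ 4)))
        + (12 * (f x)\<^sup>2) * (2 ^ card B * (\<Sum>b\<in>B. (f b)\<^sup>2)) + 2 ^ card B * (2 * f x ^ 4)"
      using insert.IH insert.hyps by (simp add: sum.distrib sum_distrib_left[symmetric] card_Pow)
    also have "\<dots> = 2 ^ card (insert x B) * (3 * ((f x)\<^sup>2 + (\<Sum>b\<in>B. (f b)\<^sup>2))\<^sup>2 - 2 * (f x ^ 4 + (\<Sum>b\<in>B. f b ^ 4)))"
      using insert.hyps by (simp add: power2_eq_square power4_eq_xxxx algebra_simps)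
    finally show ?case using 1 insert.hyps by simp
  qed
  then show "(\<Sum>A\<in>Pow B. (t B A)\<^sup>2) = 2 ^ card B * (\<Sum>b\<in>B. (f b)\<^sup>2)"
    "(\<Sum>A\<in>Pow B. (t B A) ^ 4) = 2 ^ card B * (3 * (\<Sum>b\<in>B. (f b)\<^sup>2)\<^sup>2 - 2 * (\<Sum>b\<in>B. f b ^ 4))"
    by auto
qed

text \<open>The fourth moment of the vertices of the cube falls short of that of the sphere by a multiple of
  the sum of the fourth powers of the coordinates, which the vertices of the cross-polytope supply.
  Both sets lie on the sphere of radius \<open>sqrt m\<close>.\<close>

lemma spherical_design:
  obtains L :: "('e::euclidean_space set + 'e) set" and w :: "'e set + 'e \<Rightarrow> real" and u :: "'e set + 'e \<Rightarrow> 'e"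
  where "finite L" "\<And>l. 0 \<le> w l" "(\<Sum>l\<in>L. w l) = 1"
    "\<And>y. (\<Sum>l\<in>L. w l * (u l \<bullet> y)\<^sup>2) = (norm y)\<^sup>2"
    "\<And>y. (\<Sum>l\<in>L. w l * (u l \<bullet> y) ^ 4) = 3 * real DIM('e) / (real DIM('e) + 2) * norm y ^ 4"
proof -
  define m where "m = real DIM('e)"
  have m: "m > 0" by (simp add: m_def)
  define L :: "('e set + 'e) set" where "L = Inl ` Pow Basis \<union> Inr ` Basis"
  define w1 where "w1 = m / (m + 2) / 2 ^ DIM('e)"
  define w2 where "w2 = 2 / (m * (m + 2))"
  define w :: "'e set + 'e \<Rightarrow> real" where
    "w = case_sum (\<lambda>_. w1) (\<lambda>_. w2)"
  define u :: "'e set + 'e \<Rightarrow> 'e" where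
    "u = case_sum (\<lambda>A. \<Sum>b\<in>Basis. (if b \<in> A then 1 else - 1) *\<^sub>R b) (\<lambda>b. sqrt m *\<^sub>R b)"
  have split: "(\<Sum>l\<in>L. g l) = (\<Sum>A\<in>Pow Basis. g (Inl A)) + (\<Sum>b\<in>Basis. g (Inr b))" for g :: "'e set + 'e \<Rightarrow> real"
    unfolding L_def by (subst sum.union_disjoint) (auto simp: sum.reindex)
  have uA: "u (Inl A) \<bullet> y = (\<Sum>b\<in>Basis. (if b \<in> A then 1 else - 1) * (y \<bullet> b))" for A y
    by (simp add: u_def inner_sum_left) (simp add: inner_commute)
  have ub: "u (Inr b) \<bullet> y = sqrt m * (y \<bullet> b)" for b y
    by (simp add: u_def inner_commute)
  have n2: "(\<Sum>b\<in>Basis. (y \<bullet> b)\<^sup>2) = (norm y)\<^sup>2" for y :: 'e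
    by (simp add: norm_eq_sqrt_inner euclidean_inner[of y y] power2_eq_square sum_nonneg)
  have s4: "sqrt m ^ 4 = m\<^sup>2" using m by (simp add: power4_eq_xxxx power2_eq_square)
  have one: "m / (m + 2) + 2 / (m + 2) = 1"
  proof -
    have "m / (m + 2) + 2 / (m + 2) = (m + 2) / (m + 2)" unfolding add_divide_distrib ..
    also have "\<dots> = 1" using m by (intro divide_self) simp
    finally show ?thesis .
  qed
  show ?thesis
  proof (rule that[of L w u])
    show "finite L" by (simp add: L_def)
    show "0 \<le> w l" for l using m by (cases l) (auto simp: w_def w1_def w2_def)
    show "(\<Sum>l\<in>L. w l) = 1"
    proof -
      have "(\<Sum>l\<in>L. w l) = m / (m + 2) + m * (2 / (m * (m + 2)))"
        by (simp add: split w_def w1_def w2_def card_Pow m_def)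
      also have "\<dots> = 1" using m one by simp
      finally show ?thesis .
    qed
    fix y :: 'e
    have "(\<Sum>l\<in>L. w l * (u l \<bullet> y)\<^sup>2) = w1 * (2 ^ DIM('e) * (norm y)\<^sup>2) + w2 * (m * (norm y)\<^sup>2)"
      using sign_sum_moments(1)[of Basis "\<lambda>b. y \<bullet> b"] m
      by (simp add: split uA ub w_def sum_distrib_left[symmetric] n2 power_mult_distrib)
    also have "\<dots> = m / (m + 2) * (norm y)\<^sup>2 + 2 / (m + 2) * (norm y)\<^sup>2" using m by (simp add: w1_def w2_def)
    also have "\<dots> = (norm y)\<^sup>2" unfolding distrib_right[symmetric] one by simp
    finally show "(\<Sum>l\<in>L. w l * (u l \<bullet> y)\<^sup>2) = (norm y)\<^sup>2" .
    define q where "q = (\<Sum>b\<in>Basis. (y \<bullet> b) ^ 4)"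
    have "(\<Sum>l\<in>L. w l * (u l \<bullet> y) ^ 4) = w1 * (2 ^ DIM('e) * (3 * ((norm y)\<^sup>2)\<^sup>2 - 2 * q)) + w2 * (m\<^sup>2 * q)"
      using sign_sum_moments(2)[of Basis "\<lambda>b. y \<bullet> b"]
      by (simp add: split uA ub w_def sum_distrib_left[symmetric] n2 power_mult_distrib q_def s4)
    also have "\<dots> = 3 * m / (m + 2) * ((norm y)\<^sup>2)\<^sup>2"
    proof -
      have "w1 * (2 ^ DIM('e) * (3 * ((norm y)\<^sup>2)\<^sup>2 - 2 * q)) = m / (m + 2) * (3 * ((norm y)\<^sup>2)\<^sup>2 - 2 * q)"
        by (simp add: w1_def)
      moreover have "w2 * (m\<^sup>2 * q) = m / (m + 2) * (2 * q)"
        using m by (simp add: w2_def power2_eq_square)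
      ultimately show ?thesis by (simp add: algebra_simps)
    qed
    finally show "(\<Sum>l\<in>L. w l * (u l \<bullet> y) ^ 4) = 3 * real DIM('e) / (real DIM('e) + 2) * norm y ^ 4"
      by (simp add: m_def flip: power_mult)
  qed
qed

section \<open>Slowly varying factors\<close>

definition slow :: "real \<Rightarrow> real \<Rightarrow> (real \<Rightarrow> real) \<Rightarrow> bool" where
  "slow \<mu> X f \<longleftrightarrow> \<bar>f 0\<bar> \<le> 1 \<and> (\<exists>p q. jet2 f p q \<and> \<bar>p\<bar> \<le> \<mu> * X \<and> \<bar>q\<bar> \<le> (\<mu> + \<mu>\<^sup>2) * X\<^sup>2)"

text \<open>The bound on the second derivative is chosen so as to make the parameter additive.\<close>

lemma slow_mult:
  assumes "slow \<mu> X f" "slow \<nu> X g" "\<mu> \<ge> 0" "\<nu> \<ge> 0" "X \<ge> 0"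
  shows "slow (\<mu> + \<nu>) X (\<lambda>t. f t * g t)"
proof -
  obtain p q where f: "\<bar>f 0\<bar> \<le> 1" "jet2 f p q" "\<bar>p\<bar> \<le> \<mu> * X" "\<bar>q\<bar> \<le> (\<mu> + \<mu>\<^sup>2) * X\<^sup>2"
    using assms(1) by (auto simp: slow_def)
  obtain r s where g: "\<bar>g 0\<bar> \<le> 1" "jet2 g r s" "\<bar>r\<bar> \<le> \<nu> * X" "\<bar>s\<bar> \<le> (\<nu> + \<nu>\<^sup>2) * X\<^sup>2"
    using assms(2) by (auto simp: slow_def)
  have "\<bar>f 0 * g 0\<bar> \<le> 1" using f(1) g(1) by (simp add: abs_mult mult_le_one)
  moreover have "\<bar>f 0 * r + p * g 0\<bar> \<le> (\<mu> + \<nu>) * X"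
  proof -
    have m1: "\<bar>f 0 * r\<bar> \<le> 1 * (\<nu> * X)"
      unfolding abs_mult by (rule mult_mono[OF f(1) g(3)]) auto
    have m2: "\<bar>p * g 0\<bar> \<le> (\<mu> * X) * 1"
      unfolding abs_mult by (rule mult_mono[OF f(3) g(1)]) (use assms in auto)
    have "\<bar>f 0 * r + p * g 0\<bar> \<le> 1 * (\<nu> * X) + (\<mu> * X) * 1"
      by (rule order_trans[OF abs_triangle_ineq add_mono[OF m1 m2]])
    then show ?thesis by (simp add: algebra_simps)
  qed
  moreover have "\<bar>f 0 * s + 2 * (p * r) + q * g 0\<bar> \<le> ((\<mu> + \<nu>) + (\<mu> + \<nu>)\<^sup>2) * X\<^sup>2"
  proof -
    have lin: "\<bar>a + 2 * b + c\<bar> \<le> A + 2 * B + C" if "\<bar>a\<bar> \<le> A" "\<bar>b\<bar> \<le> B" "\<bar>c\<bar> \<le> C" for a b c A B C :: real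
      using that by linarith
    have m1: "\<bar>f 0 * s\<bar> \<le> 1 * ((\<nu> + \<nu>\<^sup>2) * X\<^sup>2)"
      unfolding abs_mult by (rule mult_mono[OF f(1) g(4)]) auto
    have m2: "\<bar>p * r\<bar> \<le> (\<mu> * X) * (\<nu> * X)"
      unfolding abs_mult by (rule mult_mono[OF f(3) g(3)]) (use assms in auto)
    have m3: "\<bar>q * g 0\<bar> \<le> ((\<mu> + \<mu>\<^sup>2) * X\<^sup>2) * 1"
      unfolding abs_mult by (rule mult_mono[OF f(4) g(1)]) (use assms in auto)
    have "\<bar>f 0 * s + 2 * (p * r) + q * g 0\<bar> \<le> 1 * ((\<nu> + \<nu>\<^sup>2) * X\<^sup>2) + 2 * ((\<mu> * X) * (\<nu> * X)) + ((\<mu> + \<mu>\<^sup>2) * X\<^sup>2) * 1"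
      by (rule lin[OF m1 m2 m3])
    also have "\<dots> = ((\<mu> + \<nu>) + (\<mu> + \<nu>)\<^sup>2) * X\<^sup>2" by (simp add: power2_eq_square algebra_simps)
    finally show ?thesis .
  qed
  ultimately show ?thesis using jet2_mult[OF f(2) g(2)] unfolding slow_def by blast
qed

lemma slow_prod:
  assumes "finite I" "\<And>i. i \<in> I \<Longrightarrow> slow \<mu> X (f i)" "\<mu> \<ge> 0" "X \<ge> 0"
  shows "slow (real (card I) * \<mu>) X (\<lambda>t. \<Prod>i\<in>I. f i t)"
  using assms(1,2)
proof (induction I rule: finite_induct)
  case empty
  then show ?case using jet2_const by (auto simp: slow_def)
next
  case (insert i I)
  have "slow (\<mu> + real (card I) * \<mu>) X (\<lambda>t. f i t * (\<Prod>i\<in>I. f i t))"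
    using insert assms by (intro slow_mult) auto
  then show ?case using insert.hyps by (simp add: algebra_simps)
qed

lemma slow_bump:
  assumes "jet2 g p q" "\<bar>p\<bar> \<le> \<mu> * X" "\<bar>q\<bar> \<le> \<mu> * X\<^sup>2" "\<mu> \<ge> 0" "X \<ge> 0" "C \<ge> 1"
    and A: "\<And>x. (bump has_real_derivative A1 x) (at x)"
    "\<And>x. (A1 has_real_derivative A2 x) (at x)" "\<And>x. \<bar>A1 x\<bar> \<le> C" "\<And>x. \<bar>A2 x\<bar> \<le> C"
  shows "slow (C * \<mu>) X (\<lambda>t. bump (g t - i))"
proof -
  have g: "jet2 (\<lambda>t. g t - i) p q"
    using jet2_add[OF assms(1) jet2_const[of "- i"]] by simp
  have j: "jet2 (\<lambda>t. bump (g t - i)) (A1 (g 0 - i) * p) (A2 (g 0 - i) * p\<^sup>2 + A1 (g 0 - i) * q)"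
    by (rule jet2_compose[OF g open_UNIV, where h=bump and ?h1.0=A1]) (use A in auto)
  have p: "\<bar>A1 (g 0 - i) * p\<bar> \<le> C * \<mu> * X"
  proof -
    have "\<bar>A1 (g 0 - i) * p\<bar> \<le> C * (\<mu> * X)"
      unfolding abs_mult by (rule mult_mono) (use A assms in auto)
    then show ?thesis by (simp add: mult.assoc)
  qed
  have "\<bar>A2 (g 0 - i) * p\<^sup>2 + A1 (g 0 - i) * q\<bar> \<le> (C * \<mu> + (C * \<mu>)\<^sup>2) * X\<^sup>2"
  proof -
    have "p\<^sup>2 \<le> (\<mu> * X)\<^sup>2" using assms(2,4,5) by (simp add: power2_le_iff_abs_le)
    then have "\<bar>A2 (g 0 - i) * p\<^sup>2\<bar> \<le> C * (\<mu> * X)\<^sup>2"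
      unfolding abs_mult by (intro mult_mono) (use A assms in auto)
    also have "\<dots> \<le> C\<^sup>2 * (\<mu> * X)\<^sup>2"
      using assms(6) by (intro mult_right_mono) (auto simp: power2_eq_square)
    finally have 1: "\<bar>A2 (g 0 - i) * p\<^sup>2\<bar> \<le> C\<^sup>2 * (\<mu> * X)\<^sup>2" .
    have "\<bar>A1 (g 0 - i) * q\<bar> \<le> C * (\<mu> * X\<^sup>2)"
      unfolding abs_mult by (rule mult_mono) (use A assms in auto)
    with 1 have "\<bar>A2 (g 0 - i) * p\<^sup>2 + A1 (g 0 - i) * q\<bar> \<le> C\<^sup>2 * (\<mu> * X)\<^sup>2 + C * (\<mu> * X\<^sup>2)" by linarith
    also have "\<dots> = (C * \<mu> + (C * \<mu>)\<^sup>2) * X\<^sup>2" by (simp add: power2_eq_square algebra_simps)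
    finally show ?thesis .
  qed
  with p j bump_le_1 show ?thesis unfolding slow_def by blast
qed

lemma jet2_wave:
  fixes f \<theta> :: "real \<Rightarrow> real"
  assumes "jet2 f p q" "jet2 \<theta> \<theta>1 \<theta>2"
  shows "jet2 (\<lambda>t. s * (f t * cos (\<theta> t))) (s * (p * cos (\<theta> 0) - f 0 * \<theta>1 * sin (\<theta> 0)))
      (s * ((q - f 0 * \<theta>1\<^sup>2) * cos (\<theta> 0) - (2 * p * \<theta>1 + f 0 * \<theta>2) * sin (\<theta> 0)))"
    and "jet2 (\<lambda>t. s * (f t * sin (\<theta> t))) (s * (p * sin (\<theta> 0) + f 0 * \<theta>1 * cos (\<theta> 0)))
      (s * ((q - f 0 * \<theta>1\<^sup>2) * sin (\<theta> 0) + (2 * p * \<theta>1 + f 0 * \<theta>2) * cos (\<theta> 0)))"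
proof -
  have 1: "jet2 (\<lambda>t. cos (\<theta> t)) (- sin (\<theta> 0) * \<theta>1) (- cos (\<theta> 0) * \<theta>1\<^sup>2 + - sin (\<theta> 0) * \<theta>2)"
    by (rule jet2_compose[OF assms(2) open_UNIV, where h=cos and ?h1.0="\<lambda>x. - sin x"]) (auto intro!: derivative_eq_intros)
  have 2: "jet2 (\<lambda>t. sin (\<theta> t)) (cos (\<theta> 0) * \<theta>1) (- sin (\<theta> 0) * \<theta>1\<^sup>2 + cos (\<theta> 0) * \<theta>2)"
    by (rule jet2_compose[OF assms(2) open_UNIV, where h=sin and ?h1.0=cos]) (auto intro!: derivative_eq_intros)
  show "jet2 (\<lambda>t. s * (f t * cos (\<theta> t))) (s * (p * cos (\<theta> 0) - f 0 * \<theta>1 * sin (\<theta> 0)))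
      (s * ((q - f 0 * \<theta>1\<^sup>2) * cos (\<theta> 0) - (2 * p * \<theta>1 + f 0 * \<theta>2) * sin (\<theta> 0)))"
    using jet2_bounded_linear[OF bounded_linear_mult_right jet2_mult[OF assms(1) 1], of s]
    by (simp add: algebra_simps)
  show "jet2 (\<lambda>t. s * (f t * sin (\<theta> t))) (s * (p * sin (\<theta> 0) + f 0 * \<theta>1 * cos (\<theta> 0)))
      (s * ((q - f 0 * \<theta>1\<^sup>2) * sin (\<theta> 0) + (2 * p * \<theta>1 + f 0 * \<theta>2) * cos (\<theta> 0)))"
    using jet2_bounded_linear[OF bounded_linear_mult_right jet2_mult[OF assms(1) 2], of s]
    by (simp add: algebra_simps)
qed

section \<open>Cellwise oscillating maps on a Euclidean space\<close>

text \<open>A cosine and a sine with the same phase combine by a rotation, which removes the phase; the sums over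
  the directions are then moments of the design.\<close>

lemma wave_moments:
  fixes u :: "'l \<Rightarrow> 'e::euclidean_space" and \<theta> :: "'l \<Rightarrow> real"
  assumes "finite L" and w: "\<And>l. 0 \<le> w l" and w1: "(\<Sum>l\<in>L. w l) = 1"
    and w2: "\<And>y. (\<Sum>l\<in>L. w l * (u l \<bullet> y)\<^sup>2) = (norm y)\<^sup>2"
    and w4: "\<And>y. (\<Sum>l\<in>L. w l * (u l \<bullet> y) ^ 4) = c * norm y ^ 4"
  shows "(\<Sum>l\<in>L. (sqrt (w l) * (p * cos (\<theta> l) - \<kappa> * (u l \<bullet> \<tau>) * sin (\<theta> l)))\<^sup>2
      + (sqrt (w l) * (p * sin (\<theta> l) + \<kappa> * (u l \<bullet> \<tau>) * cos (\<theta> l)))\<^sup>2) = p\<^sup>2 + \<kappa>\<^sup>2 * (norm \<tau>)\<^sup>2" (is ?th1)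
    and "(\<Sum>l\<in>L. (sqrt (w l) * ((q - \<kappa> * (u l \<bullet> \<tau>)\<^sup>2) * cos (\<theta> l) - (2 * p * (u l \<bullet> \<tau>) + \<kappa> * (u l \<bullet> \<tau>')) * sin (\<theta> l)))\<^sup>2
      + (sqrt (w l) * ((q - \<kappa> * (u l \<bullet> \<tau>)\<^sup>2) * sin (\<theta> l) + (2 * p * (u l \<bullet> \<tau>) + \<kappa> * (u l \<bullet> \<tau>')) * cos (\<theta> l)))\<^sup>2)
     \<le> q\<^sup>2 - 2 * q * \<kappa> * (norm \<tau>)\<^sup>2 + c * \<kappa>\<^sup>2 * norm \<tau> ^ 4 + 8 * p\<^sup>2 * (norm \<tau>)\<^sup>2 + 2 * \<kappa>\<^sup>2 * (norm \<tau>')\<^sup>2" (is ?th2)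
proof -
  have rot: "(sqrt (w l) * (a * cos t - b * sin t))\<^sup>2 + (sqrt (w l) * (a * sin t + b * cos t))\<^sup>2 = w l * (a\<^sup>2 + b\<^sup>2)" for l a b t
  proof -
    have "(a * y - b * x)\<^sup>2 + (a * x + b * y)\<^sup>2 = (a\<^sup>2 + b\<^sup>2) * (x\<^sup>2 + y\<^sup>2)" for x y :: real
      by (simp add: power2_eq_square algebra_simps)
    from this[of "cos t" "sin t"] have "(a * cos t - b * sin t)\<^sup>2 + (a * sin t + b * cos t)\<^sup>2 = a\<^sup>2 + b\<^sup>2"
      by simp
    then show ?thesis using w[of l] by (simp add: power_mult_distrib distrib_left[symmetric])
  qed
  have "(\<Sum>l\<in>L. w l * (p\<^sup>2 + (\<kappa> * (u l \<bullet> \<tau>))\<^sup>2)) = p\<^sup>2 * (\<Sum>l\<in>L. w l) + \<kappa>\<^sup>2 * (\<Sum>l\<in>L. w l * (u l \<bullet> \<tau>)\<^sup>2)"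
    by (simp add: sum.distrib sum_distrib_left sum_distrib_right power_mult_distrib algebra_simps)
  then show ?th1 unfolding rot by (simp add: w1 w2)
  have "(\<Sum>l\<in>L. w l * ((q - \<kappa> * (u l \<bullet> \<tau>)\<^sup>2)\<^sup>2 + (2 * p * (u l \<bullet> \<tau>) + \<kappa> * (u l \<bullet> \<tau>'))\<^sup>2))
     \<le> (\<Sum>l\<in>L. q\<^sup>2 * w l - 2 * q * \<kappa> * (w l * (u l \<bullet> \<tau>)\<^sup>2) + \<kappa>\<^sup>2 * (w l * (u l \<bullet> \<tau>) ^ 4)
        + 8 * p\<^sup>2 * (w l * (u l \<bullet> \<tau>)\<^sup>2) + 2 * \<kappa>\<^sup>2 * (w l * (u l \<bullet> \<tau>')\<^sup>2))"
  proof (rule sum_mono)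
    fix l assume "l \<in> L"
    define x y where "x = u l \<bullet> \<tau>" and "y = u l \<bullet> \<tau>'"
    have "(2 * p * x + \<kappa> * y)\<^sup>2 \<le> 8 * p\<^sup>2 * x\<^sup>2 + 2 * \<kappa>\<^sup>2 * y\<^sup>2"
    proof -
      have "0 \<le> (2 * p * x - \<kappa> * y)\<^sup>2" by simp
      then show ?thesis by (simp add: power2_eq_square algebra_simps)
    qed
    then have "w l * ((q - \<kappa> * x\<^sup>2)\<^sup>2 + (2 * p * x + \<kappa> * y)\<^sup>2) \<le> w l * ((q - \<kappa> * x\<^sup>2)\<^sup>2 + (8 * p\<^sup>2 * x\<^sup>2 + 2 * \<kappa>\<^sup>2 * y\<^sup>2))"
      using w by (intro mult_left_mono add_left_mono) auto
    also have "\<dots> = q\<^sup>2 * w l - 2 * q * \<kappa> * (w l * x\<^sup>2) + \<kappa>\<^sup>2 * (w l * x ^ 4)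
        + 8 * p\<^sup>2 * (w l * x\<^sup>2) + 2 * \<kappa>\<^sup>2 * (w l * y\<^sup>2)"
      by (simp add: power2_eq_square power4_eq_xxxx algebra_simps)
    finally show "w l * ((q - \<kappa> * (u l \<bullet> \<tau>)\<^sup>2)\<^sup>2 + (2 * p * (u l \<bullet> \<tau>) + \<kappa> * (u l \<bullet> \<tau>'))\<^sup>2)
      \<le> q\<^sup>2 * w l - 2 * q * \<kappa> * (w l * (u l \<bullet> \<tau>)\<^sup>2) + \<kappa>\<^sup>2 * (w l * (u l \<bullet> \<tau>) ^ 4)
        + 8 * p\<^sup>2 * (w l * (u l \<bullet> \<tau>)\<^sup>2) + 2 * \<kappa>\<^sup>2 * (w l * (u l \<bullet> \<tau>')\<^sup>2)"
      by (simp only: x_def y_def)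
  qed
  also have "\<dots> = q\<^sup>2 * (\<Sum>l\<in>L. w l) - 2 * q * \<kappa> * (\<Sum>l\<in>L. w l * (u l \<bullet> \<tau>)\<^sup>2) + \<kappa>\<^sup>2 * (\<Sum>l\<in>L. w l * (u l \<bullet> \<tau>) ^ 4)
        + 8 * p\<^sup>2 * (\<Sum>l\<in>L. w l * (u l \<bullet> \<tau>)\<^sup>2) + 2 * \<kappa>\<^sup>2 * (\<Sum>l\<in>L. w l * (u l \<bullet> \<tau>')\<^sup>2)"
    by (simp only: sum.distrib sum_subtractf sum_distrib_left)
  finally show ?th2 unfolding rot by (simp add: w1 w2 w4 mult_ac)
qed

text \<open>The space is cut into cells in two ways for each of the real functions \<open>N\<close> and \<open>y \<bullet> b\<close>, the
  latter at a scale that depends on the value of \<open>N\<close>; on a cell, the map oscillates in the directions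
  \<open>u l\<close> of the linear chart \<open>T0 n z\<close>, with the frequency \<open>1 / r n\<close>.\<close>

locale cellwise_waves =
  fixes N :: "'f::euclidean_space \<Rightarrow> real" and r :: "int \<Rightarrow> real" and \<Lambda> :: real
    and T0 :: "int \<Rightarrow> ('f \<Rightarrow> int) \<Rightarrow> 'f \<Rightarrow> 'e::euclidean_space"
    and L :: "'l set" and w :: "'l \<Rightarrow> real" and u :: "'l \<Rightarrow> 'e" and c :: real
  assumes smooth_N: "smooth_on UNIV N" and r_pos: "\<And>n. r n > 0" and \<Lambda>: "\<Lambda> > 0"
    and lin: "\<And>n z. linear (T0 n z)" and contr: "\<And>n z v. norm (T0 n z v) \<le> norm v"
    and finL: "finite L" and w0: "\<And>l. 0 \<le> w l" and w1: "(\<Sum>l\<in>L. w l) = 1"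
    and w2: "\<And>y. (\<Sum>l\<in>L. w l * (u l \<bullet> y)\<^sup>2) = (norm y)\<^sup>2"
    and w4: "\<And>y. (\<Sum>l\<in>L. w l * (u l \<bullet> y) ^ 4) = c * norm y ^ 4"
begin

definition layer :: "int \<Rightarrow> 'f \<Rightarrow> int" where
  "layer i y = i + 2 * cell (of_int i) (N y)"

definition box_index :: "('f \<Rightarrow> int) \<Rightarrow> int \<Rightarrow> 'f \<Rightarrow> 'f \<Rightarrow> int" where
  "box_index \<rho> n y b = (if b \<in> Basis then \<rho> b + 2 * cell (of_int (\<rho> b)) (y \<bullet> b / (\<Lambda> * r n)) else 0)"

definition cutoff :: "int \<Rightarrow> ('f \<Rightarrow> int) \<Rightarrow> int \<Rightarrow> 'f \<Rightarrow> real" where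
  "cutoff i \<rho> n y = bump (N y - of_int i) * (\<Prod>b\<in>Basis. bump (y \<bullet> b / (\<Lambda> * r n) - of_int (\<rho> b)))"

definition cell_wave :: "int \<Rightarrow> ('f \<Rightarrow> int) \<Rightarrow> 'l \<Rightarrow> bool \<Rightarrow> int \<Rightarrow> ('f \<Rightarrow> int) \<Rightarrow> 'f \<Rightarrow> real" where
  "cell_wave i \<rho> l s n z y =
     sqrt (w l) * (cutoff i \<rho> n y * (if s then sin else cos) (u l \<bullet> T0 n z y / r n))"

definition wave :: "int \<Rightarrow> ('f \<Rightarrow> int) \<Rightarrow> 'l \<Rightarrow> bool \<Rightarrow> 'f \<Rightarrow> real" where
  "wave i \<rho> l s y = cell_wave i \<rho> l s (layer i y) (box_index \<rho> (layer i y) y) y"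

definition colours :: "(int \<times> ('f \<Rightarrow> int)) set" where
  "colours = {0, 1} \<times> (Basis \<rightarrow>\<^sub>E {0, 1})"

lemma finite_colours: "finite colours"
  by (simp add: colours_def finite_PiE)

lemma N_isCont: "isCont N y"
  using smooth_on_imp_continuous_on[OF smooth_N] by (simp add: continuous_on_eq_continuous_at)

text \<open>The waves are defined through integer-valued functions that jump, but where these jump the cutoff
  vanishes identically.\<close>

lemma cell_dichotomy:
  obtains "\<forall>\<^sub>F y' in nhds y. cutoff i \<rho> (layer i y') y' = 0"
  | "\<forall>\<^sub>F y' in nhds y. layer i y' = layer i y \<and> box_index \<rho> (layer i y') y' = box_index \<rho> (layer i y) y"
    "\<bar>N y - of_int (layer i y)\<bar> < 1"
    "\<And>b. b \<in> Basis \<Longrightarrow> \<bar>y \<bullet> b / (\<Lambda> * r (layer i y)) - of_int (box_index \<rho> (layer i y) y b)\<bar> < 1"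
proof -
  define n where "n = layer i y"
  define g where "g b y = y \<bullet> b / (\<Lambda> * r n)" for b y :: 'f
  have gc: "isCont (g b) y" for b unfolding g_def using r_pos[of n] \<Lambda> by (auto intro!: continuous_intros)
  show ?thesis
  proof (cases "(sin (pi * (N y - of_int i) / 2))\<^sup>2 > 3 / 4")
    case True
    have "isCont (\<lambda>y. N y - of_int i) y" using N_isCont by (intro continuous_intros)
    from eventually_nhds_isCont[OF this bump_eventually_0[OF True]]
    have "\<forall>\<^sub>F y' in nhds y. cutoff i \<rho> (layer i y') y' = 0"
      by eventually_elim (simp add: cutoff_def)
    then show ?thesis by (rule that(1))
  next
    case False
    then have lt: "(sin (pi * (N y - of_int i) / 2))\<^sup>2 < 1" by linarith
    have lay: "\<forall>\<^sub>F y' in nhds y. layer i y' = n"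
      using eventually_nhds_isCont[OF N_isCont cell_local_const(1)[OF lt]]
      by eventually_elim (simp add: layer_def n_def)
    have N1: "\<bar>N y - of_int (layer i y)\<bar> < 1"
      using cell_local_const(2)[OF lt] by (simp add: layer_def algebra_simps)
    show ?thesis
    proof (cases "\<exists>b\<in>Basis. (sin (pi * (g b y - of_int (\<rho> b)) / 2))\<^sup>2 > 3 / 4")
      case True
      then obtain b where b: "b \<in> Basis" "(sin (pi * (g b y - of_int (\<rho> b)) / 2))\<^sup>2 > 3 / 4" by blast
      have "isCont (\<lambda>y. g b y - of_int (\<rho> b)) y" using gc by (intro continuous_intros)
      from eventually_nhds_isCont[OF this bump_eventually_0[OF b(2)]] lay
      have "\<forall>\<^sub>F y' in nhds y. cutoff i \<rho> (layer i y') y' = 0"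
        by eventually_elim (use b(1) in \<open>auto simp: cutoff_def g_def\<close>)
      then show ?thesis by (rule that(1))
    next
      case False
      then have lt: "(sin (pi * (g b y - of_int (\<rho> b)) / 2))\<^sup>2 < 1" if "b \<in> Basis" for b
        using that by force
      have "\<forall>\<^sub>F y' in nhds y. \<forall>b\<in>Basis. cell (of_int (\<rho> b)) (g b y') = cell (of_int (\<rho> b)) (g b y)"
        using eventually_nhds_isCont[OF gc cell_local_const(1)[OF lt]]
        by (simp add: eventually_ball_finite_distrib)
      with lay have "\<forall>\<^sub>F y' in nhds y. layer i y' = layer i y \<and> box_index \<rho> (layer i y') y' = box_index \<rho> (layer i y) y"
        by eventually_elim (auto simp: box_index_def n_def g_def fun_eq_iff)
      moreover have "\<bar>y \<bullet> b / (\<Lambda> * r (layer i y)) - of_int (box_index \<rho> (layer i y) y b)\<bar> < 1" if "b \<in> Basis" for b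
        using cell_local_const(2)[OF lt[OF that]] that by (simp add: box_index_def g_def n_def algebra_simps)
      ultimately show ?thesis using N1 by (intro that(2))
    qed
  qed
qed

lemma smooth_cutoff: "smooth_on UNIV (cutoff i \<rho> n)"
proof -
  have 1: "smooth_on UNIV (\<lambda>y. bump (N y - of_int i))"
    by (rule smooth_on_compose[OF open_UNIV open_UNIV _ _ bump_smooth])
      (auto intro!: smooth_on_diff smooth_N smooth_on_const)
  have 2: "smooth_on UNIV (\<lambda>y. bump (y \<bullet> b / (\<Lambda> * r n) - of_int (\<rho> b)))" for b
  proof -
    have "bounded_linear (\<lambda>y. y \<bullet> b / (\<Lambda> * r n))"
      using bounded_linear_compose[OF bounded_linear_divide bounded_linear_inner_left] .
    from smooth_on_diff[OF open_UNIV smooth_on_bounded_linear[OF open_UNIV this] smooth_on_const[OF open_UNIV]]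
    show ?thesis by (rule smooth_on_compose[OF open_UNIV open_UNIV _ _ bump_smooth, rotated]) simp
  qed
  have 3: "smooth_on UNIV (\<lambda>y. \<Prod>b\<in>Basis. bump (y \<bullet> b / (\<Lambda> * r n) - of_int (\<rho> b)))"
    by (rule smooth_on_prod[OF open_UNIV 2])
  show ?thesis unfolding cutoff_def[abs_def] by (rule smooth_on_mult[OF open_UNIV 1 3])
qed

lemma phase_bounded_linear: "bounded_linear (\<lambda>y. u l \<bullet> T0 n z y / r n)"
  using lin[of n z] by (intro bounded_linear_compose[OF bounded_linear_divide]
      bounded_linear_compose[OF bounded_linear_inner_right]) (simp add: linear_conv_bounded_linear)

lemma smooth_cell_wave: "smooth_on UNIV (cell_wave i \<rho> l s n z)"
proof -
  have sm: "smooth_on UNIV (if s then sin else cos :: real \<Rightarrow> real)"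
    by (simp add: smooth_on_sin smooth_on_cos)
  have 1: "smooth_on UNIV (\<lambda>y. (if s then sin else cos) (u l \<bullet> T0 n z y / r n))"
    by (rule smooth_on_compose[OF open_UNIV open_UNIV _ smooth_on_bounded_linear[OF open_UNIV phase_bounded_linear] sm]) simp
  have 2: "smooth_on UNIV (\<lambda>y. cutoff i \<rho> n y * (if s then sin else cos) (u l \<bullet> T0 n z y / r n))"
    by (rule smooth_on_mult[OF open_UNIV smooth_cutoff 1])
  show ?thesis unfolding cell_wave_def[abs_def]
    by (rule smooth_on_mult[OF open_UNIV smooth_on_const[OF open_UNIV] 2])
qed

lemma smooth_wave: "smooth_on UNIV (wave i \<rho> l s)"
proof (rule smooth_on_local)
  fix y
  show "\<exists>S g. open S \<and> y \<in> S \<and> smooth_on S g \<and> (\<forall>x\<in>S. g x = wave i \<rho> l s x)"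
  proof (rule cell_dichotomy[where y=y and i=i and \<rho>=\<rho>])
    assume "\<forall>\<^sub>F y' in nhds y. cutoff i \<rho> (layer i y') y' = 0"
    then obtain S where "open S" "y \<in> S" "\<And>x. x \<in> S \<Longrightarrow> cutoff i \<rho> (layer i x) x = 0"
      by (auto simp: eventually_nhds)
    then show ?thesis
      by (intro exI[of _ S] exI[of _ "\<lambda>_. 0"]) (auto simp: wave_def cell_wave_def intro: smooth_on_const)
  next
    assume "\<forall>\<^sub>F y' in nhds y. layer i y' = layer i y \<and> box_index \<rho> (layer i y') y' = box_index \<rho> (layer i y) y"
    then obtain S where S: "open S" "y \<in> S" "\<And>x. x \<in> S \<Longrightarrow> layer i x = layer i y \<and> box_index \<rho> (layer i x) x = box_index \<rho> (layer i y) y"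
      by (auto simp: eventually_nhds)
    have "cell_wave i \<rho> l s (layer i y) (box_index \<rho> (layer i y) y) x = wave i \<rho> l s x" if "x \<in> S" for x
      unfolding wave_def conjunct2[OF S(3)[OF that]] unfolding conjunct1[OF S(3)[OF that]] ..
    then show ?thesis
      by (intro exI[of _ S] exI[of _ "cell_wave i \<rho> l s (layer i y) (box_index \<rho> (layer i y) y)"]
          conjI ballI S(1,2) smooth_on_subset[OF smooth_cell_wave subset_UNIV])
  qed
qed

lemma sum_cutoff_squares: "(\<Sum>(i, \<rho>)\<in>colours. (cutoff i \<rho> (layer i y) y)\<^sup>2) = 1"
proof -
  have two: "(\<Sum>i\<in>{0, 1::int}. (bump (s - of_int i))\<^sup>2) = 1" for s
    using bump_squares[of s] by simp
  have "(\<Sum>\<rho>\<in>Basis \<rightarrow>\<^sub>E {0, 1}. (cutoff i \<rho> (layer i y) y)\<^sup>2) = (bump (N y - of_int i))\<^sup>2" for i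
  proof -
    have "(\<Sum>\<rho>\<in>Basis \<rightarrow>\<^sub>E {0, 1}. (cutoff i \<rho> (layer i y) y)\<^sup>2) = (bump (N y - of_int i))\<^sup>2 *
       (\<Sum>\<rho>\<in>Basis \<rightarrow>\<^sub>E {0, 1}. \<Prod>b\<in>Basis. (bump (y \<bullet> b / (\<Lambda> * r (layer i y)) - of_int (\<rho> b)))\<^sup>2)"
      by (simp add: cutoff_def power_mult_distrib prod_power_distrib sum_distrib_left)
    also have "(\<Sum>\<rho>\<in>Basis \<rightarrow>\<^sub>E {0, 1}. \<Prod>b\<in>Basis. (bump (y \<bullet> b / (\<Lambda> * r (layer i y)) - of_int (\<rho> b)))\<^sup>2)
       = (\<Prod>b\<in>Basis. \<Sum>k\<in>{0, 1::int}. (bump (y \<bullet> b / (\<Lambda> * r (layer i y)) - of_int k))\<^sup>2)"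
      by (subst prod_sum_PiE) auto
    also have "\<dots> = 1" unfolding two by simp
    finally show ?thesis by simp
  qed
  then show ?thesis unfolding colours_def using two[of "N y"]
    by (simp add: sum.cartesian_product[symmetric])
qed

lemma sum_wave_squares: "(\<Sum>(i, \<rho>)\<in>colours. \<Sum>l\<in>L. \<Sum>s\<in>UNIV. (wave i \<rho> l s y)\<^sup>2) = 1"
proof -
  have "(\<Sum>l\<in>L. \<Sum>s\<in>UNIV. (wave i \<rho> l s y)\<^sup>2) = (cutoff i \<rho> (layer i y) y)\<^sup>2" for i \<rho>
  proof -
    have "(\<Sum>s\<in>UNIV. (wave i \<rho> l s y)\<^sup>2) = w l * (cutoff i \<rho> (layer i y) y)\<^sup>2" for l
      using w0[of l] by (simp add: UNIV_bool wave_def cell_wave_def power_mult_distrib distrib_left[symmetric])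
    then show ?thesis by (simp add: sum_distrib_right[symmetric] w1)
  qed
  then show ?thesis by (simp add: sum_cutoff_squares)
qed

text \<open>Near a point, a colour is either absent or given by a single cell, whose wave has explicit
  derivatives. Here \<open>X\<close> is the speed of the curve in the unit of length given by the local scale.\<close>

lemma colour_jets:
  assumes j: "jet2 \<gamma> \<xi> \<eta>" and X: "X \<ge> 0" and \<nu>: "0 \<le> \<nu>" "\<nu> \<le> 1" and \<epsilon>: "0 \<le> \<epsilon>" "\<epsilon> < 1 / 2" and "c \<ge> 0"
    and y: "\<gamma> 0 = y"
    and sl: "\<And>n. \<bar>N y - of_int n\<bar> < 1 \<Longrightarrow> slow (\<nu> / 2) X (\<lambda>t. cutoff i \<rho> n (\<gamma> t))"
    and up: "\<And>n. \<bar>N y - of_int n\<bar> < 1 \<Longrightarrow> norm \<xi> / r n \<le> X / (1 - \<epsilon>)"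
    and up2: "\<And>n. \<bar>N y - of_int n\<bar> < 1 \<Longrightarrow> norm \<eta> / r n \<le> 2 * \<epsilon> * X\<^sup>2"
    and low: "\<And>n z. \<bar>N y - of_int n\<bar> < 1 \<Longrightarrow> (\<And>b. b \<in> Basis \<Longrightarrow> \<bar>y \<bullet> b / (\<Lambda> * r n) - of_int (z b)\<bar> < 1) \<Longrightarrow>
       norm (T0 n z \<xi>) / r n \<ge> (1 - \<epsilon>)\<^sup>2 * X"
  shows "\<exists>G1 G2. (\<forall>l s. jet2 (\<lambda>t. wave i \<rho> l s (\<gamma> t)) (G1 l s) (G2 l s)) \<and>
     (\<Sum>l\<in>L. \<Sum>s\<in>UNIV. (G1 l s)\<^sup>2) \<ge> (1 - \<epsilon>) ^ 4 * X\<^sup>2 * (cutoff i \<rho> (layer i y) y)\<^sup>2 \<and>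
     (\<Sum>l\<in>L. \<Sum>s\<in>UNIV. (G2 l s)\<^sup>2) \<le> (c / (1 - \<epsilon>) ^ 4 + 8 * \<epsilon>\<^sup>2) * X ^ 4 * (cutoff i \<rho> (layer i y) y)\<^sup>2 + 41 * \<nu> * X ^ 4"
proof (rule cell_dichotomy[where y=y and i=i and \<rho>=\<rho>])
  have cont: "isCont \<gamma> 0" by (rule jet2_isCont[OF j])
  {
    assume ev: "\<forall>\<^sub>F y' in nhds y. cutoff i \<rho> (layer i y') y' = 0"
    have "\<forall>\<^sub>F t in nhds 0. cutoff i \<rho> (layer i (\<gamma> t)) (\<gamma> t) = 0"
      by (rule eventually_nhds_isCont[OF cont]) (use ev y in simp)
    then have "\<forall>\<^sub>F t in nhds 0. 0 = wave i \<rho> l s (\<gamma> t)" for l s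
      by eventually_elim (simp add: wave_def cell_wave_def)
    then have "jet2 (\<lambda>t. wave i \<rho> l s (\<gamma> t)) 0 0" for l s by (rule jet2_cong[OF jet2_const])
    moreover have "cutoff i \<rho> (layer i y) y = 0" using ev by (rule eventually_nhds_x_imp_x)
    ultimately show ?thesis
      by (intro exI[of _ "\<lambda>_ _. 0"]) (use \<nu> X in auto)
  next
    assume ev: "\<forall>\<^sub>F y' in nhds y. layer i y' = layer i y \<and> box_index \<rho> (layer i y') y' = box_index \<rho> (layer i y) y"
      and N1: "\<bar>N y - of_int (layer i y)\<bar> < 1"
      and box: "\<And>b. b \<in> Basis \<Longrightarrow> \<bar>y \<bullet> b / (\<Lambda> * r (layer i y)) - of_int (box_index \<rho> (layer i y) y b)\<bar> < 1"
    define n where "n = layer i y"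
    define z where "z = box_index \<rho> n y"
    define \<kappa> where "\<kappa> = cutoff i \<rho> n y"
    define \<tau> where "\<tau> = T0 n z \<xi> /\<^sub>R r n"
    define \<tau>' where "\<tau>' = T0 n z \<eta> /\<^sub>R r n"
    have N1: "\<bar>N y - of_int n\<bar> < 1" using N1 by (simp add: n_def)
    have rn: "r n > 0" by (rule r_pos)
    obtain p q where chi1: "\<bar>\<kappa>\<bar> \<le> 1" and pq: "jet2 (\<lambda>t. cutoff i \<rho> n (\<gamma> t)) p q"
      "\<bar>p\<bar> \<le> \<nu> / 2 * X" "\<bar>q\<bar> \<le> (\<nu> / 2 + (\<nu> / 2)\<^sup>2) * X\<^sup>2"
      using sl[OF N1] y by (auto simp: slow_def \<kappa>_def)
    have p: "\<bar>p\<bar> \<le> \<nu> * X" using pq(2) mult_nonneg_nonneg[OF \<nu>(1) X] by simp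
    have q: "\<bar>q\<bar> \<le> \<nu> * X\<^sup>2"
    proof -
      have "\<nu> * \<nu> \<le> \<nu> * 2" using \<nu> by (intro mult_left_mono) auto
      then have "(\<nu> / 2)\<^sup>2 \<le> \<nu> / 2" by (simp add: power2_eq_square)
      then have "(\<nu> / 2 + (\<nu> / 2)\<^sup>2) * X\<^sup>2 \<le> \<nu> * X\<^sup>2" by (intro mult_right_mono) auto
      with pq(3) show ?thesis by linarith
    qed
    have e1: "1 - \<epsilon> \<ge> 1 / 2" using \<epsilon> by simp
    have tau_up: "norm \<tau> \<le> X / (1 - \<epsilon>)"
    proof -
      have "norm \<tau> \<le> norm \<xi> / r n" using rn contr[of n z \<xi>] by (simp add: \<tau>_def divide_inverse mult.commute)
      then show ?thesis using up[OF N1] by linarith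
    qed
    have tau_low: "norm \<tau> \<ge> (1 - \<epsilon>)\<^sup>2 * X"
      using low[OF N1, of z] box rn by (simp add: \<tau>_def z_def n_def divide_inverse mult.commute)
    have tau'_up: "norm \<tau>' \<le> 2 * \<epsilon> * X\<^sup>2"
    proof -
      have "norm \<tau>' \<le> norm \<eta> / r n" using rn contr[of n z \<eta>] by (simp add: \<tau>'_def divide_inverse mult.commute)
      then show ?thesis using up2[OF N1] by linarith
    qed
    define \<theta> where "\<theta> l y = u l \<bullet> T0 n z y / r n" for l y
    have jt: "jet2 (\<lambda>t. \<theta> l (\<gamma> t)) (u l \<bullet> \<tau>) (u l \<bullet> \<tau>')" for l
      using jet2_bounded_linear[OF phase_bounded_linear j, of l n z]
      by (simp add: \<theta>_def \<tau>_def \<tau>'_def divide_inverse mult.commute)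
    define G1 where "G1 l s = (if s then sqrt (w l) * (p * sin (\<theta> l y) + \<kappa> * (u l \<bullet> \<tau>) * cos (\<theta> l y))
        else sqrt (w l) * (p * cos (\<theta> l y) - \<kappa> * (u l \<bullet> \<tau>) * sin (\<theta> l y)))" for l s
    define G2 where "G2 l s = (if s then sqrt (w l) * ((q - \<kappa> * (u l \<bullet> \<tau>)\<^sup>2) * sin (\<theta> l y) + (2 * p * (u l \<bullet> \<tau>) + \<kappa> * (u l \<bullet> \<tau>')) * cos (\<theta> l y))
        else sqrt (w l) * ((q - \<kappa> * (u l \<bullet> \<tau>)\<^sup>2) * cos (\<theta> l y) - (2 * p * (u l \<bullet> \<tau>) + \<kappa> * (u l \<bullet> \<tau>')) * sin (\<theta> l y)))" for l s
    have jets: "jet2 (\<lambda>t. wave i \<rho> l s (\<gamma> t)) (G1 l s) (G2 l s)" for l s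
    proof (rule jet2_cong)
      show "jet2 (\<lambda>t. cell_wave i \<rho> l s n z (\<gamma> t)) (G1 l s) (G2 l s)"
        using jet2_wave[OF pq(1) jt, of "sqrt (w l)" l] y
        by (cases s) (simp_all add: cell_wave_def G1_def G2_def \<kappa>_def \<theta>_def)
      have "\<forall>\<^sub>F t in nhds 0. layer i (\<gamma> t) = n \<and> box_index \<rho> (layer i (\<gamma> t)) (\<gamma> t) = z"
        by (rule eventually_nhds_isCont[OF cont]) (use ev y in \<open>simp add: n_def z_def\<close>)
      then show "\<forall>\<^sub>F t in nhds 0. cell_wave i \<rho> l s n z (\<gamma> t) = wave i \<rho> l s (\<gamma> t)"
      proof eventually_elim
        case (elim t)
        show ?case unfolding wave_def conjunct2[OF elim] unfolding conjunct1[OF elim] ..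
      qed
    qed
    note mom1 = wave_moments(1)[OF finL w0 w1 w2 w4, where p=p and \<kappa>=\<kappa> and \<tau>=\<tau> and \<theta>="\<lambda>l. \<theta> l y"]
    note mom2 = wave_moments(2)[OF finL w0 w1 w2 w4, where p=p and q=q and \<kappa>=\<kappa> and \<tau>=\<tau> and \<tau>'=\<tau>' and \<theta>="\<lambda>l. \<theta> l y"]
    have "(\<Sum>l\<in>L. \<Sum>s\<in>UNIV. (G1 l s)\<^sup>2) = p\<^sup>2 + \<kappa>\<^sup>2 * (norm \<tau>)\<^sup>2"
      using mom1 by (simp add: UNIV_bool G1_def)
    moreover have "(norm \<tau>)\<^sup>2 \<ge> ((1 - \<epsilon>)\<^sup>2 * X)\<^sup>2"
      using tau_low X e1 by (intro power_mono) auto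
    then have "(1 - \<epsilon>) ^ 4 * X\<^sup>2 * \<kappa>\<^sup>2 \<le> (norm \<tau>)\<^sup>2 * \<kappa>\<^sup>2"
      by (intro mult_right_mono) (auto simp: power_mult_distrib simp flip: power_mult)
    ultimately have S1: "(\<Sum>l\<in>L. \<Sum>s\<in>UNIV. (G1 l s)\<^sup>2) \<ge> (1 - \<epsilon>) ^ 4 * X\<^sup>2 * \<kappa>\<^sup>2"
      by (simp add: mult.commute) (metis add_increasing zero_le_power2)
    have t2: "(norm \<tau>)\<^sup>2 \<le> 4 * X\<^sup>2"
    proof -
      have "X / (1 - \<epsilon>) \<le> X / (1 / 2)" using e1 X by (intro divide_left_mono) auto
      then have "norm \<tau> \<le> 2 * X" using tau_up by simp
      then have "(norm \<tau>)\<^sup>2 \<le> (2 * X)\<^sup>2" by (rule power_mono) simp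
      then show ?thesis by (simp add: power_mult_distrib)
    qed
    have X4: "X ^ 4 = X\<^sup>2 * X\<^sup>2" by (simp add: power2_eq_square power4_eq_xxxx)
    have nu2: "\<nu>\<^sup>2 \<le> \<nu>" using \<nu> by (simp add: power2_eq_square mult_left_le)
    (* Of the five terms in the bound for the second derivatives, only the one with c is not small. *)
    have b1: "q\<^sup>2 \<le> \<nu> * X ^ 4"
    proof -
      have "q\<^sup>2 \<le> (\<nu> * X\<^sup>2)\<^sup>2" using power_mono[OF q, of 2] by simp
      also have "\<dots> = \<nu>\<^sup>2 * X ^ 4" unfolding X4 by (simp add: power2_eq_square)
      also have "\<dots> \<le> \<nu> * X ^ 4" using nu2 by (intro mult_right_mono) auto
      finally show ?thesis .
    qed
    have b2: "- 2 * q * \<kappa> * (norm \<tau>)\<^sup>2 \<le> 8 * \<nu> * X ^ 4"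
    proof -
      have m1: "\<bar>q * \<kappa>\<bar> \<le> \<nu> * X\<^sup>2 * 1"
        unfolding abs_mult by (rule mult_mono[OF q chi1]) (use \<nu> in auto)
      have "- (q * \<kappa>) * (norm \<tau>)\<^sup>2 \<le> (\<nu> * X\<^sup>2 * 1) * (4 * X\<^sup>2)"
        by (rule mult_mono[OF order_trans[OF abs_ge_minus_self m1] t2]) (use \<nu> in auto)
      moreover have "- 2 * q * \<kappa> * (norm \<tau>)\<^sup>2 = 2 * (- (q * \<kappa>) * (norm \<tau>)\<^sup>2)" by simp
      moreover have "8 * \<nu> * X ^ 4 = 2 * ((\<nu> * X\<^sup>2 * 1) * (4 * X\<^sup>2))" unfolding X4 by simp
      ultimately show ?thesis by (simp only: mult_le_cancel_left_pos zero_less_numeral)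
    qed
    have b3: "c * \<kappa>\<^sup>2 * norm \<tau> ^ 4 \<le> c / (1 - \<epsilon>) ^ 4 * X ^ 4 * \<kappa>\<^sup>2"
    proof -
      have "norm \<tau> ^ 4 \<le> (X / (1 - \<epsilon>)) ^ 4" using tau_up by (rule power_mono) simp
      then have "c * \<kappa>\<^sup>2 * norm \<tau> ^ 4 \<le> c * \<kappa>\<^sup>2 * (X / (1 - \<epsilon>)) ^ 4"
        using \<open>c \<ge> 0\<close> by (intro mult_left_mono) auto
      then show ?thesis by (simp add: power_divide mult_ac)
    qed
    have b4: "8 * p\<^sup>2 * (norm \<tau>)\<^sup>2 \<le> 32 * \<nu> * X ^ 4"
    proof -
      have "p\<^sup>2 \<le> (\<nu> * X)\<^sup>2" using power_mono[OF p, of 2] by simp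
      also have "\<dots> \<le> \<nu> * X\<^sup>2" using nu2 by (simp add: power_mult_distrib mult_right_mono)
      finally have "p\<^sup>2 * (norm \<tau>)\<^sup>2 \<le> (\<nu> * X\<^sup>2) * (4 * X\<^sup>2)" using t2 \<nu> by (intro mult_mono) auto
      moreover have "(\<nu> * X\<^sup>2) * (4 * X\<^sup>2) = 4 * (\<nu> * X ^ 4)" unfolding X4 by simp
      ultimately have "8 * (p\<^sup>2 * (norm \<tau>)\<^sup>2) \<le> 8 * (4 * (\<nu> * X ^ 4))" by linarith
      then show ?thesis by (simp only: mult.assoc[symmetric])
    qed
    have b5: "2 * \<kappa>\<^sup>2 * (norm \<tau>')\<^sup>2 \<le> 8 * \<epsilon>\<^sup>2 * X ^ 4 * \<kappa>\<^sup>2"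
    proof -
      have "(norm \<tau>')\<^sup>2 \<le> (2 * \<epsilon> * X\<^sup>2)\<^sup>2" using tau'_up by (rule power_mono) simp
      then have "2 * \<kappa>\<^sup>2 * (norm \<tau>')\<^sup>2 \<le> 2 * \<kappa>\<^sup>2 * (2 * \<epsilon> * X\<^sup>2)\<^sup>2" by (intro mult_left_mono) auto
      also have "\<dots> = 8 * \<epsilon>\<^sup>2 * X ^ 4 * \<kappa>\<^sup>2" unfolding X4 by (simp add: power2_eq_square)
      finally show ?thesis .
    qed
    have "(\<Sum>l\<in>L. \<Sum>s\<in>UNIV. (G2 l s)\<^sup>2) \<le> q\<^sup>2 - 2 * q * \<kappa> * (norm \<tau>)\<^sup>2 + c * \<kappa>\<^sup>2 * norm \<tau> ^ 4 + 8 * p\<^sup>2 * (norm \<tau>)\<^sup>2 + 2 * \<kappa>\<^sup>2 * (norm \<tau>')\<^sup>2"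
      using mom2 by (simp add: UNIV_bool G2_def)
    also have "\<dots> \<le> \<nu> * X ^ 4 + 8 * \<nu> * X ^ 4 + c / (1 - \<epsilon>) ^ 4 * X ^ 4 * \<kappa>\<^sup>2 + 32 * \<nu> * X ^ 4 + 8 * \<epsilon>\<^sup>2 * X ^ 4 * \<kappa>\<^sup>2"
      using add_mono[OF add_mono[OF add_mono[OF add_mono[OF b1 b2] b3] b4] b5] by simp
    also have "\<dots> = (c / (1 - \<epsilon>) ^ 4 + 8 * \<epsilon>\<^sup>2) * X ^ 4 * \<kappa>\<^sup>2 + 41 * \<nu> * X ^ 4"
      by (simp add: distrib_right)
    finally show ?thesis using jets S1 unfolding \<kappa>_def n_def by blast
  }
qed

end

text \<open>The layers are cut out by the logarithm of the local scale \<open>R\<close>. Its derivatives are small in the unit of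
  length \<open>R\<close> because those of \<open>R\<close> are small in the fixed unit: a derivative \<open>R' \<xi>\<close> contributes
  \<open>R' \<xi> / R\<close>, which is small in comparison with \<open>X = norm \<xi> / R\<close>.\<close>

lemma log_scale_jet:
  fixes \<gamma> :: "real \<Rightarrow> 'f::euclidean_space"
  assumes j: "jet2 \<gamma> \<xi> \<eta>"
    and R: "\<And>s. 0 < R s" "\<And>s. R s \<le> 1" "\<And>s. (R has_real_derivative R1 s) (at s)"
      "\<And>s. (R1 has_real_derivative R2 s) (at s)"
    and b1: "\<And>s. s \<ge> 0 \<Longrightarrow> (1 + s) * \<bar>R1 s\<bar> \<le> e / 6" and b2: "\<And>s. s \<ge> 0 \<Longrightarrow> (1 + s) * \<bar>R2 s\<bar> \<le> e / 6"
    and e: "0 < e" "e \<le> 1" and l: "l > 0"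
    and X: "X = norm \<xi> / R (\<gamma> 0 \<bullet> \<gamma> 0)" and eta: "norm \<eta> / R (\<gamma> 0 \<bullet> \<gamma> 0) \<le> X\<^sup>2"
  shows "\<exists>p q. jet2 (\<lambda>t. - ln (R (\<gamma> t \<bullet> \<gamma> t)) / l) p q \<and> \<bar>p\<bar> \<le> 3 * e / l * X \<and> \<bar>q\<bar> \<le> 3 * e / l * X\<^sup>2"
proof -
  define y where "y = \<gamma> 0"
  define s where "s = y \<bullet> y"
  define a where "a = R s"
  define ps where "ps = 2 * (y \<bullet> \<xi>)"
  define qs where "qs = 2 * (y \<bullet> \<eta>) + 2 * (norm \<xi>)\<^sup>2"
  define p where "p = R1 s * ps"
  define q where "q = R2 s * ps\<^sup>2 + R1 s * qs"
  have a: "0 < a" "a \<le> 1" using R by (auto simp: a_def)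
  have s0: "s \<ge> 0" "s = (norm y)\<^sup>2" by (simp_all add: s_def power2_norm_eq_inner)
  have js: "jet2 (\<lambda>t. \<gamma> t \<bullet> \<gamma> t) ps qs"
    using jet2_bilinear[OF bounded_bilinear_inner j j]
    by (simp add: ps_def qs_def y_def inner_commute power2_norm_eq_inner algebra_simps)
  have ja: "jet2 (\<lambda>t. R (\<gamma> t \<bullet> \<gamma> t)) p q"
    using jet2_compose[OF js open_UNIV, of R R1 "R2 s"] R by (simp add: p_def q_def s_def y_def)
  have "(inverse has_real_derivative - (inverse a)\<^sup>2) (at a)"
    using DERIV_inverse[of a] a by (simp add: power2_eq_square)
  then have jl: "jet2 (\<lambda>t. ln (R (\<gamma> t \<bullet> \<gamma> t))) (inverse a * p) (- (inverse a)\<^sup>2 * p\<^sup>2 + inverse a * q)"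
    using jet2_compose[OF ja, of "{0<..}" ln inverse "- (inverse a)\<^sup>2"] R(1) DERIV_ln
    by (simp add: a_def s_def y_def)
  have bl: "bounded_linear (\<lambda>x::real. - x / l)"
    by (rule bounded_linear_compose[OF bounded_linear_divide bounded_linear_minus[OF bounded_linear_ident]])
  have jn: "jet2 (\<lambda>t. - ln (R (\<gamma> t \<bullet> \<gamma> t)) / l) (- (inverse a * p) / l) (- (- (inverse a)\<^sup>2 * p\<^sup>2 + inverse a * q) / l)"
    by (rule jet2_bounded_linear[OF bl jl])
  have n1: "2 * norm y \<le> 1 + s"
  proof -
    have "0 \<le> (norm y - 1)\<^sup>2" by simp
    then show ?thesis by (simp add: s0(2) power2_eq_square algebra_simps)
  qed
  have cs: "\<bar>y \<bullet> v\<bar> \<le> norm y * norm v" for v by (rule Cauchy_Schwarz_ineq2)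
  have pb: "\<bar>p\<bar> \<le> e / 6 * norm \<xi>"
  proof -
    have "\<bar>p\<bar> \<le> \<bar>R1 s\<bar> * (2 * norm y * norm \<xi>)"
      unfolding p_def abs_mult ps_def using cs[of \<xi>] by (intro mult_left_mono) auto
    also have "\<dots> \<le> \<bar>R1 s\<bar> * ((1 + s) * norm \<xi>)"
      using n1 by (intro mult_left_mono mult_right_mono) auto
    also have "\<dots> = ((1 + s) * \<bar>R1 s\<bar>) * norm \<xi>" by simp
    also have "\<dots> \<le> e / 6 * norm \<xi>" by (intro mult_right_mono b1 s0) simp
    finally show ?thesis .
  qed
  have qb: "\<bar>q\<bar> \<le> e * (norm \<xi>)\<^sup>2 + e / 6 * norm \<eta>"
  proof -
    have "ps\<^sup>2 \<le> 4 * s * (norm \<xi>)\<^sup>2"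
    proof -
      have "\<bar>ps\<bar> \<le> 2 * norm y * norm \<xi>" using cs[of \<xi>] by (simp add: ps_def)
      from power_mono[OF this, of 2] show ?thesis by (simp add: s0(2) power_mult_distrib)
    qed
    also have "\<dots> \<le> 4 * (1 + s) * (norm \<xi>)\<^sup>2" by (intro mult_right_mono) auto
    finally have "\<bar>R2 s * ps\<^sup>2\<bar> \<le> \<bar>R2 s\<bar> * (4 * (1 + s) * (norm \<xi>)\<^sup>2)"
      unfolding abs_mult by (intro mult_left_mono) auto
    also have "\<dots> = ((1 + s) * \<bar>R2 s\<bar>) * (4 * (norm \<xi>)\<^sup>2)" by simp
    also have "\<dots> \<le> e / 6 * (4 * (norm \<xi>)\<^sup>2)" by (intro mult_right_mono b2 s0) simp
    finally have 1: "\<bar>R2 s * ps\<^sup>2\<bar> \<le> e / 6 * (4 * (norm \<xi>)\<^sup>2)" .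
    have "\<bar>qs\<bar> \<le> 2 * norm y * norm \<eta> + 2 * (norm \<xi>)\<^sup>2"
      using cs[of \<eta>] unfolding qs_def by (intro order_trans[OF abs_triangle_ineq]) simp
    also have "\<dots> \<le> (1 + s) * norm \<eta> + (1 + s) * (2 * (norm \<xi>)\<^sup>2)"
    proof (rule add_mono)
      show "2 * norm y * norm \<eta> \<le> (1 + s) * norm \<eta>" using n1 by (intro mult_right_mono) auto
      have "1 * (2 * (norm \<xi>)\<^sup>2) \<le> (1 + s) * (2 * (norm \<xi>)\<^sup>2)" using s0 by (intro mult_right_mono) auto
      then show "2 * (norm \<xi>)\<^sup>2 \<le> (1 + s) * (2 * (norm \<xi>)\<^sup>2)" by simp
    qed
    finally have "\<bar>R1 s * qs\<bar> \<le> \<bar>R1 s\<bar> * ((1 + s) * norm \<eta> + (1 + s) * (2 * (norm \<xi>)\<^sup>2))"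
      unfolding abs_mult by (intro mult_left_mono) auto
    also have "\<dots> = ((1 + s) * \<bar>R1 s\<bar>) * (norm \<eta> + 2 * (norm \<xi>)\<^sup>2)" by (simp add: algebra_simps)
    also have "\<dots> \<le> e / 6 * (norm \<eta> + 2 * (norm \<xi>)\<^sup>2)" by (intro mult_right_mono b1 s0) simp
    finally have 2: "\<bar>R1 s * qs\<bar> \<le> e / 6 * (norm \<eta> + 2 * (norm \<xi>)\<^sup>2)" .
    have "\<bar>q\<bar> \<le> e / 6 * (4 * (norm \<xi>)\<^sup>2) + e / 6 * (norm \<eta> + 2 * (norm \<xi>)\<^sup>2)"
      unfolding q_def by (rule order_trans[OF abs_triangle_ineq add_mono[OF 1 2]])
    also have "\<dots> = e * (norm \<xi>)\<^sup>2 + e / 6 * norm \<eta>" by (simp add: algebra_simps)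
    finally show ?thesis .
  qed
  have X': "X = norm \<xi> / a" by (simp add: X a_def s_def y_def)
  have X0: "X \<ge> 0" using a by (simp add: X')
  have eta': "norm \<eta> / a \<le> X\<^sup>2" using eta by (simp add: a_def s_def y_def)
  have ap: "\<bar>inverse a * p\<bar> \<le> e * X"
  proof -
    have "\<bar>inverse a * p\<bar> \<le> inverse a * (e / 6 * norm \<xi>)"
      unfolding abs_mult using pb a by (intro mult_mono) auto
    also have "\<dots> = e / 6 * X" using a by (simp add: X' field_simps)
    also have "\<dots> \<le> e * X" using X0 e by (intro mult_right_mono) auto
    finally show ?thesis .
  qed
  have aq: "\<bar>inverse a * q\<bar> \<le> 2 * e * X\<^sup>2"
  proof -
    have "\<bar>inverse a * q\<bar> \<le> inverse a * (e * (norm \<xi>)\<^sup>2 + e / 6 * norm \<eta>)"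
      unfolding abs_mult using qb a by (intro mult_mono) auto
    also have "\<dots> = e * ((norm \<xi>)\<^sup>2 / a) + e / 6 * (norm \<eta> / a)" using a by (simp add: field_simps)
    also have "\<dots> \<le> e * X\<^sup>2 + e * X\<^sup>2"
    proof (rule add_mono)
      have "(norm \<xi>)\<^sup>2 / a = a * X\<^sup>2" using a by (simp add: X' power2_eq_square)
      also have "\<dots> \<le> 1 * X\<^sup>2" using a by (intro mult_right_mono) auto
      finally show "e * ((norm \<xi>)\<^sup>2 / a) \<le> e * X\<^sup>2" using e by (intro mult_left_mono) auto
      have "e / 6 * (norm \<eta> / a) \<le> e * (norm \<eta> / a)" using e a by (intro mult_right_mono) auto
      also have "\<dots> \<le> e * X\<^sup>2" using e eta' by (intro mult_left_mono) auto
      finally show "e / 6 * (norm \<eta> / a) \<le> e * X\<^sup>2" .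
    qed
    finally show ?thesis by simp
  qed
  have "\<bar>- (inverse a * p) / l\<bar> \<le> 3 * e / l * X"
  proof -
    have "\<bar>- (inverse a * p) / l\<bar> \<le> e * X / l" using ap l by (simp add: abs_divide divide_right_mono)
    also have "\<dots> \<le> 3 * (e * X) / l" using e X0 l by (intro divide_right_mono) auto
    finally show ?thesis by simp
  qed
  moreover have "\<bar>- (- (inverse a)\<^sup>2 * p\<^sup>2 + inverse a * q) / l\<bar> \<le> 3 * e / l * X\<^sup>2"
  proof -
    have "(inverse a * p)\<^sup>2 \<le> (e * X)\<^sup>2" using power_mono[OF ap, of 2] by simp
    also have "\<dots> = e * (e * X\<^sup>2)" by (simp add: power2_eq_square)
    also have "\<dots> \<le> 1 * (e * X\<^sup>2)" using e by (intro mult_right_mono) auto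
    finally have "\<bar>- (inverse a)\<^sup>2 * p\<^sup>2\<bar> \<le> e * X\<^sup>2" by (simp add: power_mult_distrib abs_mult)
    then have "\<bar>- (inverse a)\<^sup>2 * p\<^sup>2 + inverse a * q\<bar> \<le> e * X\<^sup>2 + 2 * e * X\<^sup>2"
      using aq by (intro order_trans[OF abs_triangle_ineq add_mono])
    then have "\<bar>- (- (inverse a)\<^sup>2 * p\<^sup>2 + inverse a * q)\<bar> / l \<le> (e * X\<^sup>2 + 2 * e * X\<^sup>2) / l"
      using l by (intro divide_right_mono) (simp_all only: abs_minus_cancel less_imp_le)
    then show ?thesis using l by (simp add: abs_divide)
  qed
  ultimately show ?thesis using jn by blast
qed

lemma small_parameter:
  fixes c \<delta> :: real
  assumes "\<delta> > 0"
  obtains \<epsilon> where "0 < \<epsilon>" "\<epsilon> < 1 / 2" "c / (1 - \<epsilon>) ^ 4 + 49 * \<epsilon> \<le> (c + \<delta>) * (1 - \<epsilon>) ^ 8"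
proof -
  have "((\<lambda>\<epsilon>. (c + \<delta>) * (1 - \<epsilon>) ^ 8 - (c / (1 - \<epsilon>) ^ 4 + 49 * \<epsilon>)) \<longlongrightarrow> (c + \<delta>) * (1 - 0) ^ 8 - (c / (1 - 0) ^ 4 + 49 * 0)) (at_right 0)"
    by (intro tendsto_intros) auto
  then have "((\<lambda>\<epsilon>. (c + \<delta>) * (1 - \<epsilon>) ^ 8 - (c / (1 - \<epsilon>) ^ 4 + 49 * \<epsilon>)) \<longlongrightarrow> \<delta>) (at_right 0)" by simp
  from order_tendstoD(1)[OF this assms]
  have "\<forall>\<^sub>F \<epsilon> in at_right 0. c / (1 - \<epsilon>) ^ 4 + 49 * \<epsilon> \<le> (c + \<delta>) * (1 - \<epsilon>) ^ 8" by eventually_elim simp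
  moreover have "\<forall>\<^sub>F \<epsilon>::real in at_right 0. \<epsilon> \<in> {0<..<1/2}" by (rule eventually_at_right_real) simp
  ultimately have "\<forall>\<^sub>F \<epsilon> in at_right 0. \<epsilon> \<in> {0<..<1/2} \<and> c / (1 - \<epsilon>) ^ 4 + 49 * \<epsilon> \<le> (c + \<delta>) * (1 - \<epsilon>) ^ 8"
    by eventually_elim simp
  then obtain \<epsilon> where "\<epsilon> \<in> {0<..<1/2}" "c / (1 - \<epsilon>) ^ 4 + 49 * \<epsilon> \<le> (c + \<delta>) * (1 - \<epsilon>) ^ 8"
    using eventually_happens trivial_limit_at_right_real by blast
  then show ?thesis by (intro that[of \<epsilon>]) auto
qed

text \<open>The main analytic construction. Here \<open>Y\<close> plays the role of an embedded manifold, \<open>P y\<close> that of its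
  tangent space at \<open>y\<close>, \<open>T y\<close> that of a projection to this tangent space, and \<open>B\<close> bounds the normal
  acceleration of its curves. No bound uniform in \<open>y\<close> is available, so the scale at which the map
  oscillates has to decrease at infinity; it does so slowly enough for neighbouring cells to have
  almost the same scale.\<close>

lemma oscillating_map:
  fixes Y :: "'f::euclidean_space set" and P :: "'f \<Rightarrow> 'f set" and T :: "'f \<Rightarrow> 'f \<Rightarrow> 'e::euclidean_space"
    and B :: "'f \<Rightarrow> real" and \<delta> :: real
  assumes lin: "\<And>y. linear (T y)" and contr: "\<And>y v. norm (T y v) \<le> norm v"
    and iso: "\<And>\<epsilon> R. \<epsilon> > 0 \<Longrightarrow> \<exists>d>0. \<forall>y\<in>Y. \<forall>y'\<in>Y. norm y \<le> R \<longrightarrow> dist y y' \<le> d \<longrightarrow>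
       (\<forall>\<xi>\<in>P y. norm (T y' \<xi>) \<ge> (1 - \<epsilon>) * norm \<xi>)"
    and bnd: "\<And>R. \<exists>b. \<forall>y\<in>Y. norm y \<le> R \<longrightarrow> B y \<le> b"
    and \<delta>: "\<delta> > 0"
  defines "c \<equiv> 3 * real DIM('e) / (real DIM('e) + 2)"
  shows "\<exists>(n::nat) \<Phi>. (\<forall>i. smooth_on UNIV (\<Phi> i)) \<and> (\<forall>y. (\<Sum>i<n. (\<Phi> i y)\<^sup>2) = 1) \<and>
     (\<forall>y\<in>Y. \<forall>\<xi>\<in>P y. \<forall>\<eta> \<gamma>. norm \<eta> \<le> B y * (norm \<xi>)\<^sup>2 \<longrightarrow> jet2 \<gamma> \<xi> \<eta> \<longrightarrow> \<gamma> 0 = y \<longrightarrow>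
       (\<exists>G1 G2. (\<forall>i. jet2 (\<lambda>t. \<Phi> i (\<gamma> t)) (G1 i) (G2 i)) \<and>
          (\<Sum>i<n. (G2 i)\<^sup>2) \<le> (c + \<delta>) * (\<Sum>i<n. (G1 i)\<^sup>2)\<^sup>2 \<and> (\<xi> \<noteq> 0 \<longrightarrow> (\<Sum>i<n. (G1 i)\<^sup>2) > 0)))"
proof -
  have c0: "c \<ge> 0" by (simp add: c_def)
  obtain L :: "('e set + 'e) set" and w :: "'e set + 'e \<Rightarrow> real" and u :: "'e set + 'e \<Rightarrow> 'e"
    where design: "finite L" "\<And>l. 0 \<le> w l" "(\<Sum>l\<in>L. w l) = 1"
    "\<And>y. (\<Sum>l\<in>L. w l * (u l \<bullet> y)\<^sup>2) = (norm y)\<^sup>2"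
    "\<And>y. (\<Sum>l\<in>L. w l * (u l \<bullet> y) ^ 4) = c * norm y ^ 4"
    unfolding c_def by (rule spherical_design) blast
  obtain \<epsilon> where \<epsilon>: "0 < \<epsilon>" "\<epsilon> < 1 / 2" and \<epsilon>c: "c / (1 - \<epsilon>) ^ 4 + 49 * \<epsilon> \<le> (c + \<delta>) * (1 - \<epsilon>) ^ 8"
    by (rule small_parameter[OF \<delta>])
  obtain A1 A2 C0 where A: "\<And>x. (bump has_real_derivative A1 x) (at x)"
    "\<And>x. (A1 has_real_derivative A2 x) (at x)" and A0: "\<And>x. \<bar>A1 x\<bar> \<le> C0" "\<And>x. \<bar>A2 x\<bar> \<le> C0"
    by (rule bump_derivs) blast
  define C where "C = max 1 C0"
  have C: "C \<ge> 1" and AC: "\<And>x. \<bar>A1 x\<bar> \<le> C" "\<And>x. \<bar>A2 x\<bar> \<le> C"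
    using A0 by (auto simp: C_def le_max_iff_disj)
  (* The parameters depend on each other in this order. \<epsilon> bounds the distortion of the projections
     over a cell and the relative change of the scale between neighbouring layers; \<nu> is the size
     allowed to the derivatives of the cutoffs, divided by the number K of colours over which the
     errors add up; \<Lambda> is the size of the cells and e the slowness of the scale, both in the local unit
     of length, that make these derivatives small; only then is the scale itself chosen, below M. *)
  define K where "K = real (card ({0, 1::int} \<times> ((Basis :: 'f set) \<rightarrow>\<^sub>E {0, 1::int})))"
  have K: "K \<ge> 1"
  proof -
    have "card ({0, 1::int} \<times> ((Basis :: 'f set) \<rightarrow>\<^sub>E {0, 1::int})) > 0"
      by (subst card_gt_0_iff) (auto simp: finite_PiE PiE_eq_empty_iff)
    then show ?thesis by (simp add: K_def)
  qed
  define \<nu> where "\<nu> = \<epsilon> / K"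
  have \<nu>: "\<nu> > 0" "\<nu> \<le> 1" using \<epsilon> K by (auto simp: \<nu>_def divide_le_eq)
  define \<mu> where "\<mu> = - ln (1 - \<epsilon>)"
  have \<mu>: "\<mu> > 0" using \<epsilon> by (simp add: \<mu>_def ln_less_zero)
  have expmu: "exp (- \<mu>) = 1 - \<epsilon>" "exp \<mu> = 1 / (1 - \<epsilon>)"
    using \<epsilon> by (simp_all add: \<mu>_def exp_minus inverse_eq_divide)
  define Q where "Q = real DIM('f)"
  have Q: "Q > 0" by (simp add: Q_def)
  define \<Lambda> where "\<Lambda> = 8 * C * Q / \<nu>"
  have \<Lambda>: "\<Lambda> > 0" using C Q \<nu> by (simp add: \<Lambda>_def)
  define e where "e = min 1 (\<mu> * \<nu> / (12 * C))"
  have e: "0 < e" "e \<le> 1" using \<mu> \<nu> C by (auto simp: e_def)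
  have "\<exists>d>0. \<forall>y\<in>Y. \<forall>y'\<in>Y. norm y \<le> real k + 1 \<longrightarrow> dist y y' \<le> d \<longrightarrow>
       (\<forall>\<xi>\<in>P y. norm (T y' \<xi>) \<ge> (1 - \<epsilon>) * norm \<xi>)" for k by (rule iso[OF \<epsilon>(1)])
  then obtain d where d: "\<And>k. d k > 0" "\<And>k y y' \<xi>. y \<in> Y \<Longrightarrow> y' \<in> Y \<Longrightarrow> norm y \<le> real k + 1 \<Longrightarrow> dist y y' \<le> d k \<Longrightarrow>
       \<xi> \<in> P y \<Longrightarrow> norm (T y' \<xi>) \<ge> (1 - \<epsilon>) * norm \<xi>" by metis
  have "\<exists>b. \<forall>y\<in>Y. norm y \<le> real k + 1 \<longrightarrow> B y \<le> b" for k by (rule bnd)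
  then obtain b where b: "\<And>k y. y \<in> Y \<Longrightarrow> norm y \<le> real k + 1 \<Longrightarrow> B y \<le> b k" by metis
  define M where "M k = min (d k / (4 * \<Lambda> * Q)) (\<epsilon> / (\<bar>b k\<bar> + 1))" for k :: nat
  have M: "M k > 0" for k using d(1)[of k] \<Lambda> Q \<epsilon> by (auto simp: M_def intro!: divide_pos_pos)
  obtain R R1 R2 where Rsm: "smooth_on UNIV R" and R: "\<And>s. 0 < R s" "\<And>s. R s \<le> 1"
    and RM: "\<And>k s. real k \<le> s \<Longrightarrow> R s \<le> M k"
    and R12: "\<And>s. (R has_real_derivative R1 s) (at s)" "\<And>s. (R1 has_real_derivative R2 s) (at s)"
    and Rb: "\<And>s. s \<ge> 0 \<Longrightarrow> (1 + s) * \<bar>R1 s\<bar> \<le> e / 6" "\<And>s. s \<ge> 0 \<Longrightarrow> (1 + s) * \<bar>R2 s\<bar> \<le> e / 6"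
  proof (rule slowly_varying_function[of M "e / 6"])
    show "0 < M k" for k by (rule M)
    show "0 < e / 6" using e by simp
  qed blast
  define \<rho> where "\<rho> y = R (y \<bullet> y)" for y :: 'f
  define N where "N y = - ln (\<rho> y) / \<mu>" for y
  define r where "r n = exp (- \<mu> * of_int n)" for n :: int
  have \<rho>: "\<rho> y > 0" for y by (simp add: \<rho>_def R)
  have \<rho>N: "\<rho> y = exp (- \<mu> * N y)" for y using \<mu> \<rho>[of y] by (simp add: N_def)
  have r\<rho>: "(1 - \<epsilon>) * \<rho> y \<le> r n" "r n \<le> \<rho> y / (1 - \<epsilon>)" if "\<bar>N y - of_int n\<bar> < 1" for y n
  proof -
    have rr: "r n = \<rho> y * exp (\<mu> * (N y - of_int n))"
      unfolding \<rho>N r_def exp_add[symmetric] by (simp add: algebra_simps)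
    have "- \<mu> \<le> \<mu> * (N y - of_int n)" "\<mu> * (N y - of_int n) \<le> \<mu>"
      using that \<mu> mult_left_mono[of "-1" "N y - of_int n" \<mu>] mult_left_mono[of "N y - of_int n" 1 \<mu>] by auto
    then have "exp (- \<mu>) \<le> exp (\<mu> * (N y - of_int n))" "exp (\<mu> * (N y - of_int n)) \<le> exp \<mu>" by simp_all
    then have "\<rho> y * exp (- \<mu>) \<le> r n" "r n \<le> \<rho> y * exp \<mu>"
      using \<rho>[of y] unfolding rr by (auto intro: mult_left_mono)
    then show "(1 - \<epsilon>) * \<rho> y \<le> r n" "r n \<le> \<rho> y / (1 - \<epsilon>)" unfolding expmu by (simp_all add: mult.commute)
  qed
  define in_cell where "in_cell n z y \<longleftrightarrow> \<bar>N y - of_int n\<bar> < 1 \<and> (\<forall>b\<in>Basis. \<bar>y \<bullet> b / (\<Lambda> * r n) - of_int (z b)\<bar> < 1)"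
    for n :: int and z :: "'f \<Rightarrow> int" and y
  define T0 where "T0 n z = T (SOME y. y \<in> Y \<and> in_cell n z y)" for n z
  have smN: "smooth_on UNIV N"
  proof -
    have 1: "smooth_on UNIV (\<lambda>y::'f. y \<bullet> y)" by (intro smooth_on_inner smooth_on_id open_UNIV)
    have 2: "smooth_on UNIV \<rho>" unfolding \<rho>_def[abs_def]
      by (rule smooth_on_compose[OF open_UNIV open_UNIV _ 1 Rsm]) simp
    have 3: "smooth_on UNIV (\<lambda>y. ln (\<rho> y))"
      by (rule smooth_on_compose[OF open_UNIV _ _ 2 smooth_on_ln]) (use \<rho> in auto)
    have bl: "bounded_linear (\<lambda>x::real. - x / \<mu>)"
      by (rule bounded_linear_compose[OF bounded_linear_divide bounded_linear_minus[OF bounded_linear_ident]])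
    show ?thesis unfolding N_def[abs_def] by (rule smooth_on_linear_compose[OF bl open_UNIV 3])
  qed
  interpret cellwise_waves N r \<Lambda> T0 L w u c
    by (rule cellwise_waves.intro) (use smN \<Lambda> design lin contr in \<open>simp_all add: r_def T0_def\<close>)
  have K': "K = real (card colours)" by (simp add: K_def colours_def)
  define J where "J = colours \<times> L \<times> (UNIV :: bool set)"
  have "finite J" using finite_colours design(1) by (simp add: J_def)
  then obtain f where f: "bij_betw f {..<card J} J"
    using ex_bij_betw_nat_finite[of J] by (auto simp: atLeast0LessThan)
  define W where "W j = (case j of ((i, \<sigma>), l, s) \<Rightarrow> wave i \<sigma> l s)" for j
  have sumJ: "(\<Sum>k<card J. g (f k)) = (\<Sum>\<kappa>\<in>colours. \<Sum>l\<in>L. \<Sum>s\<in>UNIV. g (\<kappa>, l, s))" for g :: "(int \<times> ('f \<Rightarrow> int)) \<times> ('e set + 'e) \<times> bool \<Rightarrow> real"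
    using sum.reindex_bij_betw[OF f, of g] by (simp add: J_def sum.cartesian_product)
  show ?thesis
  proof (intro exI[of _ "card J"] exI[of _ "\<lambda>k. W (f k)"] conjI allI ballI impI)
    fix k show "smooth_on UNIV (W (f k))"
      by (cases "f k") (auto simp: W_def smooth_wave split: prod.split)
  next
    fix y show "(\<Sum>k<card J. (W (f k) y)\<^sup>2) = 1"
      using sumJ[of "\<lambda>j. (W j y)\<^sup>2"] sum_wave_squares[of y] by (simp add: W_def case_prod_beta)
  next
    fix y \<xi> \<eta> \<gamma>
    assume y: "y \<in> Y" and \<xi>: "\<xi> \<in> P y" and \<eta>: "norm \<eta> \<le> B y * (norm \<xi>)\<^sup>2" and j: "jet2 \<gamma> \<xi> \<eta>" and \<gamma>: "\<gamma> 0 = y"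
    define X where "X = norm \<xi> / \<rho> y"
    have X: "X \<ge> 0" using \<rho>[of y] by (simp add: X_def)
    define k where "k = nat \<lfloor>y \<bullet> y\<rfloor>"
    have ky: "real k \<le> y \<bullet> y" "y \<bullet> y < real k + 1"
      unfolding k_def by (simp_all add: floor_correct inner_ge_zero) 
    have nk: "norm y \<le> real k + 1"
    proof (rule power2_le_imp_le)
      have "(norm y)\<^sup>2 \<le> real k + 1" using ky by (simp add: power2_norm_eq_inner)
      also have "\<dots> \<le> (real k + 1)\<^sup>2" by (simp add: power2_eq_square algebra_simps)
      finally show "(norm y)\<^sup>2 \<le> (real k + 1)\<^sup>2" .
    qed simp
    have \<rho>M: "\<rho> y \<le> d k / (4 * \<Lambda> * Q)" "\<rho> y \<le> \<epsilon> / (\<bar>b k\<bar> + 1)"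
      using RM[OF ky(1)] by (simp_all add: \<rho>_def M_def)
    have eta: "norm \<eta> / \<rho> y \<le> \<epsilon> * X\<^sup>2"
    proof -
      have "\<rho> y * B y \<le> \<epsilon>"
      proof -
        have "\<rho> y * B y \<le> \<rho> y * (\<bar>b k\<bar> + 1)" using b[OF y nk] \<rho>[of y] by (intro mult_left_mono) auto
        also have "\<dots> \<le> \<epsilon> / (\<bar>b k\<bar> + 1) * (\<bar>b k\<bar> + 1)" using \<rho>M(2) by (intro mult_right_mono) auto
        also have "\<dots> = \<epsilon>"
        proof -
          have "\<bar>b k\<bar> + 1 \<noteq> 0" by linarith
          then show ?thesis by simp
        qed
        finally show ?thesis .
      qed
      then have "(\<rho> y * B y) * X\<^sup>2 \<le> \<epsilon> * X\<^sup>2" by (intro mult_right_mono) auto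
      moreover have "norm \<eta> / \<rho> y \<le> B y * (norm \<xi>)\<^sup>2 / \<rho> y" using \<eta> \<rho>[of y] by (intro divide_right_mono) auto
      moreover have "B y * (norm \<xi>)\<^sup>2 / \<rho> y = (\<rho> y * B y) * X\<^sup>2" using \<rho>[of y] by (simp add: X_def power2_eq_square)
      ultimately show ?thesis by linarith
    qed
    have e2: "1 - \<epsilon> > 1 / 2" using \<epsilon> by simp
    (* In the unit \<rho> y, the curve has the speed X, and its acceleration is small against X squared. *)
    have main: "\<exists>G1 G2. (\<forall>l s. jet2 (\<lambda>t. wave i \<sigma> l s (\<gamma> t)) (G1 l s) (G2 l s)) \<and>
     (\<Sum>l\<in>L. \<Sum>s\<in>UNIV. (G1 l s)\<^sup>2) \<ge> (1 - \<epsilon>) ^ 4 * X\<^sup>2 * (cutoff i \<sigma> (layer i y) y)\<^sup>2 \<and>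
     (\<Sum>l\<in>L. \<Sum>s\<in>UNIV. (G2 l s)\<^sup>2) \<le> (c / (1 - \<epsilon>) ^ 4 + 8 * \<epsilon>\<^sup>2) * X ^ 4 * (cutoff i \<sigma> (layer i y) y)\<^sup>2 + 41 * \<nu> * X ^ 4" for i \<sigma>
    proof (rule colour_jets[OF j X])
      show "0 \<le> \<nu>" "\<nu> \<le> 1" "0 \<le> \<epsilon>" "\<epsilon> < 1 / 2" "c \<ge> 0" "\<gamma> 0 = y" using \<nu> \<epsilon> c0 \<gamma> by auto
    next
      fix n :: int assume n: "\<bar>N y - of_int n\<bar> < 1"
      have rn: "r n > 0" by (simp add: r_def)
      have up: "v / r n \<le> (v / \<rho> y) / (1 - \<epsilon>)" if "v \<ge> 0" for v
      proof -
        have "v / r n \<le> v / ((1 - \<epsilon>) * \<rho> y)"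
          using r\<rho>(1)[OF n] that \<rho>[of y] e2 by (intro divide_left_mono mult_pos_pos rn) auto
        then show ?thesis by (simp add: mult.commute)
      qed
      show "norm \<xi> / r n \<le> X / (1 - \<epsilon>)" using up[of "norm \<xi>"] by (simp add: X_def)
      have up': "v / r n \<le> 2 * (v / \<rho> y)" if "v \<ge> 0" for v
      proof -
        have "(v / \<rho> y) / (1 - \<epsilon>) \<le> (v / \<rho> y) / (1 / 2)"
          using that e2 \<rho>[of y] by (intro divide_left_mono) auto
        also have "\<dots> = 2 * (v / \<rho> y)" by simp
        finally show ?thesis using up[OF that] by (rule order_trans[rotated])
      qed
      show "norm \<eta> / r n \<le> 2 * \<epsilon> * X\<^sup>2" using up'[of "norm \<eta>"] eta by simp
      show "slow (\<nu> / 2) X (\<lambda>t. cutoff i \<sigma> n (\<gamma> t))"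
      proof -
        have "norm \<eta> / R (\<gamma> 0 \<bullet> \<gamma> 0) \<le> X\<^sup>2"
        proof -
          have "\<epsilon> * X\<^sup>2 \<le> 1 * X\<^sup>2" using \<epsilon> by (intro mult_right_mono) auto
          then show ?thesis using eta \<gamma> by (simp add: \<rho>_def)
        qed
        from log_scale_jet[OF j R R12 Rb e \<mu> _ this]
        obtain p q where pq: "jet2 (\<lambda>t. N (\<gamma> t)) p q" "\<bar>p\<bar> \<le> 3 * e / \<mu> * X" "\<bar>q\<bar> \<le> 3 * e / \<mu> * X\<^sup>2"
          using \<gamma> by (auto simp: X_def N_def \<rho>_def)
        have el: "3 * e / \<mu> \<le> \<nu> / (4 * C)"
        proof -
          have "e \<le> \<mu> * \<nu> / (12 * C)" by (simp add: e_def)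
          then have "3 * e / \<mu> \<le> 3 * (\<mu> * \<nu> / (12 * C)) / \<mu>" using \<mu> by (intro divide_right_mono mult_left_mono) auto
          also have "\<dots> = \<nu> / (4 * C)" using \<mu> by simp
          finally show ?thesis .
        qed
        have "\<bar>p\<bar> \<le> \<nu> / (4 * C) * X" "\<bar>q\<bar> \<le> \<nu> / (4 * C) * X\<^sup>2"
          using pq(2,3) mult_right_mono[OF el X] mult_right_mono[OF el, of "X\<^sup>2"] by auto
        then have "slow (C * (\<nu> / (4 * C))) X (\<lambda>t. bump (N (\<gamma> t) - of_int i))"
          using \<nu> C X by (intro slow_bump[OF pq(1) _ _ _ _ _ A AC]) auto
        then have s1: "slow (\<nu> / 4) X (\<lambda>t. bump (N (\<gamma> t) - of_int i))" using C by simp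
        have sb: "slow (C * (2 / \<Lambda>)) X (\<lambda>t. bump (\<gamma> t \<bullet> b / (\<Lambda> * r n) - of_int (\<sigma> b)))" if "b \<in> Basis" for b
        proof (rule slow_bump[OF _ _ _ _ X C A AC])
          have bl: "bounded_linear (\<lambda>y. y \<bullet> b / (\<Lambda> * r n))"
            using bounded_linear_compose[OF bounded_linear_divide bounded_linear_inner_left] .
          show "jet2 (\<lambda>t. \<gamma> t \<bullet> b / (\<Lambda> * r n)) (\<xi> \<bullet> b / (\<Lambda> * r n)) (\<eta> \<bullet> b / (\<Lambda> * r n))"
            by (rule jet2_bounded_linear[OF bl j])
          have nb: "\<bar>v \<bullet> b / (\<Lambda> * r n)\<bar> \<le> 2 / \<Lambda> * (norm v / \<rho> y)" for v
          proof -
            have "\<bar>v \<bullet> b\<bar> \<le> norm v" by (rule Basis_le_norm[OF that])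
            then have "\<bar>v \<bullet> b\<bar> / r n \<le> 2 * (norm v / \<rho> y)"
              using up'[of "norm v"] divide_right_mono[of "\<bar>v \<bullet> b\<bar>" "norm v" "r n"] rn by simp
            then have "(\<bar>v \<bullet> b\<bar> / r n) / \<Lambda> \<le> (2 * (norm v / \<rho> y)) / \<Lambda>" using \<Lambda> by (intro divide_right_mono) auto
            then show ?thesis using \<Lambda> rn by (simp add: abs_divide abs_mult mult.commute)
          qed
          show "\<bar>\<xi> \<bullet> b / (\<Lambda> * r n)\<bar> \<le> 2 / \<Lambda> * X" using nb[of \<xi>] by (simp add: X_def)
          have "norm \<eta> / \<rho> y \<le> 1 * X\<^sup>2" using eta mult_right_mono[of \<epsilon> 1 "X\<^sup>2"] \<epsilon> by simp
          then have "2 / \<Lambda> * (norm \<eta> / \<rho> y) \<le> 2 / \<Lambda> * (1 * X\<^sup>2)" using \<Lambda> by (intro mult_left_mono) auto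
          then show "\<bar>\<eta> \<bullet> b / (\<Lambda> * r n)\<bar> \<le> 2 / \<Lambda> * X\<^sup>2" using nb[of \<eta>] by simp
          show "0 \<le> 2 / \<Lambda>" using \<Lambda> by simp
        qed
        have "slow (real DIM('f) * (C * (2 / \<Lambda>))) X (\<lambda>t. \<Prod>b\<in>Basis. bump (\<gamma> t \<bullet> b / (\<Lambda> * r n) - of_int (\<sigma> b)))"
          using sb C \<Lambda> X by (intro slow_prod) auto
        moreover have "real DIM('f) * (C * (2 / \<Lambda>)) = \<nu> / 4"
          using Q C \<nu> by (simp add: \<Lambda>_def Q_def)
        ultimately have s2: "slow (\<nu> / 4) X (\<lambda>t. \<Prod>b\<in>Basis. bump (\<gamma> t \<bullet> b / (\<Lambda> * r n) - of_int (\<sigma> b)))" by (simp only:)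
        show ?thesis
          using slow_mult[OF s1 s2 _ _ X] \<nu> by (simp add: cutoff_def)
      qed
      fix z assume z: "\<And>b. b \<in> Basis \<Longrightarrow> \<bar>y \<bullet> b / (\<Lambda> * r n) - of_int (z b)\<bar> < 1"
      define y' where "y' = (SOME y. y \<in> Y \<and> in_cell n z y)"
      have yc: "y \<in> Y \<and> in_cell n z y" using y n z by (simp add: in_cell_def)
      then have "y' \<in> Y \<and> in_cell n z y'" unfolding y'_def by (rule someI)
      then have y': "y' \<in> Y" "in_cell n z y'" by auto
      have "dist y y' \<le> d k"
      proof -
        have "\<bar>(y - y') \<bullet> b\<bar> \<le> 2 * \<Lambda> * r n" if "b \<in> Basis" for b
        proof -
          have "\<bar>y \<bullet> b / (\<Lambda> * r n) - y' \<bullet> b / (\<Lambda> * r n)\<bar> \<le> 2"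
            using z[OF that] y'(2) that unfolding in_cell_def by (smt (verit))
          then have "\<bar>(y - y') \<bullet> b\<bar> / (\<Lambda> * r n) \<le> 2"
            using \<Lambda> rn by (simp add: inner_diff_left diff_divide_distrib[symmetric] abs_divide abs_mult)
          then show ?thesis using \<Lambda> rn by (simp add: divide_le_eq mult.assoc)
        qed
        then have "norm (y - y') \<le> (\<Sum>b\<in>(Basis::'f set). 2 * \<Lambda> * r n)"
          by (intro order_trans[OF norm_le_l1] sum_mono)
        also have "\<dots> = Q * (2 * \<Lambda> * r n)" by (simp add: Q_def)
        also have "\<dots> \<le> Q * (2 * \<Lambda> * (2 * \<rho> y))"
        proof -
          have "\<rho> y / (1 - \<epsilon>) \<le> \<rho> y / (1 / 2)" using e2 \<rho>[of y] by (intro divide_left_mono) auto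
          then have "r n \<le> 2 * \<rho> y" using r\<rho>(2)[OF n] by simp
          then show ?thesis using Q \<Lambda> by (intro mult_left_mono) auto
        qed
        also have "\<dots> = 4 * \<Lambda> * Q * \<rho> y" by simp
        also have "\<dots> \<le> 4 * \<Lambda> * Q * (d k / (4 * \<Lambda> * Q))" using \<rho>M(1) Q \<Lambda> by (intro mult_left_mono) auto
        also have "\<dots> = d k" using Q \<Lambda> by simp
        finally show ?thesis by (simp add: dist_norm)
      qed
      from d(2)[OF y y'(1) nk this \<xi>] have t: "(1 - \<epsilon>) * norm \<xi> \<le> norm (T0 n z \<xi>)"
        by (simp add: T0_def y'_def)
      have "(1 - \<epsilon>)\<^sup>2 * X * r n \<le> (1 - \<epsilon>)\<^sup>2 * X * (\<rho> y / (1 - \<epsilon>))"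
        using r\<rho>(2)[OF n] X by (intro mult_left_mono) auto
      also have "\<dots> = (1 - \<epsilon>) * norm \<xi>" using e2 \<rho>[of y] by (simp add: X_def power2_eq_square)
      finally show "(1 - \<epsilon>)\<^sup>2 * X \<le> norm (T0 n z \<xi>) / r n"
        using t rn by (simp add: pos_le_divide_eq)
    qed
    define jets where "jets \<kappa> H \<longleftrightarrow> (\<forall>l s. jet2 (\<lambda>t. W (\<kappa>, l, s) (\<gamma> t)) (fst H l s) (snd H l s)) \<and>
     (\<Sum>l\<in>L. \<Sum>s\<in>UNIV. (fst H l s)\<^sup>2) \<ge> (1 - \<epsilon>) ^ 4 * X\<^sup>2 * (case \<kappa> of (i, \<sigma>) \<Rightarrow> (cutoff i \<sigma> (layer i y) y)\<^sup>2) \<and>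
     (\<Sum>l\<in>L. \<Sum>s\<in>UNIV. (snd H l s)\<^sup>2) \<le> (c / (1 - \<epsilon>) ^ 4 + 8 * \<epsilon>\<^sup>2) * X ^ 4 * (case \<kappa> of (i, \<sigma>) \<Rightarrow> (cutoff i \<sigma> (layer i y) y)\<^sup>2) + 41 * \<nu> * X ^ 4"
      for \<kappa> and H :: "(_ \<Rightarrow> _ \<Rightarrow> real) \<times> (_ \<Rightarrow> _ \<Rightarrow> real)"
    have "\<exists>H. jets \<kappa> H" for \<kappa>
    proof (cases \<kappa>)
      case (Pair i \<sigma>)
      from main[of i \<sigma>] obtain G1 G2 where "(\<forall>l s. jet2 (\<lambda>t. wave i \<sigma> l s (\<gamma> t)) (G1 l s) (G2 l s)) \<and>
     (\<Sum>l\<in>L. \<Sum>s\<in>UNIV. (G1 l s)\<^sup>2) \<ge> (1 - \<epsilon>) ^ 4 * X\<^sup>2 * (cutoff i \<sigma> (layer i y) y)\<^sup>2 \<and>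
     (\<Sum>l\<in>L. \<Sum>s\<in>UNIV. (G2 l s)\<^sup>2) \<le> (c / (1 - \<epsilon>) ^ 4 + 8 * \<epsilon>\<^sup>2) * X ^ 4 * (cutoff i \<sigma> (layer i y) y)\<^sup>2 + 41 * \<nu> * X ^ 4" by blast
      then have "jets \<kappa> (G1, G2)" by (simp add: jets_def Pair W_def)
      then show ?thesis ..
    qed
    then obtain H where H: "\<And>\<kappa>. jets \<kappa> (H \<kappa>)" by metis
    define G1 where "G1 = (\<lambda>(\<kappa>, l, s). fst (H \<kappa>) l s)"
    define G2 where "G2 = (\<lambda>(\<kappa>, l, s). snd (H \<kappa>) l s)"
    have jW: "jet2 (\<lambda>t. W j (\<gamma> t)) (G1 j) (G2 j)" for j
      by (cases j) (use H in \<open>auto simp: jets_def G1_def G2_def\<close>)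
    have S1: "(\<Sum>k<card J. (G1 (f k))\<^sup>2) \<ge> (1 - \<epsilon>) ^ 4 * X\<^sup>2"
    proof -
      have "(1 - \<epsilon>) ^ 4 * X\<^sup>2 = (\<Sum>\<kappa>\<in>colours. (1 - \<epsilon>) ^ 4 * X\<^sup>2 * (case \<kappa> of (i, \<sigma>) \<Rightarrow> (cutoff i \<sigma> (layer i y) y)\<^sup>2))"
        using sum_cutoff_squares[of y] by (simp flip: sum_distrib_left)
      also have "\<dots> \<le> (\<Sum>\<kappa>\<in>colours. \<Sum>l\<in>L. \<Sum>s\<in>UNIV. (fst (H \<kappa>) l s)\<^sup>2)"
        by (rule sum_mono) (use H in \<open>simp add: jets_def\<close>)
      also have "\<dots> = (\<Sum>k<card J. (G1 (f k))\<^sup>2)" using sumJ[of "\<lambda>j. (G1 j)\<^sup>2"] by (simp add: G1_def)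
      finally show ?thesis .
    qed
    have S2: "(\<Sum>k<card J. (G2 (f k))\<^sup>2) \<le> (c / (1 - \<epsilon>) ^ 4 + 49 * \<epsilon>) * X ^ 4"
    proof -
      have "(\<Sum>k<card J. (G2 (f k))\<^sup>2) = (\<Sum>\<kappa>\<in>colours. \<Sum>l\<in>L. \<Sum>s\<in>UNIV. (snd (H \<kappa>) l s)\<^sup>2)"
        using sumJ[of "\<lambda>j. (G2 j)\<^sup>2"] by (simp add: G2_def)
      also have "\<dots> \<le> (\<Sum>\<kappa>\<in>colours. (c / (1 - \<epsilon>) ^ 4 + 8 * \<epsilon>\<^sup>2) * X ^ 4 * (case \<kappa> of (i, \<sigma>) \<Rightarrow> (cutoff i \<sigma> (layer i y) y)\<^sup>2) + 41 * \<nu> * X ^ 4)"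
        by (rule sum_mono) (use H in \<open>simp add: jets_def\<close>)
      also have "\<dots> = (c / (1 - \<epsilon>) ^ 4 + 8 * \<epsilon>\<^sup>2) * X ^ 4 + K * (41 * \<nu> * X ^ 4)"
        using sum_cutoff_squares[of y] by (simp add: sum.distrib K' flip: sum_distrib_left)
      also have "\<dots> = (c / (1 - \<epsilon>) ^ 4 + (8 * \<epsilon>\<^sup>2 + 41 * \<epsilon>)) * X ^ 4"
        using K by (simp add: \<nu>_def algebra_simps)
      also have "\<dots> \<le> (c / (1 - \<epsilon>) ^ 4 + 49 * \<epsilon>) * X ^ 4"
      proof (intro mult_right_mono add_left_mono)
        have "\<epsilon> * \<epsilon> \<le> \<epsilon> * 1" using \<epsilon> by (intro mult_left_mono) auto
        then show "8 * \<epsilon>\<^sup>2 + 41 * \<epsilon> \<le> 49 * \<epsilon>" by (simp add: power2_eq_square)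
      qed simp
      finally show ?thesis .
    qed
    show "\<exists>G1 G2. (\<forall>k. jet2 (\<lambda>t. W (f k) (\<gamma> t)) (G1 k) (G2 k)) \<and>
          (\<Sum>k<card J. (G2 k)\<^sup>2) \<le> (c + \<delta>) * (\<Sum>k<card J. (G1 k)\<^sup>2)\<^sup>2 \<and> (\<xi> \<noteq> 0 \<longrightarrow> (\<Sum>k<card J. (G1 k)\<^sup>2) > 0)"
    proof (rule exI[of _ "\<lambda>k. G1 (f k)"], rule exI[of _ "\<lambda>k. G2 (f k)"], intro conjI allI impI jW)
      have "(c / (1 - \<epsilon>) ^ 4 + 49 * \<epsilon>) * X ^ 4 \<le> (c + \<delta>) * (1 - \<epsilon>) ^ 8 * X ^ 4"
        by (rule mult_right_mono[OF \<epsilon>c]) simp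
      also have "\<dots> = (c + \<delta>) * ((1 - \<epsilon>) ^ 4 * X\<^sup>2)\<^sup>2" by (simp add: power_mult_distrib flip: power_mult)
      also have "\<dots> \<le> (c + \<delta>) * (\<Sum>k<card J. (G1 (f k))\<^sup>2)\<^sup>2"
        using S1 c0 \<delta> e2 by (intro mult_left_mono power_mono) auto
      finally show "(\<Sum>k<card J. (G2 (f k))\<^sup>2) \<le> (c + \<delta>) * (\<Sum>k<card J. (G1 (f k))\<^sup>2)\<^sup>2" using S2 by linarith
      assume "\<xi> \<noteq> 0"
      then have "(1 - \<epsilon>) ^ 4 * X\<^sup>2 > 0" using e2 \<rho>[of y] by (simp add: X_def)
      then show "(\<Sum>k<card J. (G1 (f k))\<^sup>2) > 0" using S1 by linarith
    qed
  qed
qed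

section \<open>Smooth functions on a manifold\<close>

definition smooth_fun :: "('a, 'e::euclidean_space) chart set \<Rightarrow> 'a set \<Rightarrow> ('a \<Rightarrow> 'b::real_normed_vector) \<Rightarrow> bool" where
  "smooth_fun A V F \<longleftrightarrow> (\<forall>c\<in>A. smooth_on (snd c ` (fst c \<inter> V)) (\<lambda>u. F (chart_inv c u)))"

locale manifold =
  fixes X :: "'a topology" and A :: "('a, 'e::euclidean_space) chart set"
  assumes mfd: "smooth_manifold X A"
begin

lemma chart: "c \<in> A \<Longrightarrow> is_chart X c"
  using mfd by (simp add: smooth_manifold_def)

lemma chart_dom_open: "c \<in> A \<Longrightarrow> openin X (fst c)"
  using chart by (simp add: is_chart_def)

lemma chart_dom_subset: "c \<in> A \<Longrightarrow> fst c \<subseteq> topspace X"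
  using chart_dom_open openin_subset by blast

lemma chart_homeo: "c \<in> A \<Longrightarrow> homeomorphic_map (subtopology X (fst c)) (top_of_set (chart_image c)) (snd c)"
  using chart by (simp add: is_chart_def)

lemma chart_image_open: "c \<in> A \<Longrightarrow> open (chart_image c)"
  using chart by (simp add: is_chart_def)

lemma chart_inj: "c \<in> A \<Longrightarrow> inj_on (snd c) (fst c)"
  using chart_homeo[of c] chart_dom_subset[of c] homeomorphic_map_def
  by (metis homeomorphic_imp_injective_map topspace_subtopology_subset)

lemma chart_inv_left: "c \<in> A \<Longrightarrow> x \<in> fst c \<Longrightarrow> chart_inv c (snd c x) = x"
  using chart_inj by (simp add: inv_into_f_f)

lemma chart_inv_right: "u \<in> chart_image c \<Longrightarrow> snd c (chart_inv c u) = u"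
  by (rule f_inv_into_f)

lemma chart_inv_in: "u \<in> chart_image c \<Longrightarrow> chart_inv c u \<in> fst c"
  by (rule inv_into_into)

lemma chart_cover: "x \<in> topspace X \<Longrightarrow> \<exists>c\<in>A. x \<in> fst c"
  using mfd by (auto simp: smooth_manifold_def)

lemma chart_open_image: 
  assumes "c \<in> A" "openin X V"
  shows "open (snd c ` (fst c \<inter> V))"
proof -
  have "openin (subtopology X (fst c)) (fst c \<inter> V)"
    using assms by (metis openin_subtopology_Int2 Int_commute)
  then have "openin (top_of_set (chart_image c)) (snd c ` (fst c \<inter> V))"
    using chart_homeo[OF assms(1)] homeomorphic_imp_open_map open_map_def by blast
  then show ?thesis using chart_image_open[OF assms(1)] openin_open_eq by blast
qed

lemma chart_preimage_open:
  assumes "c \<in> A" "open O'"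
  shows "openin X {x \<in> fst c. snd c x \<in> O'}"
proof -
  have "continuous_map (subtopology X (fst c)) euclidean (snd c)"
    using chart_homeo[OF assms(1)] by (metis continuous_map_in_subtopology homeomorphic_imp_continuous_map)
  then have op: "openin (subtopology X (fst c)) {x \<in> topspace (subtopology X (fst c)). snd c x \<in> O'}"
    using assms(2) by (simp add: continuous_map_def)
  have top: "topspace (subtopology X (fst c)) = fst c" using chart_dom_subset[OF assms(1)] by auto
  show ?thesis
    using op unfolding top openin_open_subtopology[OF chart_dom_open[OF assms(1)]] by blast
qed

lemma chart_compact_preimage:
  assumes "c \<in> A" "compact C" "C \<subseteq> chart_image c"
  shows "compactin X {x \<in> fst c. snd c x \<in> C}"
proof -
  let ?U = "{x \<in> fst c. snd c x \<in> C}"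
  have "snd c ` ?U = C" using assms(3) by auto
  then have "compactin (top_of_set (chart_image c)) (snd c ` ?U)"
    using assms by (simp add: compactin_subtopology)
  moreover have "?U \<subseteq> topspace (subtopology X (fst c))" using chart_dom_subset[OF assms(1)] by auto
  ultimately have "compactin (subtopology X (fst c)) ?U"
    using homeomorphic_map_compactness[OF chart_homeo[OF assms(1)]] by blast
  then show ?thesis by (simp add: compactin_subtopology)
qed

lemma Hausdorff: "Hausdorff_space X"
  using mfd by (simp add: smooth_manifold_def)

lemma smooth_fun_subset: "smooth_fun A V F \<Longrightarrow> W \<subseteq> V \<Longrightarrow> smooth_fun A W F"
  unfolding smooth_fun_def by (blast intro: smooth_on_subset)

lemma smooth_fun_const: "openin X V \<Longrightarrow> smooth_fun A V (\<lambda>x. k)"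
  unfolding smooth_fun_def using smooth_on_const chart_open_image by blast

lemma smooth_fun_chart: "c \<in> A \<Longrightarrow> smooth_fun A (fst c) (snd c)"
  using mfd by (auto simp: smooth_fun_def smooth_manifold_def)

lemma smooth_fun_compose:
  fixes F :: "'a \<Rightarrow> 'b::euclidean_space" and g :: "'b \<Rightarrow> 'c::real_normed_vector"
  assumes "openin X V" "smooth_fun A V F" "open T" "F ` V \<subseteq> T" "smooth_on T g"
  shows "smooth_fun A V (\<lambda>x. g (F x))"
  unfolding smooth_fun_def
proof
  fix c assume c: "c \<in> A"
  show "smooth_on (snd c ` (fst c \<inter> V)) (\<lambda>u. g (F (chart_inv c u)))"
  proof (rule smooth_on_compose[OF chart_open_image[OF c assms(1)] assms(3) _ _ assms(5)])
    show "(\<lambda>u. F (chart_inv c u)) ` snd c ` (fst c \<inter> V) \<subseteq> T"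
      using assms(4) chart_inv_left[OF c] by auto
    show "smooth_on (snd c ` (fst c \<inter> V)) (\<lambda>u. F (chart_inv c u))"
      using assms(2) c by (simp add: smooth_fun_def)
  qed
qed

lemma smooth_fun_linear:
  assumes "openin X V" "bounded_linear L'" "smooth_fun A V F"
  shows "smooth_fun A V (\<lambda>x. L' (F x))"
  unfolding smooth_fun_def
proof
  fix c assume c: "c \<in> A"
  show "smooth_on (snd c ` (fst c \<inter> V)) (\<lambda>u. L' (F (chart_inv c u)))"
    by (rule smooth_on_linear_compose[OF assms(2) chart_open_image[OF c assms(1)]])
      (use assms(3) c in \<open>simp add: smooth_fun_def\<close>)
qed

lemma smooth_fun_bilinear:
  assumes "openin X V" "bounded_bilinear pr" "smooth_fun A V F" "smooth_fun A V G"
  shows "smooth_fun A V (\<lambda>x. pr (F x) (G x))"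
  unfolding smooth_fun_def
proof
  fix c assume c: "c \<in> A"
  show "smooth_on (snd c ` (fst c \<inter> V)) (\<lambda>u. pr (F (chart_inv c u)) (G (chart_inv c u)))"
    by (rule smooth_on_bilinear[OF assms(2) chart_open_image[OF c assms(1)]])
      (use assms(3,4) c in \<open>simp_all add: smooth_fun_def\<close>)
qed

lemma smooth_fun_add:
  assumes "openin X V" "smooth_fun A V F" "smooth_fun A V G"
  shows "smooth_fun A V (\<lambda>x. F x + G x)"
  unfolding smooth_fun_def
proof
  fix c assume c: "c \<in> A"
  show "smooth_on (snd c ` (fst c \<inter> V)) (\<lambda>u. F (chart_inv c u) + G (chart_inv c u))"
    by (rule smooth_on_add[OF chart_open_image[OF c assms(1)]])
      (use assms(2,3) c in \<open>simp_all add: smooth_fun_def\<close>)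
qed

lemma smooth_fun_sum:
  assumes "openin X V" "\<And>i. i \<in> I \<Longrightarrow> smooth_fun A V (F i)"
  shows "smooth_fun A V (\<lambda>x. \<Sum>i\<in>I. F i x)"
  using assms(2)
proof (induction I rule: infinite_finite_induct)
  case (insert i I)
  have "smooth_fun A V (\<lambda>x. F i x + (\<Sum>i\<in>I. F i x))"
    by (rule smooth_fun_add[OF assms(1)]) (use insert in auto)
  with insert.hyps show ?case by simp
qed (use smooth_fun_const[OF assms(1)] in auto)

lemma smooth_fun_prod:
  fixes F :: "'i \<Rightarrow> 'a \<Rightarrow> real"
  assumes "openin X V" "\<And>i. i \<in> I \<Longrightarrow> smooth_fun A V (F i)"
  shows "smooth_fun A V (\<lambda>x. \<Prod>i\<in>I. F i x)"
  using assms(2)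
proof (induction I rule: infinite_finite_induct)
  case (insert i I)
  have "smooth_fun A V (\<lambda>x. F i x * (\<Prod>i\<in>I. F i x))"
    by (rule smooth_fun_bilinear[OF assms(1) bounded_bilinear_mult]) (use insert in auto)
  with insert.hyps show ?case by simp
qed (use smooth_fun_const[OF assms(1)] in auto)

lemma smooth_fun_local:
  assumes V: "openin X V"
    and "\<And>x. x \<in> V \<Longrightarrow> \<exists>W G. openin X W \<and> x \<in> W \<and> smooth_fun A W G \<and> (\<forall>y\<in>W. G y = F y)"
  shows "smooth_fun A V F"
  unfolding smooth_fun_def
proof
  fix c assume c: "c \<in> A"
  show "smooth_on (snd c ` (fst c \<inter> V)) (\<lambda>u. F (chart_inv c u))"
  proof (rule smooth_on_local)
    fix u assume "u \<in> snd c ` (fst c \<inter> V)"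
    then obtain x where x: "x \<in> fst c" "x \<in> V" "u = snd c x" by auto
    then obtain W G where W: "openin X W" "x \<in> W" "smooth_fun A W G" "\<forall>y\<in>W. G y = F y"
      using assms(2) by blast
    show "\<exists>T g. open T \<and> u \<in> T \<and> smooth_on T g \<and> (\<forall>y\<in>T. g y = F (chart_inv c y))"
    proof (intro exI conjI)
      show "open (snd c ` (fst c \<inter> W))" by (rule chart_open_image[OF c W(1)])
      show "u \<in> snd c ` (fst c \<inter> W)" using x W(2) by auto
      show "smooth_on (snd c ` (fst c \<inter> W)) (\<lambda>u. G (chart_inv c u))" using W(3) c by (simp add: smooth_fun_def)
      show "\<forall>y\<in>snd c ` (fst c \<inter> W). G (chart_inv c y) = F (chart_inv c y)"
        using W(4) chart_inv_left[OF c] by auto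
    qed
  qed
qed

lemma smooth_fun_chart_rep:
  assumes "smooth_fun A (topspace X) F" "d \<in> A"
  shows "smooth_on (chart_image d) (\<lambda>u. F (chart_inv d u))"
proof -
  have "fst d \<inter> topspace X = fst d" using chart_dom_subset[OF assms(2)] by blast
  then show ?thesis using assms unfolding smooth_fun_def by metis
qed

lemma smooth_fun_Pair:
  assumes "openin X V" "smooth_fun A V F" "smooth_fun A V G"
  shows "smooth_fun A V (\<lambda>x. (F x, G x))"
proof -
  have "smooth_fun A V (\<lambda>x. (F x, 0) + (0, G x))"
    by (rule smooth_fun_add[OF assms(1)
        smooth_fun_linear[OF assms(1) bounded_linear_Pair[OF bounded_linear_ident bounded_linear_zero] assms(2)]
        smooth_fun_linear[OF assms(1) bounded_linear_Pair[OF bounded_linear_zero bounded_linear_ident] assms(3)]])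
  then show ?thesis by simp
qed

lemma smooth_fun_vec:
  fixes F :: "'k::finite \<Rightarrow> 'a \<Rightarrow> 'b::euclidean_space"
  assumes "openin X V" "\<And>k. smooth_fun A V (F k)"
  shows "smooth_fun A V (\<lambda>x. \<chi> k. F k x)"
proof -
  have "linear (axis k :: 'b \<Rightarrow> 'b ^ 'k)" for k
    by (rule linearI) (auto simp: axis_def vec_eq_iff)
  then have "bounded_linear (axis k :: 'b \<Rightarrow> 'b ^ 'k)" for k by (simp add: linear_conv_bounded_linear)
  then have "smooth_fun A V (\<lambda>x. \<Sum>k\<in>UNIV. (axis k (F k x) :: 'b ^ 'k))"
    by (intro smooth_fun_sum[OF assms(1)] smooth_fun_linear[OF assms(1) _ assms(2)])
  moreover have "(\<Sum>k\<in>UNIV. (axis k (F k x) :: 'b ^ 'k)) = (\<chi> k. F k x)" for x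
    by (simp add: vec_eq_iff axis_def if_distrib[of "\<lambda>f. f _"] cong: if_cong)
  ultimately show ?thesis by simp
qed

lemma smooth_fun_continuous:
  assumes "smooth_fun A (topspace X) F"
  shows "continuous_map X euclidean F"
  unfolding continuous_map_def
proof (intro conjI allI impI)
  show "F \<in> topspace X \<rightarrow> topspace euclidean" by simp
  fix O' :: "'b set" assume "openin euclidean O'"
  then have O': "open O'" by simp
  have "openin X {x \<in> fst c. F x \<in> O'}" if c: "c \<in> A" for c
  proof -
    have cont: "continuous_on (chart_image c) (\<lambda>u. F (chart_inv c u))"
      using assms c smooth_on_imp_continuous_on chart_dom_subset[OF c]
      by (fastforce simp: smooth_fun_def Int_absorb2)
    have "open (chart_image c \<inter> (\<lambda>u. F (chart_inv c u)) -` O')"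
      using continuous_open_preimage[OF cont chart_image_open[OF c] O'] .
    from chart_preimage_open[OF c this]
    have "openin X {x \<in> fst c. snd c x \<in> chart_image c \<inter> (\<lambda>u. F (chart_inv c u)) -` O'}" .
    moreover have "snd c x \<in> chart_image c \<inter> (\<lambda>u. F (chart_inv c u)) -` O' \<longleftrightarrow> F x \<in> O'" if "x \<in> fst c" for x
      using chart_inv_left[OF c that] that by simp
    ultimately show ?thesis by (simp cong: conj_cong)
  qed
  then have "openin X (\<Union>c\<in>A. {x \<in> fst c. F x \<in> O'})" by blast
  moreover have "(\<Union>c\<in>A. {x \<in> fst c. F x \<in> O'}) = {x \<in> topspace X. F x \<in> O'}"
    using chart_cover chart_dom_subset by blast
  ultimately show "openin X {x \<in> topspace X. F x \<in> O'}" by simp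
qed

text \<open>The changes of charts in the two directions are inverse to each other, and the chain rule applies.\<close>

lemma chart_change:
  assumes c: "c \<in> A" and d: "d \<in> A" and x: "x \<in> fst c" "x \<in> fst d"
  defines "\<tau> \<equiv> \<lambda>u. snd d (chart_inv c u)"
  shows "smooth_on (snd c ` (fst c \<inter> fst d)) \<tau>" and "open (snd c ` (fst c \<inter> fst d))"
    and "inj (frechet_derivative \<tau> (at (snd c x)))"
proof -
  let ?U = "snd c ` (fst c \<inter> fst d)" and ?V = "snd d ` (fst d \<inter> fst c)"
  let ?\<sigma> = "\<lambda>u. snd c (chart_inv d u)"
  show sm: "smooth_on ?U \<tau>" using smooth_fun_chart[OF d] c by (simp add: smooth_fun_def \<tau>_def)
  have sm': "smooth_on ?V ?\<sigma>" using smooth_fun_chart[OF c] d by (simp add: smooth_fun_def)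
  show op: "open ?U" by (rule chart_open_image[OF c chart_dom_open[OF d]])
  have u: "snd c x \<in> ?U" and tu: "\<tau> (snd c x) = snd d x" "snd d x \<in> ?V"
    using x chart_inv_left[OF c] by (auto simp: \<tau>_def)
  have "(\<tau> has_derivative frechet_derivative \<tau> (at (snd c x))) (at (snd c x))"
    by (rule smooth_on_has_derivative[OF sm u])
  moreover have "(?\<sigma> has_derivative frechet_derivative ?\<sigma> (at (snd d x))) (at (\<tau> (snd c x)))"
    unfolding tu(1) by (rule smooth_on_has_derivative[OF sm' tu(2)])
  ultimately have "((\<lambda>u. ?\<sigma> (\<tau> u)) has_derivative (\<lambda>v. frechet_derivative ?\<sigma> (at (snd d x)) (frechet_derivative \<tau> (at (snd c x)) v))) (at (snd c x))"
    by (rule has_derivative_compose)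
  moreover have "((\<lambda>u. ?\<sigma> (\<tau> u)) has_derivative (\<lambda>v. v)) (at (snd c x))"
    by (rule has_derivative_transform_within_open[OF has_derivative_ident op u])
      (auto simp: \<tau>_def chart_inv_left[OF c] chart_inv_left[OF d])
  ultimately have "frechet_derivative ?\<sigma> (at (snd d x)) (frechet_derivative \<tau> (at (snd c x)) v) = v" for v
    using has_derivative_unique by (metis (no_types, lifting))
  then show "inj (frechet_derivative \<tau> (at (snd c x)))" by (metis injI)
qed

text \<open>Balls of three times the radius are kept inside the charts, to leave room for cutoffs.\<close>

lemma countable_coordinate_balls:
  assumes "topspace X \<noteq> {}"
  obtains c :: "nat \<Rightarrow> ('a, 'e) chart" and p :: "nat \<Rightarrow> 'e" and s :: "nat \<Rightarrow> real"
  where "\<And>i. c i \<in> A" "\<And>i. s i > 0" "\<And>i. cball (p i) (3 * s i) \<subseteq> chart_image (c i)"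
    "topspace X = (\<Union>i. {x \<in> fst (c i). dist (p i) (snd (c i) x) < s i})"
proof -
  define good where "good t \<longleftrightarrow> (case t of (c, p, s) \<Rightarrow> c \<in> A \<and> s > 0 \<and> cball p (3 * s) \<subseteq> chart_image c)"
    for t :: "('a, 'e) chart \<times> 'e \<times> real"
  define U where "U t = (case t of (c, p, s) \<Rightarrow> {x \<in> fst c. dist p (snd c x) < s})" for t :: "('a, 'e) chart \<times> 'e \<times> real"
  have op: "openin X (U t)" if "good t" for t
  proof -
    obtain c p s where t: "t = (c, p, s)" by (cases t)
    then have "openin X {x \<in> fst c. snd c x \<in> ball p s}" using that chart_preimage_open[of c "ball p s"] by (simp add: good_def)
    then show ?thesis by (simp add: t U_def)
  qed
  have cov: "\<exists>t. good t \<and> x \<in> U t" if x: "x \<in> topspace X" for x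
  proof -
    obtain c where c: "c \<in> A" "x \<in> fst c" using chart_cover[OF x] by blast
    then obtain e where e: "e > 0" "cball (snd c x) e \<subseteq> chart_image c"
      using open_contains_cball chart_image_open[OF c(1)] by blast
    then have "good (c, snd c x, e / 3)" "x \<in> U (c, snd c x, e / 3)" using c by (auto simp: good_def U_def)
    then show ?thesis by blast
  qed
  have Lind: "Lindelof_space X"
    using mfd by (simp add: smooth_manifold_def second_countable_imp_Lindelof_space)
  have "\<exists>\<V>. countable \<V> \<and> \<V> \<subseteq> U ` Collect good \<and> \<Union>\<V> = topspace X"
  proof (rule Lindelof_spaceD[OF Lind])
    show "openin X W" if "W \<in> U ` Collect good" for W using that op by auto
    have "U t \<subseteq> topspace X" if "good t" for t using openin_subset[OF op[OF that]] .
    then show "\<Union> (U ` Collect good) = topspace X" using cov by blast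
  qed
  then obtain \<V> where V: "countable \<V>" "\<V> \<subseteq> U ` Collect good" "\<Union>\<V> = topspace X"
    by (elim exE conjE) (rule that)
  then obtain C where C: "countable C" "C \<subseteq> Collect good" "\<V> = U ` C"
    using countable_subset_image by metis
  have "C \<noteq> {}"
  proof
    assume e: "C = {}"
    have "topspace X = {}" unfolding V(3)[symmetric] C(3) e by simp
    with assms show False ..
  qed
  define t where "t = from_nat_into C"
  have tr: "range t = C" unfolding t_def by (rule range_from_nat_into[OF \<open>C \<noteq> {}\<close> C(1)])
  have g: "good (t i)" for i using tr C(2) by blast
  have "topspace X = (\<Union>i. U (t i))"
  proof
    show "topspace X \<subseteq> (\<Union>i. U (t i))" unfolding V(3)[symmetric] C(3) tr[symmetric] by auto
    show "(\<Union>i. U (t i)) \<subseteq> topspace X" using openin_subset[OF op[OF g]] by blast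
  qed
  then show ?thesis
    using g by (intro that[of "\<lambda>i. fst (t i)" "\<lambda>i. snd (snd (t i))" "\<lambda>i. fst (snd (t i))"])
      (auto simp: good_def U_def case_prod_beta)
qed

end

section \<open>Coordinate balls in general position\<close>

locale ball_cover = manifold X A for X :: "'a topology" and A :: "('a, 'e::euclidean_space) chart set" +
  fixes c :: "nat \<Rightarrow> ('a, 'e) chart" and p :: "nat \<Rightarrow> 'e" and s :: "nat \<Rightarrow> real"
  assumes c_in: "\<And>i. c i \<in> A" and s_pos: "\<And>i. s i > 0"
    and cball_in: "\<And>i. cball (p i) (3 * s i) \<subseteq> chart_image (c i)"
    and cover: "topspace X = (\<Union>i. {x \<in> fst (c i). dist (p i) (snd (c i) x) < s i})"
begin

definition coord :: "nat \<Rightarrow> 'a \<Rightarrow> 'e" where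
  "coord i x = (snd (c i) x - p i) /\<^sub>R s i"

definition sq :: "nat \<Rightarrow> 'a \<Rightarrow> real" where
  "sq i x = coord i x \<bullet> coord i x"

definition inner_ball :: "nat \<Rightarrow> 'a set" where
  "inner_ball i = {x \<in> fst (c i). sq i x < 1}"

lemma norm_coord: "norm (coord i x) = dist (p i) (snd (c i) x) / s i"
  using s_pos[of i] by (simp add: coord_def dist_norm norm_minus_commute divide_inverse mult.commute)

lemma sq_less: "R \<ge> 0 \<Longrightarrow> sq i x < R\<^sup>2 \<longleftrightarrow> dist (p i) (snd (c i) x) < R * s i"
proof -
  assume R: "R \<ge> 0"
  have "sq i x < R\<^sup>2 \<longleftrightarrow> norm (coord i x) < R"
    unfolding sq_def power2_norm_eq_inner[symmetric] using R
    by (meson norm_ge_zero not_le power2_le_imp_le power_mono power_strict_mono zero_less_numeral)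
  then show ?thesis using s_pos[of i] by (simp add: norm_coord divide_less_eq)
qed

lemma inner_ball_eq: "inner_ball i = {x \<in> fst (c i). dist (p i) (snd (c i) x) < s i}"
  using sq_less[of 1 i] by (simp add: inner_ball_def)

lemma inner_ball_open: "openin X (inner_ball i)"
proof -
  have "openin X {x \<in> fst (c i). snd (c i) x \<in> ball (p i) (s i)}"
    by (rule chart_preimage_open[OF c_in]) simp
  then show ?thesis by (simp add: inner_ball_eq)
qed

lemma inner_ball_cover: "topspace X = (\<Union>i. inner_ball i)"
  using cover by (simp add: inner_ball_eq)

lemma dom_open: "openin X (fst (c i))"
  by (rule chart_dom_open[OF c_in])

lemma smooth_coord: "smooth_fun A (fst (c i)) (coord i)"
proof -
  have "smooth_fun A (fst (c i)) (\<lambda>x. snd (c i) x + - p i)"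
    by (rule smooth_fun_add[OF dom_open smooth_fun_chart[OF c_in] smooth_fun_const[OF dom_open]])
  from smooth_fun_linear[OF dom_open bounded_linear_scaleR_right this, of "inverse (s i)"]
  show ?thesis by (simp add: coord_def[abs_def])
qed

lemma smooth_sq: "smooth_fun A (fst (c i)) (sq i)"
  unfolding sq_def[abs_def] by (rule smooth_fun_bilinear[OF dom_open bounded_bilinear_inner smooth_coord smooth_coord])

text \<open>With more than \<open>m\<close> colours, the squared radii of the coordinate balls can be chosen so that no point
  lies on spheres of all colours. Take one sphere of each colour: the squared radii for which
  these spheres meet form the image of an \<open>m\<close>-dimensional set under a smooth map to a space of larger
  dimension, hence a countable union of compact sets of measure zero, and the theorem of Baire
  avoids all of them at once. This takes the place of covering dimension: it bounds, in terms
  of \<open>m\<close> only, the number of families of disjoint small open sets needed to cover a non-compact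
  manifold.\<close>

lemma generic_levels:
  assumes "DIM('e) < CARD('k::finite)"
  shows "\<exists>rad :: 'k \<Rightarrow> nat \<Rightarrow> real. (\<forall>k i. 1 < rad k i \<and> rad k i < 4) \<and>
    (\<forall>x\<in>topspace X. \<exists>k. \<forall>i. x \<in> fst (c i) \<longrightarrow> sq i x \<noteq> rad k i)"
proof -
  define \<psi> where "\<psi> t = 2 + arctan t / 2" for t :: real
  have psi: "1 < \<psi> t" "\<psi> t < 4" for t
    using arctan_bounded[of t] pi_less_4 unfolding \<psi>_def by linarith+
  have psi_inj: "\<psi> a = \<psi> b \<longleftrightarrow> a = b" for a b by (simp add: \<psi>_def arctan_eq_iff)
  have psi_cont: "continuous_on S (\<lambda>x. \<psi> (f x))" if "continuous_on S f" for S and f :: "'z::topological_space \<Rightarrow> real"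
    unfolding \<psi>_def using that by (intro continuous_intros) auto
  define k0 :: 'k where "k0 = undefined"
  define D where "D I = (\<Inter>k. fst (c (I k)))" for I :: "'k \<Rightarrow> nat"
  define U where "U I = snd (c (I k0)) ` (fst (c (I k0)) \<inter> D I)" for I :: "'k \<Rightarrow> nat"
  define G where "G I u = (\<chi> k. sq (I k) (chart_inv (c (I k0)) u))" for I :: "'k \<Rightarrow> nat" and u
  have Dop: "openin X (D I)" for I unfolding D_def by (rule openin_INT2) (auto simp: dom_open)
  have Uop: "open (U I)" for I unfolding U_def by (rule chart_open_image[OF c_in Dop])
  have Gd: "G I differentiable_on U I" for I
    unfolding differentiable_on_def
  proof
    fix u assume u: "u \<in> U I"
    have "(\<lambda>u. G I u \<bullet> b) differentiable at u" if b: "b \<in> Basis" for b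
    proof -
      obtain k where k: "b = axis k 1" using b by (auto simp: Basis_vec_def)
      have "smooth_on (snd (c (I k0)) ` (fst (c (I k0)) \<inter> fst (c (I k)))) (\<lambda>u. sq (I k) (chart_inv (c (I k0)) u))"
        using smooth_sq c_in by (simp add: smooth_fun_def)
      moreover have "u \<in> snd (c (I k0)) ` (fst (c (I k0)) \<inter> fst (c (I k)))" using u by (auto simp: U_def D_def)
      ultimately have "(\<lambda>u. sq (I k) (chart_inv (c (I k0)) u)) differentiable at u"
        by (rule smooth_on_imp_differentiable)
      then show ?thesis by (simp add: k G_def inner_axis)
    qed
    then have "G I differentiable at u" using differentiable_componentwise_within[of "G I" u UNIV] by simp
    then show "G I differentiable at u within U I" by (rule differentiable_at_withinI)
  qed
  have "\<forall>I. \<exists>C. (\<forall>n::nat. compact (C n) \<and> C n \<subseteq> U I) \<and> \<Union>(range C) = U I"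
  proof
    fix I show "\<exists>C. (\<forall>n::nat. compact (C n) \<and> C n \<subseteq> U I) \<and> \<Union>(range C) = U I"
      by (rule open_Union_compact_subsets[OF Uop[of I]]) blast
  qed
  from choice[OF this] obtain C where
    C': "\<forall>I. (\<forall>n::nat. compact (C I n) \<and> C I n \<subseteq> U I) \<and> \<Union>(range (C I)) = U I" ..
  have C: "compact (C I n)" "C I n \<subseteq> U I" "\<Union>(range (C I)) = U I" for I n
    using C'[rule_format, of I] by auto
  define E where "E I a = (\<chi> k. \<psi> (a (I k, k)))" for I and a :: "nat \<times> 'k \<Rightarrow> real"
  define Bad where "Bad = (\<lambda>(I, n). {a. E I a \<in> G I ` C I n})"
  have Econt: "continuous_on UNIV (E I)" for I
    unfolding E_def by (intro continuous_on_vec_lambda psi_cont) simp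
  have Gcomp: "compact (G I ` C I n)" for I n
    by (intro compact_continuous_image C differentiable_imp_continuous_on differentiable_on_subset[OF Gd C(2)])
  have Gneg: "negligible (G I ` C I n)" for I n
    by (rule negligible_differentiable_image_lowdim[OF _ differentiable_on_subset[OF Gd C(2)]]) (use assms in simp)
  have "euclidean interior_of \<Union> (range Bad) = {}"
  proof (rule Baire_category_alt)
    show "completely_metrizable_space (euclidean :: (nat \<times> 'k \<Rightarrow> real) topology) \<or>
       locally_compact_space (euclidean :: (nat \<times> 'k \<Rightarrow> real) topology) \<and> regular_space (euclidean :: (nat \<times> 'k \<Rightarrow> real) topology)"
      using completely_metrizable_space_euclidean by blast
    show "countable (range Bad)" by simp
    fix T assume "T \<in> range Bad"
    then obtain I n where T: "T = {a. E I a \<in> G I ` C I n}" by (auto simp: Bad_def)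
    have "closed T" unfolding T
      using continuous_closed_preimage[OF Econt closed_UNIV compact_imp_closed[OF Gcomp]] by (simp add: vimage_def)
    moreover have "interior T = {}"
    proof (rule ccontr)
      assume "interior T \<noteq> {}"
      then obtain a where a: "a \<in> interior T" by blast
      define j where "j v = (\<lambda>(i, k). if i = I k then v $ k else a (i, k))" for v :: "real^'k"
      have jc: "continuous_on UNIV j"
      proof (rule continuous_on_coordinatewise_then_product)
        fix q :: "nat \<times> 'k"
        show "continuous_on UNIV (\<lambda>v. j v q)"
          by (cases q; cases "fst q = I (snd q)") (auto simp: j_def intro!: continuous_intros)
      qed
      define V where "V = j -` interior T"
      have Vop: "open V" unfolding V_def using continuous_open_vimage[OF open_interior] jc
        by (simp add: open_vimage)
      have "j (\<chi> k. a (I k, k)) = a" by (auto simp: j_def fun_eq_iff)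
      then have Vne: "V \<noteq> {}" using a by (auto simp: V_def)
      define \<Psi> where "\<Psi> v = (\<chi> k. \<psi> (v $ k))" for v :: "real^'k"
        (* An open set of parameters would give an open, hence not negligible, set of squared radii. *)
      have "open (\<Psi> ` V)"
      proof (rule invariance_of_domain)
        show "continuous_on V \<Psi>" unfolding \<Psi>_def by (intro continuous_on_vec_lambda psi_cont continuous_intros)
        show "inj_on \<Psi> V" by (auto simp: inj_on_def \<Psi>_def vec_eq_iff psi_inj)
      qed (rule Vop)
      moreover have "\<Psi> ` V \<subseteq> G I ` C I n"
      proof
        fix z assume "z \<in> \<Psi> ` V"
        then obtain v where v: "v \<in> V" "z = \<Psi> v" by blast
        then have "j v \<in> T" using interior_subset by (auto simp: V_def)
        then have "E I (j v) \<in> G I ` C I n" by (simp add: T)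
        moreover have "E I (j v) = \<Psi> v" by (simp add: E_def \<Psi>_def j_def)
        ultimately show "z \<in> G I ` C I n" using v by simp
      qed
      ultimately show False
        using negligible_subset[OF Gneg[of I n]] open_not_negligible Vne by blast
    qed
    ultimately show "closedin euclidean T \<and> euclidean interior_of T = {}" by simp
  qed
  then have "interior (\<Union> (range Bad)) = {}" by simp
  then have "\<Union> (range Bad) \<noteq> UNIV" by (metis UNIV_not_empty interior_UNIV)
  then obtain a where a: "a \<notin> \<Union> (range Bad)" by blast
  show ?thesis
  proof (intro exI[of _ "\<lambda>k i. \<psi> (a (i, k))"] conjI allI ballI)
    fix x assume x: "x \<in> topspace X"
    show "\<exists>k. \<forall>i. x \<in> fst (c i) \<longrightarrow> sq i x \<noteq> \<psi> (a (i, k))"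
    proof (rule ccontr)
      assume "\<not> ?thesis"
      then have "\<forall>k. \<exists>i. x \<in> fst (c i) \<and> sq i x = \<psi> (a (i, k))" by blast
      then obtain I where I: "\<And>k. x \<in> fst (c (I k))" "\<And>k. sq (I k) x = \<psi> (a (I k, k))" by metis
      define u where "u = snd (c (I k0)) x"
      have "u \<in> U I" using I(1) by (auto simp: U_def D_def u_def)
      then obtain n where n: "u \<in> C I n" using C(3)[of I] by blast
      have "G I u = E I a"
        using I chart_inv_left[OF c_in I(1)] by (simp add: G_def E_def u_def)
      then have "E I a \<in> G I ` C I n" using imageI[OF n, of "G I"] by simp
      then have "a \<in> Bad (I, n)" by (simp add: Bad_def)
      then show False using a by blast
    qed
  qed (use psi in auto)
qed

end

section \<open>A proper embedding into a Euclidean space\<close>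

context ball_cover begin

definition ball_bump :: "nat \<Rightarrow> real \<Rightarrow> 'a \<Rightarrow> real" where
  "ball_bump i R x = (if x \<in> fst (c i) then smooth_step (R - sq i x) else 0)"

definition ball_gap :: "nat \<Rightarrow> real \<Rightarrow> 'a \<Rightarrow> real" where
  "ball_gap i R x = (if x \<in> fst (c i) then smooth_step (sq i x - R) else 1)"

text \<open>The closed ball of radius \<open>3\<close> is compact, hence closed, so that its complement is an open set on which
  the extension is constant.\<close>

lemma smooth_extension:
  assumes g: "smooth_fun A (fst (c i)) g" and k: "\<And>x. x \<in> fst (c i) \<Longrightarrow> sq i x \<ge> 9 \<Longrightarrow> g x = k"
  shows "smooth_fun A (topspace X) (\<lambda>x. if x \<in> fst (c i) then g x else k)"
proof (rule smooth_fun_local)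
  fix x assume x: "x \<in> topspace X"
  show "\<exists>W G. openin X W \<and> x \<in> W \<and> smooth_fun A W G \<and> (\<forall>y\<in>W. G y = (if y \<in> fst (c i) then g y else k))"
  proof (cases "x \<in> fst (c i)")
    case True
    then show ?thesis using g dom_open by (intro exI[of _ "fst (c i)"] exI[of _ g]) auto
  next
    case False
    define C where "C = {x \<in> fst (c i). snd (c i) x \<in> cball (p i) (3 * s i)}"
    have "compactin X C" unfolding C_def by (rule chart_compact_preimage[OF c_in compact_cball cball_in])
    then have "closedin X C" using Hausdorff compactin_imp_closedin by blast
    then have op: "openin X (topspace X - C)" by blast
    have "(if y \<in> fst (c i) then g y else k) = k" if "y \<in> topspace X - C" for y
    proof (cases "y \<in> fst (c i)")
      case True
      then have "\<not> dist (p i) (snd (c i) y) < 3 * s i" using that by (auto simp: C_def)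
      then have "\<not> sq i y < 3\<^sup>2" using sq_less[of 3 i y] by simp
      then show ?thesis using k[OF True] by simp
    qed simp
    then show ?thesis
      using op x False by (intro exI[of _ "topspace X - C"] exI[of _ "\<lambda>_. k"]) (auto simp: C_def smooth_fun_const)
  qed
qed simp

lemma smooth_step_sq:
  "smooth_fun A (fst (c i)) (\<lambda>x. smooth_step (R - sq i x))" "smooth_fun A (fst (c i)) (\<lambda>x. smooth_step (sq i x - R))"
proof -
  have 1: "smooth_on UNIV (\<lambda>t::real. smooth_step (R - t))"
    by (rule smooth_on_compose[OF open_UNIV open_UNIV _ _ smooth_step_smooth])
      (auto intro!: smooth_on_diff smooth_on_const smooth_on_id)
  have 2: "smooth_on UNIV (\<lambda>t::real. smooth_step (t - R))"
    by (rule smooth_on_compose[OF open_UNIV open_UNIV _ _ smooth_step_smooth])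
      (auto intro!: smooth_on_diff smooth_on_const smooth_on_id)
  show "smooth_fun A (fst (c i)) (\<lambda>x. smooth_step (R - sq i x))"
    by (rule smooth_fun_compose[OF dom_open smooth_sq open_UNIV _ 1]) simp
  show "smooth_fun A (fst (c i)) (\<lambda>x. smooth_step (sq i x - R))"
    by (rule smooth_fun_compose[OF dom_open smooth_sq open_UNIV _ 2]) simp
qed

lemma smooth_ball_bump: "R \<le> 4 \<Longrightarrow> smooth_fun A (topspace X) (ball_bump i R)"
  unfolding ball_bump_def[abs_def] by (rule smooth_extension[OF smooth_step_sq(1)]) (auto intro: smooth_step_0)

lemma smooth_ball_bump_coord: "R \<le> 4 \<Longrightarrow> smooth_fun A (topspace X) (\<lambda>x. ball_bump i R x *\<^sub>R coord i x)"
proof -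
  assume "R \<le> 4"
  then have "smooth_fun A (topspace X) (\<lambda>x. if x \<in> fst (c i) then smooth_step (R - sq i x) *\<^sub>R coord i x else 0)"
    by (intro smooth_extension smooth_fun_bilinear[OF dom_open bounded_bilinear_scaleR smooth_step_sq(1) smooth_coord])
      (auto intro: smooth_step_0)
  moreover have "(\<lambda>x. ball_bump i R x *\<^sub>R coord i x) = (\<lambda>x. if x \<in> fst (c i) then smooth_step (R - sq i x) *\<^sub>R coord i x else 0)"
    by (auto simp: ball_bump_def fun_eq_iff)
  ultimately show ?thesis by simp
qed

lemma smooth_ball_gap: "R \<le> 4 \<Longrightarrow> smooth_fun A (topspace X) (ball_gap i R)"
  unfolding ball_gap_def[abs_def] by (rule smooth_extension[OF smooth_step_sq(2)]) (auto intro: smooth_step_1)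

lemma ball_gap_zero: "x \<in> inner_ball i \<Longrightarrow> R \<ge> 1 \<Longrightarrow> ball_gap i R x = 0"
  by (auto simp: inner_ball_def ball_gap_def intro: smooth_step_0)

lemma prod_ball_gap_zero:
  "finite I \<Longrightarrow> j \<in> I \<Longrightarrow> x \<in> inner_ball j \<Longrightarrow> R j \<ge> 1 \<Longrightarrow> (\<Prod>i\<in>I. ball_gap i (R i) x) = 0"
  using ball_gap_zero[of x j "R j"] by (intro prod_zero) auto

text \<open>The sums below are locally finite for a simple reason: the \<open>i\<close>-th term carries a factor that
  vanishes on all the previous inner balls.\<close>

definition loc_fin :: "(nat \<Rightarrow> 'a \<Rightarrow> 'b::real_normed_vector) \<Rightarrow> bool" where
  "loc_fin F \<longleftrightarrow> (\<forall>i j x. x \<in> inner_ball j \<longrightarrow> j < i \<longrightarrow> F i x = 0)"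

definition loc_sum :: "(nat \<Rightarrow> 'a \<Rightarrow> 'b::real_normed_vector) \<Rightarrow> 'a \<Rightarrow> 'b" where
  "loc_sum F x = (\<Sum>i\<le>(LEAST j. x \<in> inner_ball j). F i x)"

lemma least_ball: "x \<in> topspace X \<Longrightarrow> x \<in> inner_ball (LEAST j. x \<in> inner_ball j)"
  using inner_ball_cover by (metis (mono_tags, lifting) LeastI UN_E)

lemma loc_sum_eq:
  assumes "loc_fin F" "x \<in> inner_ball j"
  shows "loc_sum F x = (\<Sum>i\<le>j. F i x)"
proof -
  let ?l = "LEAST j. x \<in> inner_ball j"
  have l: "?l \<le> j" "x \<in> inner_ball ?l" using assms(2) by (auto intro: Least_le LeastI)
  show ?thesis unfolding loc_sum_def
    by (rule sum.mono_neutral_left) (use l assms(1) in \<open>auto simp: loc_fin_def not_le\<close>)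
qed

lemma loc_sum_single:
  assumes "loc_fin F" "x \<in> topspace X" "\<And>j. j \<noteq> i \<Longrightarrow> F j x = 0"
  shows "loc_sum F x = F i x"
proof -
  let ?l = "LEAST j. x \<in> inner_ball j"
  have "loc_sum F x = (\<Sum>j\<le>?l. if j = i then F i x else 0)"
    unfolding loc_sum_def by (rule sum.cong) (use assms(3) in auto)
  also have "\<dots> = F i x"
    using least_ball[OF assms(2)] assms(1) by (auto simp: loc_fin_def)
  finally show ?thesis .
qed

lemma smooth_loc_sum:
  assumes "loc_fin F" "\<And>i. smooth_fun A (topspace X) (F i)"
  shows "smooth_fun A (topspace X) (loc_sum F)"
proof (rule smooth_fun_local)
  fix x assume "x \<in> topspace X"
  then obtain j where j: "x \<in> inner_ball j" using inner_ball_cover by blast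
  have sub: "inner_ball j \<subseteq> topspace X" using inner_ball_cover by blast
  have sm: "smooth_fun A (inner_ball j) (\<lambda>x. \<Sum>i\<le>j. F i x)"
    by (rule smooth_fun_sum[OF inner_ball_open smooth_fun_subset[OF assms(2) sub]])
  have "(\<Sum>i\<le>j. F i y) = loc_sum F y" if "y \<in> inner_ball j" for y
    using loc_sum_eq[OF assms(1) that] by simp
  then show "\<exists>W G. openin X W \<and> x \<in> W \<and> smooth_fun A W G \<and> (\<forall>y\<in>W. G y = loc_sum F y)"
    using sm j inner_ball_open by (intro exI[of _ "inner_ball j"] exI[of _ "\<lambda>x. \<Sum>i\<le>j. F i x"]) auto
qed simp

text \<open>In the \<open>k\<close>-th block of coordinates, only the first ball that contains the point is seen; the blocks
  record its number and the coordinates of the point in it. The last coordinate tends to infinity.\<close>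

lemma blockwise_embedding:
  assumes "DIM('e) < CARD('k::finite)"
  shows "\<exists>h :: 'a \<Rightarrow> ((real \<times> real \<times> 'e) ^ 'k) \<times> real. smooth_fun A (topspace X) h \<and> inj_on h (topspace X) \<and>
    (\<forall>d\<in>A. \<forall>u\<in>chart_image d. inj (frechet_derivative (\<lambda>u. h (chart_inv d u)) (at u))) \<and>
    (\<forall>R. compactin X {x \<in> topspace X. norm (h x) \<le> R})"
proof -
  obtain rad :: "'k \<Rightarrow> nat \<Rightarrow> real" where rad: "\<And>k i. 1 < rad k i" "\<And>k i. rad k i < 4"
    and gen: "\<And>x. x \<in> topspace X \<Longrightarrow> \<exists>k. \<forall>i. x \<in> fst (c i) \<longrightarrow> sq i x \<noteq> rad k i"
    using generic_levels[OF assms] by blast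
  have rad_le: "rad k i \<le> 4" "1 \<le> rad k i" for k i using rad[of k i] by linarith+
  define om where "om k i x = ball_bump i (rad k i) x * (\<Prod>j<i. ball_gap j (rad k j) x)" for k i x
  define ov where "ov k i x = om k i x *\<^sub>R coord i x" for k i x
  define te where "te i x = (\<Prod>j\<le>i. ball_gap j 1 x)" for i x
  have lf_om: "loc_fin (om k)" for k
    unfolding loc_fin_def om_def using prod_ball_gap_zero[of "{..<_}" _ _ "rad k"] rad_le(2) by simp
  have lf_n: "loc_fin (\<lambda>i x. real i * om k i x)" and lf_ov: "loc_fin (ov k)" for k
    using lf_om[of k] by (auto simp: loc_fin_def ov_def)
  have lf_te: "loc_fin te"
    unfolding loc_fin_def
  proof (intro allI impI)
    fix i j x assume "x \<in> inner_ball j" "j < i"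
    then show "te i x = 0" unfolding te_def using prod_ball_gap_zero[of "{..i}" j x "\<lambda>_. 1"] by simp
  qed
  have sm_prod: "smooth_fun A (topspace X) (\<lambda>x. \<Prod>j<i. ball_gap j (rad k j) x)" for i k
    by (rule smooth_fun_prod[OF openin_topspace smooth_ball_gap[OF rad_le(1)]])
  have sm_om: "smooth_fun A (topspace X) (om k i)" for k i
    unfolding om_def[abs_def]
    by (rule smooth_fun_bilinear[OF openin_topspace bounded_bilinear_mult smooth_ball_bump[OF rad_le(1)] sm_prod])
  have sm_ov: "smooth_fun A (topspace X) (ov k i)" for k i
  proof -
    have "smooth_fun A (topspace X) (\<lambda>x. (\<Prod>j<i. ball_gap j (rad k j) x) *\<^sub>R (ball_bump i (rad k i) x *\<^sub>R coord i x))"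
      by (rule smooth_fun_bilinear[OF openin_topspace bounded_bilinear_scaleR sm_prod smooth_ball_bump_coord[OF rad_le(1)]])
    then show ?thesis by (simp add: ov_def[abs_def] om_def mult.commute)
  qed
  have sm_te: "smooth_fun A (topspace X) (te i)" for i
    unfolding te_def[abs_def] by (rule smooth_fun_prod[OF openin_topspace smooth_ball_gap]) simp
  have sm_n: "smooth_fun A (topspace X) (\<lambda>x. real i * om k i x)" for i k
    by (rule smooth_fun_linear[OF openin_topspace bounded_linear_mult_right sm_om])
  define h where "h x = (\<chi> k. (loc_sum (om k) x, loc_sum (\<lambda>i x. real i * om k i x) x, loc_sum (ov k) x), loc_sum te x)" for x
  have sm_h: "smooth_fun A (topspace X) h"
    unfolding h_def[abs_def]
    by (intro smooth_fun_Pair[OF openin_topspace] smooth_fun_vec[OF openin_topspace]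
        smooth_loc_sum lf_om lf_n lf_ov lf_te sm_om sm_n sm_ov sm_te)
  (* The i-th set of colour k is the i-th ball of this colour without the earlier closed balls. *)
  have om_le: "om k i x = 0 \<or> om k j x = 0" if "i < j" for k i j x
  proof (cases "ball_bump i (rad k i) x = 0")
    case False
    then have "x \<in> fst (c i)" "sq i x < rad k i" by (auto simp: ball_bump_def smooth_step_0 not_le[symmetric] split: if_splits)
    then have "ball_gap i (rad k i) x = 0" by (simp add: ball_gap_def smooth_step_0)
    then show ?thesis using that by (auto simp: om_def)
  qed (simp add: om_def)
  have om_one: "om k j x = 0" if "om k i x \<noteq> 0" "j \<noteq> i" for k i j x
    using om_le[of i j k x] om_le[of j i k x] that by (meson linorder_neqE_nat)
  have h_at: "fst (h x) $ k = (om k i x, real i * om k i x, om k i x *\<^sub>R coord i x)"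
    if "x \<in> topspace X" "om k i x \<noteq> 0" for x k i
    using loc_sum_single[OF lf_om that(1), of i k] loc_sum_single[OF lf_n that(1), of i k]
      loc_sum_single[OF lf_ov that(1), of i k] om_one[OF that(2)]
    by (simp add: h_def ov_def)
  have om_ex: "\<exists>k i. om k i x > 0" if x: "x \<in> topspace X" for x
  proof -
    obtain k where k: "\<And>i. x \<in> fst (c i) \<Longrightarrow> sq i x \<noteq> rad k i" using gen[OF x] by blast
    define Q where "Q i \<longleftrightarrow> x \<in> fst (c i) \<and> sq i x < rad k i" for i
    obtain i0 where "x \<in> inner_ball i0" using x inner_ball_cover by blast
    then have "Q i0" using rad(1)[of k i0] by (auto simp: Q_def inner_ball_def)
    define i where "i = (LEAST i. Q i)"
    have i: "Q i" "\<And>j. j < i \<Longrightarrow> \<not> Q j" using LeastI[of Q, OF \<open>Q i0\<close>] not_less_Least by (auto simp: i_def)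
    have "ball_bump i (rad k i) x > 0" using i(1) by (simp add: Q_def ball_bump_def smooth_step_pos)
    moreover have "ball_gap j (rad k j) x > 0" if "j < i" for j
      using i(2)[OF that] k[of j] by (auto simp: Q_def ball_gap_def intro!: smooth_step_pos)
    ultimately have "om k i x > 0" unfolding om_def by (intro mult_pos_pos prod_pos) auto
    then show ?thesis by blast
  qed
  have om_dom: "x \<in> fst (c i)" if "om k i x \<noteq> 0" for x k i
    using that by (auto simp: om_def ball_bump_def split: if_splits)
  have coord_inj: "x = y" if "x \<in> fst (c i)" "y \<in> fst (c i)" "coord i x = coord i y" for x y i
  proof -
    have "snd (c i) x = snd (c i) y" using that(3) s_pos[of i] by (simp add: coord_def)
    then show ?thesis using chart_inj[OF c_in] that(1,2) by (meson inj_onD)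
  qed
  have inj: "inj_on h (topspace X)"
  proof (rule inj_onI)
    fix x y assume x: "x \<in> topspace X" and y: "y \<in> topspace X" and eq: "h x = h y"
    obtain k i where ki: "om k i x > 0" using om_ex[OF x] by blast
    then have hx: "fst (h x) $ k = (om k i x, real i * om k i x, om k i x *\<^sub>R coord i x)" using h_at[OF x] by simp
    have "\<exists>i'. om k i' y \<noteq> 0"
    proof (rule ccontr)
      assume "\<not> ?thesis"
      then have "loc_sum (om k) y = 0" by (simp add: loc_sum_def)
      then have "fst (fst (h y) $ k) = 0" by (simp add: h_def)
      then show False using hx ki eq by simp
    qed
    then obtain i' where i': "om k i' y \<noteq> 0" by blast
    have hy: "fst (h y) $ k = (om k i' y, real i' * om k i' y, om k i' y *\<^sub>R coord i' y)" by (rule h_at[OF y i'])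
    have e: "om k i x = om k i' y" "real i * om k i x = real i' * om k i' y" "om k i x *\<^sub>R coord i x = om k i' y *\<^sub>R coord i' y"
      using hx hy eq by auto
    then have "i = i'" using ki by simp
    moreover have "coord i x = coord i y" using e ki \<open>i = i'\<close> by simp
    ultimately show "x = y" using coord_inj[of x i y] om_dom[of k i x] om_dom[OF i'] ki by simp
  qed
  have imm: "inj (frechet_derivative (\<lambda>u. h (chart_inv d u)) (at u))" if d: "d \<in> A" and u: "u \<in> chart_image d" for d u
  proof -
    define x where "x = chart_inv d u"
    have xd: "x \<in> fst d" "snd d x = u" using chart_inv_in[OF u] chart_inv_right[OF u] by (simp_all add: x_def)
    then have x: "x \<in> topspace X" using chart_dom_subset[OF d] by blast
    obtain k i where ki: "om k i x > 0" using om_ex[OF x] by blast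
    define V where "V = {x \<in> topspace X. om k i x \<in> {0<..}}"
    have "continuous_map X euclidean (om k i)" by (rule smooth_fun_continuous[OF sm_om])
    then have Vop: "openin X V" unfolding V_def by (rule openin_continuous_map_preimage) simp
    have xV: "x \<in> V" using x ki by (simp add: V_def)
    have Vdom: "V \<subseteq> fst (c i)" using om_dom[of k i] by (force simp: V_def)
    define W where "W = snd d ` (fst d \<inter> V)"
    have Wop: "open W" unfolding W_def by (rule chart_open_image[OF d Vop])
    have uW: "u \<in> W" unfolding W_def using xd xV by blast
    define H where "H u = h (chart_inv d u)" for u
    define a where "a u = fst (fst (H u) $ k)" for u
    define b where "b u = snd (snd (fst (H u) $ k))" for u
    define e where "e u = coord i (chart_inv d u)" for u
    have inv_V: "chart_inv d v \<in> V" if "v \<in> W" for v using that chart_inv_left[OF d] by (auto simp: W_def)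
    have ab: "a v \<noteq> 0" "b v = a v *\<^sub>R e v" if "v \<in> W" for v
      using inv_V[OF that] h_at[of "chart_inv d v" k i] by (auto simp: V_def a_def b_def e_def H_def)
    have smH: "smooth_on (chart_image d) H"
      unfolding H_def[abs_def] by (rule smooth_fun_chart_rep[OF sm_h d])
    have dH: "(H has_derivative frechet_derivative H (at u)) (at u)" by (rule smooth_on_has_derivative[OF smH u])
    have La: "bounded_linear (\<lambda>z :: ((real \<times> real \<times> 'e) ^ 'k) \<times> real. fst (fst z $ k))"
      by (intro bounded_linear_compose[OF bounded_linear_fst] bounded_linear_compose[OF bounded_linear_vec_nth] bounded_linear_fst)
    have Lb: "bounded_linear (\<lambda>z :: ((real \<times> real \<times> 'e) ^ 'k) \<times> real. snd (snd (fst z $ k)))"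
      by (intro bounded_linear_compose[OF bounded_linear_snd] bounded_linear_compose[OF bounded_linear_vec_nth] bounded_linear_fst)
    define \<tau> where "\<tau> u = snd (c i) (chart_inv d u)" for u
    have xi: "x \<in> fst (c i)" using xV Vdom by blast
    note cc = chart_change[OF d c_in xd(1) xi, folded \<tau>_def]
    have u\<tau>: "u \<in> snd d ` (fst d \<inter> fst (c i))" using xd xi by blast
    have d\<tau>: "(\<tau> has_derivative frechet_derivative \<tau> (at u)) (at u)"
      using smooth_on_has_derivative[of _ \<tau>, OF _ u\<tau>] cc(1) by (simp add: \<tau>_def[abs_def])
    have de: "(e has_derivative (\<lambda>v. frechet_derivative \<tau> (at u) v /\<^sub>R s i)) (at u)"
    proof -
      have "((\<lambda>u. (\<tau> u - p i) /\<^sub>R s i) has_derivative (\<lambda>v. (frechet_derivative \<tau> (at u) v - 0) /\<^sub>R s i)) (at u)"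
        by (intro has_derivative_scaleR_right has_derivative_diff d\<tau> has_derivative_const)
      then show ?thesis by (simp add: e_def[abs_def] coord_def \<tau>_def)
    qed
    have da: "(a has_derivative (\<lambda>v. fst (fst (frechet_derivative H (at u) v) $ k))) (at u)"
      unfolding a_def[abs_def] by (rule bounded_linear.has_derivative[OF La dH])
    have db: "(b has_derivative (\<lambda>v. snd (snd (fst (frechet_derivative H (at u) v) $ k)))) (at u)"
      unfolding b_def[abs_def] by (rule bounded_linear.has_derivative[OF Lb dH])
    (* Where om k i is positive, the last entry of the block is its product with the coordinates. *)
    have db': "(b has_derivative (\<lambda>v. a u *\<^sub>R (frechet_derivative \<tau> (at u) v /\<^sub>R s i) + fst (fst (frechet_derivative H (at u) v) $ k) *\<^sub>R e u)) (at u)"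
      by (rule has_derivative_transform_within_open[OF has_derivative_scaleR[OF da de] Wop uW]) (use ab(2) in simp)
    have "v = 0" if "frechet_derivative H (at u) v = 0" for v
    proof -
      have "snd (snd (fst (frechet_derivative H (at u) v) $ k)) = a u *\<^sub>R (frechet_derivative \<tau> (at u) v /\<^sub>R s i) + fst (fst (frechet_derivative H (at u) v) $ k) *\<^sub>R e u"
        using has_derivative_unique[OF db db'] by (rule fun_cong)
      then have "frechet_derivative \<tau> (at u) v = 0" using that ab(1)[OF uW] s_pos[of i] by simp
      moreover have "linear (frechet_derivative \<tau> (at u))" using d\<tau> has_derivative_linear by blast
      moreover have "inj (frechet_derivative \<tau> (at u))" using cc(3) xd(2) by (simp add: \<tau>_def[abs_def])
      ultimately show "v = 0" using linear_injective_0 by blast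
    qed
    moreover have "linear (frechet_derivative H (at u))" using dH has_derivative_linear by blast
    ultimately show ?thesis unfolding H_def[abs_def] using linear_injective_0 by blast
  qed
  have proper: "compactin X {x \<in> topspace X. norm (h x) \<le> R}" for R
  proof -
    obtain M :: nat where M: "R < real M" using reals_Archimedean2 by blast
    define C where "C i = {x \<in> fst (c i). snd (c i) x \<in> cball (p i) (3 * s i)}" for i
    have "compactin X (C i)" for i unfolding C_def by (rule chart_compact_preimage[OF c_in compact_cball cball_in])
    then have comp: "compactin X (\<Union>i<M. C i)" by (intro compactin_Union) auto
    have "x \<in> (\<Union>i<M. C i)" if x: "x \<in> topspace X" and n: "norm (h x) \<le> R" for x
    proof (rule ccontr)
      assume nx: "x \<notin> (\<Union>i<M. C i)"
      have out: "ball_gap j 1 x = 1" if "j < M" for j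
      proof (cases "x \<in> fst (c j)")
        case True
        then have "\<not> dist (p j) (snd (c j) x) < 3 * s j" using nx that by (auto simp: C_def)
        then have "\<not> sq j x < 3\<^sup>2" using sq_less[of 3 j x] by simp
        then show ?thesis by (simp add: ball_gap_def smooth_step_1)
      qed (simp add: ball_gap_def)
      define l where "l = (LEAST j. x \<in> inner_ball j)"
      have l: "x \<in> inner_ball l" unfolding l_def by (rule least_ball[OF x])
      have "M \<le> l"
      proof (rule ccontr)
        assume "\<not> M \<le> l"
        then show False using out[of l] ball_gap_zero[OF l, of 1] by simp
      qed
      have "real M = (\<Sum>i<M. te i x)" using out by (simp add: te_def)
      also have "\<dots> \<le> (\<Sum>i\<le>l. te i x)"
        by (rule sum_mono2) (use \<open>M \<le> l\<close> in \<open>auto simp: te_def ball_gap_def smooth_step_range intro!: prod_nonneg\<close>)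
      also have "\<dots> = snd (h x)" by (simp add: h_def loc_sum_def l_def)
      also have "\<dots> \<le> norm (h x)"
        using norm_snd_le[of "snd (h x)" "fst (h x)"] by simp
      finally show False using n M by simp
    qed
    then have "{x \<in> topspace X. norm (h x) \<le> R} \<subseteq> (\<Union>i<M. C i)" by blast
    moreover have "closedin X {x \<in> topspace X. h x \<in> cball 0 R}"
      by (rule closedin_continuous_map_preimage[OF smooth_fun_continuous[OF sm_h]]) simp
    ultimately show ?thesis using closed_compactin[OF comp] by simp
  qed
  show ?thesis using sm_h inj imm proper by blast
qed

end

section \<open>The geometry of a proper embedding\<close>

text \<open>The adjoint of an isometric embedding with image \<open>S\<close>.\<close>

lemma contraction_isometric_on_subspace:
  fixes S :: "'f::euclidean_space set"
  assumes "subspace S" "dim S = DIM('e::euclidean_space)"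
  shows "\<exists>T :: 'f \<Rightarrow> 'e. linear T \<and> (\<forall>v. norm (T v) \<le> norm v) \<and> (\<forall>\<xi>\<in>S. norm (T \<xi>) = norm \<xi>)"
proof -
  obtain f :: "'e \<Rightarrow> 'f" and g where f: "linear f" "f ` UNIV = S" "\<And>x. norm (f x) = norm x"
    using isometries_subspaces[OF subspace_UNIV assms(1)] assms(2) by (metis UNIV_I dim_UNIV)
  define T where "T = adjoint f"
  have ad: "T v \<bullet> w = v \<bullet> f w" for v w unfolding T_def using adjoint_clauses(2)[OF f(1)] by (simp add: inner_commute)
  have con: "norm (T v) \<le> norm v" for v
  proof -
    have "norm (T v) * norm (T v) = v \<bullet> f (T v)" using ad[of v "T v"] by (simp add: power2_norm_eq_inner flip: power2_eq_square)
    also have "\<dots> \<le> norm v * norm (T v)" using norm_cauchy_schwarz[of v "f (T v)"] f(3) by simp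
    finally show ?thesis by (cases "norm (T v) = 0") (auto simp: mult_le_cancel_right)
  qed
  moreover have "norm (T \<xi>) = norm \<xi>" if "\<xi> \<in> S" for \<xi>
  proof -
    obtain w where w: "\<xi> = f w" using f(2) \<open>\<xi> \<in> S\<close> by blast
    have "norm \<xi> * norm \<xi> = T \<xi> \<bullet> w" using ad[of \<xi> w] w by (simp add: power2_norm_eq_inner flip: power2_eq_square)
    also have "\<dots> \<le> norm (T \<xi>) * norm \<xi>" using norm_cauchy_schwarz[of "T \<xi>" w] w f(3) by simp
    finally have "norm \<xi> \<le> norm (T \<xi>)" by (cases "norm \<xi> = 0") (auto simp: mult_le_cancel_right)
    then show ?thesis using con[of \<xi>] by simp
  qed
  moreover have "linear T" unfolding T_def by (rule adjoint_linear[OF f(1)])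
  ultimately show ?thesis by blast
qed

locale proper_embedding = manifold X A for X :: "'a topology" and A :: "('a, 'e::euclidean_space) chart set" +
  fixes h :: "'a \<Rightarrow> 'f::euclidean_space"
  assumes smooth_h: "smooth_fun A (topspace X) h" and inj_h: "inj_on h (topspace X)"
    and imm_h: "\<And>d u. d \<in> A \<Longrightarrow> u \<in> chart_image d \<Longrightarrow> inj (frechet_derivative (\<lambda>u. h (chart_inv d u)) (at u))"
    and proper_h: "\<And>R. compactin X {x \<in> topspace X. norm (h x) \<le> R}"
begin

definition H :: "('a, 'e) chart \<Rightarrow> 'e \<Rightarrow> 'f" where "H d u = h (chart_inv d u)"

definition DH :: "('a, 'e) chart \<Rightarrow> 'e \<Rightarrow> 'e \<Rightarrow> 'f" where "DH d u v = frechet_derivative (H d) (at u) v"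

definition DDH :: "('a, 'e) chart \<Rightarrow> 'e \<Rightarrow> 'e \<Rightarrow> 'e \<Rightarrow> 'f" where
  "DDH d u v w = frechet_derivative (\<lambda>p. DH d p v) (at u) w"

lemma smooth_H: "d \<in> A \<Longrightarrow> smooth_on (chart_image d) (H d)"
  unfolding H_def[abs_def] by (rule smooth_fun_chart_rep[OF smooth_h])

lemma linear_DH: "d \<in> A \<Longrightarrow> u \<in> chart_image d \<Longrightarrow> linear (DH d u)"
  unfolding DH_def[abs_def] using smooth_on_imp_differentiable[OF smooth_H] by (intro linear_frechet_derivative)

lemma inj_DH: "d \<in> A \<Longrightarrow> u \<in> chart_image d \<Longrightarrow> inj (DH d u)"
  using imm_h by (simp add: DH_def[abs_def] H_def[abs_def])

lemma jet_H:
  assumes "d \<in> A" "\<gamma> 0 \<in> chart_image d" "jet2 \<gamma> p q"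
  shows "jet2 (\<lambda>s. H d (\<gamma> s)) (DH d (\<gamma> 0) p) (DDH d (\<gamma> 0) p p + DH d (\<gamma> 0) q)"
  using jet2_smooth_compose[OF smooth_H[OF assms(1)] chart_image_open[OF assms(1)] assms(2,3)]
  by (simp add: DH_def[abs_def] DDH_def[abs_def])

text \<open>In another chart, the second derivative of the embedding changes by a tangential term; a parabola
  whose acceleration compensates the second derivative of the change of charts shows this.\<close>

lemma chart_change_jet:
  assumes d: "d \<in> A" "d' \<in> A" and x: "x \<in> fst d" "x \<in> fst d'"
  shows "\<exists>v' w. DH d (snd d x) v = DH d' (snd d' x) v' \<and>
     DDH d (snd d x) v v + DH d (snd d x) w = DDH d' (snd d' x) v' v'"
proof -
  define \<tau> where "\<tau> u = snd d' (chart_inv d u)" for u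
  define U where "U = snd d ` (fst d \<inter> fst d')"
  define u where "u = snd d x"
  note cc = chart_change[OF d x]
  have sm: "smooth_on U \<tau>" and U: "open U" and inj: "inj (frechet_derivative \<tau> (at u))"
    using cc by (simp_all add: \<tau>_def[abs_def] U_def u_def)
  have uU: "u \<in> U" and ud: "u \<in> chart_image d" and \<tau>u: "\<tau> u = snd d' x" "\<tau> u \<in> chart_image d'"
    using x chart_inv_left[OF d(1)] by (auto simp: U_def u_def \<tau>_def)
  have lin: "linear (frechet_derivative \<tau> (at u))"
    using smooth_on_imp_differentiable[OF sm uU] by (rule linear_frechet_derivative)
  then have "surj (frechet_derivative \<tau> (at u))" using inj linear_injective_imp_surjective by blast
  then obtain w where w: "frechet_derivative \<tau> (at u) w = - frechet_derivative (\<lambda>p. frechet_derivative \<tau> (at p) v) (at u) v"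
    by (metis surjD)
  define \<gamma> where "\<gamma> s = u + s *\<^sub>R v + (s\<^sup>2 / 2) *\<^sub>R w" for s :: real
  have \<gamma>0: "\<gamma> 0 = u" by (simp add: \<gamma>_def)
  have j\<gamma>: "jet2 \<gamma> v w" unfolding \<gamma>_def[abs_def] by (rule jet2_parabola)
  define v' where "v' = frechet_derivative \<tau> (at u) v"
  have j\<tau>: "jet2 (\<lambda>s. \<tau> (\<gamma> s)) v' 0"
    using jet2_smooth_compose[OF sm U _ j\<gamma>] uU by (simp add: \<gamma>0 w v'_def)
  have 1: "jet2 (\<lambda>s. H d (\<gamma> s)) (DH d u v) (DDH d u v v + DH d u w)"
    using jet_H[OF d(1) _ j\<gamma>] ud by (simp add: \<gamma>0)
  have 2: "jet2 (\<lambda>s. H d' (\<tau> (\<gamma> s))) (DH d' (\<tau> u) v') (DDH d' (\<tau> u) v' v' + DH d' (\<tau> u) 0)"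
    using jet_H[OF d(2) _ j\<tau>] \<tau>u(2) by (simp add: \<gamma>0)
  have "\<forall>\<^sub>F s in nhds 0. \<gamma> s \<in> U"
    by (rule eventually_nhds_isCont[OF jet2_isCont[OF j\<gamma>]]) (use U uU \<gamma>0 eventually_nhds_in_open in auto)
  then have "\<forall>\<^sub>F s in nhds 0. H d' (\<tau> (\<gamma> s)) = H d (\<gamma> s)"
    by eventually_elim (auto simp: U_def \<tau>_def H_def chart_inv_left[OF d(1)] chart_inv_left[OF d(2)])
  from jet2_unique[OF 1 jet2_cong[OF 2 this]]
  show ?thesis using linear_0[OF linear_DH[OF d(2) \<tau>u(2)]] \<tau>u(1) by (auto simp: u_def)
qed

definition tangent :: "'f \<Rightarrow> 'f set" where
  "tangent y = {\<xi>. \<exists>d u v. d \<in> A \<and> u \<in> chart_image d \<and> H d u = y \<and> \<xi> = DH d u v}"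

lemma tangent_eq:
  assumes d: "d \<in> A" and x: "x \<in> fst d"
  shows "tangent (h x) = range (DH d (snd d x))"
proof
  have "snd d x \<in> chart_image d" "H d (snd d x) = h x" using x chart_inv_left[OF d x] by (auto simp: H_def)
  then show "range (DH d (snd d x)) \<subseteq> tangent (h x)" unfolding tangent_def using d by blast
  show "tangent (h x) \<subseteq> range (DH d (snd d x))"
  proof
    fix \<xi> assume "\<xi> \<in> tangent (h x)"
    then obtain d' u v where d': "d' \<in> A" "u \<in> chart_image d'" "H d' u = h x" "\<xi> = DH d' u v"
      unfolding tangent_def by blast
    have "chart_inv d' u \<in> fst d'" "snd d' (chart_inv d' u) = u"
      using chart_inv_in[OF d'(2)] chart_inv_right[OF d'(2)] by auto
    moreover have "chart_inv d' u = x"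
      using d'(3) inj_h chart_dom_subset[OF d] chart_dom_subset[OF d'(1)] x \<open>chart_inv d' u \<in> fst d'\<close>
      by (auto simp: H_def inj_on_def)
    ultimately have "x \<in> fst d'" "snd d' x = u" by auto
    then show "\<xi> \<in> range (DH d (snd d x))"
      using chart_change_jet[OF d'(1) d _ x, of v] d'(4) by auto
  qed
qed

lemma tangent_subspace:
  assumes "x \<in> topspace X"
  shows "subspace (tangent (h x))" "dim (tangent (h x)) = DIM('e)"
proof -
  obtain d where d: "d \<in> A" "x \<in> fst d" using chart_cover[OF assms] by blast
  have u: "snd d x \<in> chart_image d" using d by blast
  note l = linear_DH[OF d(1) u] inj_DH[OF d(1) u]
  show "subspace (tangent (h x))"
    unfolding tangent_eq[OF d] by (rule linear_subspace_image[OF l(1) subspace_UNIV])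
  show "dim (tangent (h x)) = DIM('e)"
    unfolding tangent_eq[OF d] using dim_image_eq[OF l(1), of UNIV] l(2) by simp
qed

text \<open>A proper continuous injection is a homeomorphism onto its image.\<close>

lemma h_open_onto_image:
  assumes "openin X W" "x \<in> W"
  shows "\<exists>O'. open O' \<and> h x \<in> O' \<and> (\<forall>y\<in>topspace X. h y \<in> O' \<longrightarrow> y \<in> W)"
proof -
  have xX: "x \<in> topspace X" using assms openin_subset by blast
  define C where "C = {y \<in> topspace X. norm (h y) \<le> norm (h x) + 1}"
  have "closedin X (topspace X - W)" using assms(1) by blast
  then have "compactin X ((topspace X - W) \<inter> C)"
    using compact_Int_closedin[OF proper_h] closed_Int_compactin[OF _ proper_h] unfolding C_def by blast
  then have "compactin euclidean (h ` ((topspace X - W) \<inter> C))"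
    by (rule image_compactin[OF _ smooth_fun_continuous[OF smooth_h]])
  then have cl: "closed (h ` ((topspace X - W) \<inter> C))" by (simp add: compact_imp_closed)
  show ?thesis
  proof (intro exI conjI ballI impI)
    show "open (ball (h x) 1 - h ` ((topspace X - W) \<inter> C))" by (intro open_Diff open_ball cl)
    have "h x \<notin> h ` ((topspace X - W) \<inter> C)"
      using inj_h xX assms(2) by (auto simp: inj_on_def)
    then show "h x \<in> ball (h x) 1 - h ` ((topspace X - W) \<inter> C)" by simp
    fix y assume y: "y \<in> topspace X" "h y \<in> ball (h x) 1 - h ` ((topspace X - W) \<inter> C)"
    then have "dist (h x) (h y) < 1" by simp
    then have "norm (h y) \<le> norm (h x) + 1"
      using norm_triangle_ineq2[of "h y" "h x"] by (simp add: dist_norm norm_minus_commute)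
    then show "y \<in> W" using y by (auto simp: C_def)
  qed
qed

lemma image_compact: "compact {y \<in> h ` topspace X. norm y \<le> R}"
proof -
  have "compactin euclidean (h ` {x \<in> topspace X. norm (h x) \<le> R})"
    by (rule image_compactin[OF proper_h smooth_fun_continuous[OF smooth_h]])
  moreover have "h ` {x \<in> topspace X. norm (h x) \<le> R} = {y \<in> h ` topspace X. norm y \<le> R}" by auto
  ultimately show ?thesis by simp
qed

lemma local_bounds:
  assumes d: "d \<in> A" and u0: "u0 \<in> chart_image d"
  obtains \<mu> where "\<mu> > 0" "\<And>\<kappa>. \<kappa> > 0 \<Longrightarrow> \<exists>O'. open O' \<and> u0 \<in> O' \<and> O' \<subseteq> chart_image d \<and>
      (\<forall>u\<in>O'. \<forall>v. norm (DH d u v - DH d u0 v) \<le> \<kappa> * norm v)" "\<And>v. norm (DH d u0 v) \<ge> \<mu> * norm v"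
proof -
  obtain \<mu> where \<mu>: "\<mu> > 0" "\<And>v. norm (DH d u0 v) \<ge> \<mu> * norm v"
    using linear_inj_bounded_below_pos[OF linear_DH[OF d u0] inj_DH[OF d u0]] by metis
  moreover have "\<exists>O'. open O' \<and> u0 \<in> O' \<and> O' \<subseteq> chart_image d \<and>
      (\<forall>u\<in>O'. \<forall>v. norm (DH d u v - DH d u0 v) \<le> \<kappa> * norm v)" if "\<kappa> > 0" for \<kappa>
  proof -
    define \<eta> where "\<eta> = \<kappa> / real DIM('e)"
    have \<eta>: "\<eta> > 0" using that by (simp add: \<eta>_def)
    have "\<forall>\<^sub>F u in nhds u0. dist (DH d u b) (DH d u0 b) < \<eta>" for b
    proof -
      have "continuous_on (chart_image d) (\<lambda>u. DH d u b)"
        unfolding DH_def by (rule smooth_on_imp_continuous_on[OF smooth_on_derivative[OF smooth_H[OF d]]])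
      then have "isCont (\<lambda>u. DH d u b) u0"
        using chart_image_open[OF d] u0 continuous_on_eq_continuous_at by blast
      from eventually_nhds_isCont[OF this, of "\<lambda>z. dist z (DH d u0 b) < \<eta>"]
      show ?thesis using eventually_nhds_in_open[of "ball (DH d u0 b) \<eta>" "DH d u0 b"] \<eta> by (simp add: dist_commute)
    qed
    then have "\<forall>\<^sub>F u in nhds u0. \<forall>b\<in>Basis. dist (DH d u b) (DH d u0 b) < \<eta>"
      by (simp add: eventually_ball_finite_distrib)
    moreover have "\<forall>\<^sub>F u in nhds u0. u \<in> chart_image d"
      by (rule eventually_nhds_in_open[OF chart_image_open[OF d] u0])
    ultimately have "\<forall>\<^sub>F u in nhds u0. (\<forall>b\<in>Basis. dist (DH d u b) (DH d u0 b) < \<eta>) \<and> u \<in> chart_image d"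
      by (rule eventually_conj)
    then obtain O' where O': "open O'" "u0 \<in> O'" "\<And>u. u \<in> O' \<Longrightarrow> (\<forall>b\<in>Basis. dist (DH d u b) (DH d u0 b) < \<eta>) \<and> u \<in> chart_image d"
      unfolding eventually_nhds by blast
    have "norm (DH d u v - DH d u0 v) \<le> \<kappa> * norm v" if u: "u \<in> O'" for u v
    proof -
      have ud: "u \<in> chart_image d" using O'(3)[OF u] by blast
      have L: "linear (\<lambda>v. DH d u v - DH d u0 v)"
        by (intro linear_compose_sub linear_DH d ud u0)
      have "DH d u v - DH d u0 v = (\<lambda>v. DH d u v - DH d u0 v) (\<Sum>b\<in>Basis. (v \<bullet> b) *\<^sub>R b)"
        by (simp only: euclidean_representation)
      also have "\<dots> = (\<Sum>b\<in>Basis. (v \<bullet> b) *\<^sub>R (DH d u b - DH d u0 b))"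
        unfolding linear_sum[OF L] linear_scale[OF L] ..
      finally have "norm (DH d u v - DH d u0 v) \<le> (\<Sum>b\<in>Basis. norm ((v \<bullet> b) *\<^sub>R (DH d u b - DH d u0 b)))"
        by (simp only: norm_sum)
      also have "\<dots> \<le> (\<Sum>b\<in>(Basis::'e set). norm v * \<eta>)"
      proof (rule sum_mono)
        fix b :: 'e assume b: "b \<in> Basis"
        have "norm (DH d u b - DH d u0 b) \<le> \<eta>" using O'(3)[OF u] b by (auto simp: dist_norm intro: less_imp_le)
        then show "norm ((v \<bullet> b) *\<^sub>R (DH d u b - DH d u0 b)) \<le> norm v * \<eta>"
          using Basis_le_norm[OF b, of v] by (simp add: mult_mono)
      qed
      also have "\<dots> = \<kappa> * norm v" by (simp add: \<eta>_def)
      finally show ?thesis .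
    qed
    then show ?thesis using O' by blast
  qed
  ultimately show ?thesis by (intro that)
qed

end

context proper_embedding begin

lemma tangent_contraction_exists:
  "\<exists>T :: 'f \<Rightarrow> 'f \<Rightarrow> 'e. (\<forall>y. linear (T y)) \<and> (\<forall>y v. norm (T y v) \<le> norm v) \<and>
     (\<forall>x\<in>topspace X. \<forall>\<xi>\<in>tangent (h x). norm (T (h x) \<xi>) = norm \<xi>)"
proof -
  have "\<forall>y. \<exists>T :: 'f \<Rightarrow> 'e. linear T \<and> (\<forall>v. norm (T v) \<le> norm v) \<and>
      (y \<in> h ` topspace X \<longrightarrow> (\<forall>\<xi>\<in>tangent y. norm (T \<xi>) = norm \<xi>))"
  proof
    fix y
    show "\<exists>T :: 'f \<Rightarrow> 'e. linear T \<and> (\<forall>v. norm (T v) \<le> norm v) \<and>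
      (y \<in> h ` topspace X \<longrightarrow> (\<forall>\<xi>\<in>tangent y. norm (T \<xi>) = norm \<xi>))"
    proof (cases "y \<in> h ` topspace X")
      case True
      then have "subspace (tangent y)" "dim (tangent y) = DIM('e)" using tangent_subspace by auto
      from contraction_isometric_on_subspace[OF this] show ?thesis by blast
    next
      case False
      then show ?thesis by (intro exI[of _ "\<lambda>_. 0"]) (simp add: linear_zero)
    qed
  qed
  from choice[OF this] obtain T :: "'f \<Rightarrow> 'f \<Rightarrow> 'e" where "\<forall>y. linear (T y) \<and> (\<forall>v. norm (T y v) \<le> norm v) \<and>
      (y \<in> h ` topspace X \<longrightarrow> (\<forall>\<xi>\<in>tangent y. norm (T y \<xi>) = norm \<xi>))" ..
  then show ?thesis by (intro exI[of _ T]) blast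
qed

lemma nearby_tangents_local:
  fixes T :: "'f \<Rightarrow> 'f \<Rightarrow> 'e"
  assumes lin: "\<And>y. linear (T y)" and con: "\<And>y v. norm (T y v) \<le> norm v"
    and iso: "\<And>x \<xi>. x \<in> topspace X \<Longrightarrow> \<xi> \<in> tangent (h x) \<Longrightarrow> norm (T (h x) \<xi>) = norm \<xi>"
    and x0: "x0 \<in> topspace X" and \<epsilon>: "\<epsilon> > 0"
  shows "\<exists>W. openin X W \<and> x0 \<in> W \<and> (\<forall>x1\<in>W. \<forall>x2\<in>W. \<forall>\<xi>\<in>tangent (h x1). norm (T (h x2) \<xi>) \<ge> (1 - \<epsilon>) * norm \<xi>)"
proof -
  obtain d where d: "d \<in> A" "x0 \<in> fst d" using chart_cover[OF x0] by blast
  define u0 where "u0 = snd d x0"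
  have u0: "u0 \<in> chart_image d" using d(2) by (auto simp: u0_def)
  obtain \<mu> where \<mu>: "\<mu> > 0" and near: "\<And>\<kappa>. \<kappa> > 0 \<Longrightarrow> \<exists>O'. open O' \<and> u0 \<in> O' \<and> O' \<subseteq> chart_image d \<and>
      (\<forall>u\<in>O'. \<forall>v. norm (DH d u v - DH d u0 v) \<le> \<kappa> * norm v)" and low: "\<And>v. norm (DH d u0 v) \<ge> \<mu> * norm v"
    using local_bounds[OF d(1) u0] by metis
  define \<kappa> where "\<kappa> = min (\<mu> / 2) (\<epsilon> * \<mu> / 8)"
  have \<kappa>: "\<kappa> > 0" "\<kappa> \<le> \<mu> / 2" "8 * \<kappa> \<le> \<epsilon> * \<mu>" using \<mu> \<epsilon> by (auto simp: \<kappa>_def)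
  obtain O' where O': "open O'" "u0 \<in> O'" "O' \<subseteq> chart_image d"
      "\<And>u v. u \<in> O' \<Longrightarrow> norm (DH d u v - DH d u0 v) \<le> \<kappa> * norm v" using near[OF \<kappa>(1)] by blast
  define W where "W = {x \<in> fst d. snd d x \<in> O'}"
  have "norm (T (h x2) \<xi>) \<ge> (1 - \<epsilon>) * norm \<xi>" if x1: "x1 \<in> W" and x2: "x2 \<in> W" and \<xi>: "\<xi> \<in> tangent (h x1)" for x1 x2 \<xi>
  proof -
    have x12: "x1 \<in> fst d" "x2 \<in> fst d" "snd d x1 \<in> O'" "snd d x2 \<in> O'" using x1 x2 by (auto simp: W_def)
    obtain v where v: "\<xi> = DH d (snd d x1) v" using \<xi> tangent_eq[OF d(1) x12(1)] by auto
    define \<xi>' where "\<xi>' = DH d (snd d x2) v"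
    have \<xi>': "\<xi>' \<in> tangent (h x2)" using tangent_eq[OF d(1) x12(2)] by (auto simp: \<xi>'_def)
    have x2X: "x2 \<in> topspace X" using x12(2) chart_dom_subset[OF d(1)] by blast
    have n0: "norm (\<xi> - DH d u0 v) \<le> \<kappa> * norm v" unfolding v by (rule O'(4)[OF x12(3)])
    have n0': "norm (\<xi>' - DH d u0 v) \<le> \<kappa> * norm v" unfolding \<xi>'_def by (rule O'(4)[OF x12(4)])
    have diff: "norm (\<xi> - \<xi>') \<le> 2 * (\<kappa> * norm v)"
    proof -
      have "norm (\<xi> - \<xi>') \<le> norm (\<xi> - DH d u0 v) + norm (\<xi>' - DH d u0 v)"
        using norm_triangle_ineq4[of "\<xi> - DH d u0 v" "\<xi>' - DH d u0 v"] by simp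
      then show ?thesis using n0 n0' by linarith
    qed
    have "\<mu> * norm v \<le> norm (DH d u0 v)" by (rule low)
    also have "\<dots> \<le> norm \<xi> + \<kappa> * norm v" using n0 norm_triangle_ineq2[of "DH d u0 v" \<xi>] by (simp add: norm_minus_commute)
    also have "\<dots> \<le> norm \<xi> + \<mu> / 2 * norm v" using \<kappa>(2) by (intro add_left_mono mult_right_mono) auto
    finally have lower: "\<mu> * norm v \<le> 2 * norm \<xi>" by simp
    have "8 * \<kappa> * norm v \<le> \<epsilon> * \<mu> * norm v" using \<kappa>(3) by (rule mult_right_mono) simp
    also have "\<dots> \<le> \<epsilon> * (2 * norm \<xi>)" using mult_left_mono[OF lower, of \<epsilon>] \<epsilon> by (simp add: mult.assoc)
    finally have small: "4 * (\<kappa> * norm v) \<le> \<epsilon> * norm \<xi>" by simp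
    have "norm \<xi>' = norm (T (h x2) \<xi>')" using iso[OF x2X \<xi>'] by simp
    also have "\<dots> \<le> norm (T (h x2) \<xi>) + norm (T (h x2) (\<xi> - \<xi>'))"
      using norm_triangle_ineq2[of "T (h x2) \<xi>'" "T (h x2) \<xi>"] linear_diff[OF lin] by (simp add: norm_minus_commute)
    also have "\<dots> \<le> norm (T (h x2) \<xi>) + norm (\<xi> - \<xi>')" using con by simp
    finally have "norm \<xi> - 2 * norm (\<xi> - \<xi>') \<le> norm (T (h x2) \<xi>)"
      using norm_triangle_ineq2[of \<xi> \<xi>'] by linarith
    then show ?thesis using diff small by (simp add: algebra_simps)
  qed
  moreover have "openin X W" unfolding W_def by (rule chart_preimage_open[OF d(1) O'(1)])
  moreover have "x0 \<in> W" using d(2) O'(2) by (simp add: W_def u0_def)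
  ultimately show ?thesis by blast
qed

text \<open>A Lebesgue number of the cover by the neighbourhoods of the local statement; their images are open
  in the image of the embedding because this is a homeomorphism.\<close>

lemma nearby_tangents:
  fixes T :: "'f \<Rightarrow> 'f \<Rightarrow> 'e"
  assumes lin: "\<And>y. linear (T y)" and con: "\<And>y v. norm (T y v) \<le> norm v"
    and iso: "\<And>x \<xi>. x \<in> topspace X \<Longrightarrow> \<xi> \<in> tangent (h x) \<Longrightarrow> norm (T (h x) \<xi>) = norm \<xi>"
    and \<epsilon>: "\<epsilon> > 0"
  shows "\<exists>e>0. \<forall>y\<in>h ` topspace X. \<forall>y'\<in>h ` topspace X. norm y \<le> R \<longrightarrow> dist y y' \<le> e \<longrightarrow>
       (\<forall>\<xi>\<in>tangent y. norm (T y' \<xi>) \<ge> (1 - \<epsilon>) * norm \<xi>)"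
proof -
  define good where "good O' \<longleftrightarrow> open O' \<and> (\<forall>y\<in>h ` topspace X. \<forall>y'\<in>h ` topspace X. y \<in> O' \<longrightarrow> y' \<in> O' \<longrightarrow>
     (\<forall>\<xi>\<in>tangent y. norm (T y' \<xi>) \<ge> (1 - \<epsilon>) * norm \<xi>))" for O'
  have cov: "\<exists>O'. good O' \<and> y \<in> O'" if "y \<in> h ` topspace X" for y
  proof -
    from that obtain x where x: "x \<in> topspace X" "y = h x" by blast
    obtain W where W: "openin X W" "x \<in> W" "\<forall>x1\<in>W. \<forall>x2\<in>W. \<forall>\<xi>\<in>tangent (h x1). norm (T (h x2) \<xi>) \<ge> (1 - \<epsilon>) * norm \<xi>"
      using nearby_tangents_local[where T=T, OF lin con iso x(1) \<epsilon>] by blast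
    obtain O' where O': "open O'" "h x \<in> O'" "\<forall>y\<in>topspace X. h y \<in> O' \<longrightarrow> y \<in> W"
      using h_open_onto_image[OF W(1,2)] by blast
    have "good O'" unfolding good_def using O' W(3) by blast
    then show ?thesis using O'(2) x(2) by blast
  qed
  have "{y \<in> h ` topspace X. norm y \<le> R} \<subseteq> \<Union> (Collect good)" using cov by blast
  moreover have "\<And>O'. O' \<in> Collect good \<Longrightarrow> open O'" by (simp add: good_def)
  ultimately obtain e where e: "e > 0" "\<forall>y\<in>{y \<in> h ` topspace X. norm y \<le> R}. \<exists>O'\<in>Collect good. ball y e \<subseteq> O'"
    using Heine_Borel_lemma[OF image_compact[of R], of "Collect good"] by metis
  have "norm (T y' \<xi>) \<ge> (1 - \<epsilon>) * norm \<xi>" if y: "y \<in> h ` topspace X" "y' \<in> h ` topspace X" "norm y \<le> R" "dist y y' \<le> e / 2"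
    "\<xi> \<in> tangent y" for y y' \<xi>
  proof -
    obtain O' where O': "good O'" "ball y e \<subseteq> O'" using e(2) y(1,3) by auto
    have "y \<in> ball y e" "y' \<in> ball y e" using e(1) y(4) by auto
    then have "y \<in> O'" "y' \<in> O'" using O'(2) by blast+
    then show ?thesis using O'(1) y unfolding good_def by blast
  qed
  then show ?thesis using e(1) by (intro exI[of _ "e / 2"]) auto
qed

text \<open>A bound on the normal curvatures of the embedding at \<open>x\<close>: instead of taking normal parts, some
  tangential term is added.\<close>

definition curv_bounded :: "'a \<Rightarrow> real \<Rightarrow> bool" where
  "curv_bounded x K \<longleftrightarrow> (\<forall>d\<in>A. x \<in> fst d \<longrightarrow>
     (\<forall>v. \<exists>w. norm (DDH d (snd d x) v v + DH d (snd d x) w) \<le> K * (norm (DH d (snd d x) v))\<^sup>2))"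

lemma curv_bounded_mono: "curv_bounded x K \<Longrightarrow> K \<le> K' \<Longrightarrow> curv_bounded x K'"
  unfolding curv_bounded_def by (meson mult_right_mono order_trans zero_le_power2)

lemma curv_bounded_local:
  assumes x0: "x0 \<in> topspace X"
  shows "\<exists>W K. openin X W \<and> x0 \<in> W \<and> (\<forall>x\<in>W. curv_bounded x K)"
proof -
  obtain d where d: "d \<in> A" "x0 \<in> fst d" using chart_cover[OF x0] by blast
  define u0 where "u0 = snd d x0"
  have u0: "u0 \<in> chart_image d" using d(2) by (auto simp: u0_def)
  obtain \<mu> where \<mu>: "\<mu> > 0" and near: "\<And>\<kappa>. \<kappa> > 0 \<Longrightarrow> \<exists>O'. open O' \<and> u0 \<in> O' \<and> O' \<subseteq> chart_image d \<and>
      (\<forall>u\<in>O'. \<forall>v. norm (DH d u v - DH d u0 v) \<le> \<kappa> * norm v)" and low: "\<And>v. norm (DH d u0 v) \<ge> \<mu> * norm v"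
    using local_bounds[OF d(1) u0] by metis
  have "\<mu> / 2 > 0" using \<mu> by simp
  from near[OF this] obtain O1 where O1: "open O1" "u0 \<in> O1" "O1 \<subseteq> chart_image d"
      "\<And>u v. u \<in> O1 \<Longrightarrow> norm (DH d u v - DH d u0 v) \<le> \<mu> / 2 * norm v" by blast
  have smDH: "smooth_on (chart_image d) (\<lambda>p. DH d p b)" for b
    unfolding DH_def by (rule smooth_on_derivative[OF smooth_H[OF d(1)]])
  define M where "M b b' = norm (DDH d u0 b b') + 1" for b b'
  have "\<forall>\<^sub>F u in nhds u0. norm (DDH d u b b') < M b b'" for b b'
  proof -
    have "continuous_on (chart_image d) (\<lambda>u. DDH d u b b')"
      unfolding DDH_def by (rule smooth_on_imp_continuous_on[OF smooth_on_derivative[OF smDH]])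
    then have "isCont (\<lambda>u. DDH d u b b') u0"
      using chart_image_open[OF d(1)] u0 continuous_on_eq_continuous_at by blast
    then have ic: "isCont (\<lambda>u. norm (DDH d u b b')) u0" by (rule isCont_norm)
    show ?thesis
      by (rule eventually_nhds_isCont[OF ic]) (use eventually_nhds_in_open[of "{..<M b b'}"] in \<open>simp add: M_def\<close>)
  qed
  then have "\<forall>\<^sub>F u in nhds u0. \<forall>b\<in>Basis. \<forall>b'\<in>Basis. norm (DDH d u b b') < M b b'"
    by (simp add: eventually_ball_finite_distrib)
  then obtain O2 where O2: "open O2" "u0 \<in> O2" "\<And>u. u \<in> O2 \<Longrightarrow> \<forall>b\<in>Basis. \<forall>b'\<in>Basis. norm (DDH d u b b') < M b b'"
    unfolding eventually_nhds by blast
  define K0 where "K0 = (\<Sum>b\<in>Basis. \<Sum>b'\<in>Basis. M b b')"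
  have K0: "K0 \<ge> 0" unfolding K0_def M_def by (intro sum_nonneg) auto
  define K where "K = K0 * 4 / \<mu>\<^sup>2"
  define W where "W = {x \<in> fst d. snd d x \<in> O1 \<inter> O2}"
  have "curv_bounded x K" if x: "x \<in> W" for x
    unfolding curv_bounded_def
  proof (intro ballI impI allI)
    fix d' v assume d': "d' \<in> A" "x \<in> fst d'"
    have xd: "x \<in> fst d" "snd d x \<in> O1" "snd d x \<in> O2" using x by (auto simp: W_def)
    define u where "u = snd d x"
    have u: "u \<in> chart_image d" "u \<in> O1" "u \<in> O2" using xd O1(3) by (auto simp: u_def)
    obtain v' w where vw: "DH d' (snd d' x) v = DH d u v'" "DDH d' (snd d' x) v v + DH d' (snd d' x) w = DDH d u v' v'"
      using chart_change_jet[OF d'(1) d(1) d'(2) xd(1), of v] by (auto simp: u_def)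
    have lower: "\<mu> / 2 * norm v' \<le> norm (DH d u v')"
    proof -
      have "\<mu> * norm v' \<le> norm (DH d u0 v')" by (rule low)
      also have "\<dots> \<le> norm (DH d u v') + \<mu> / 2 * norm v'"
        using O1(4)[OF u(2), of v'] norm_triangle_ineq2[of "DH d u0 v'" "DH d u v'"] by (simp add: norm_minus_commute)
      finally show ?thesis by simp
    qed
    have "norm (DDH d u v' v') \<le> K0 * (norm v')\<^sup>2"
    proof -
      have L: "linear (DDH d u b)" for b
        unfolding DDH_def[abs_def] by (rule linear_frechet_derivative[OF smooth_on_imp_differentiable[OF smDH u(1)]])
      have e1: "DDH d u b v' = (\<Sum>b'\<in>Basis. (v' \<bullet> b') *\<^sub>R DDH d u b b')" for b
      proof -
        have "DDH d u b (\<Sum>b'\<in>Basis. (v' \<bullet> b') *\<^sub>R b') = (\<Sum>b'\<in>Basis. (v' \<bullet> b') *\<^sub>R DDH d u b b')"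
          unfolding linear_sum[OF L] linear_scale[OF L] ..
        then show ?thesis by (simp only: euclidean_representation)
      qed
      have "DDH d u v' v' = (\<Sum>b\<in>Basis. (v' \<bullet> b) *\<^sub>R DDH d u b v')"
        using second_derivative_linear[OF smooth_H[OF d(1)] chart_image_open[OF d(1)] u(1), of v' v']
        by (simp add: DDH_def DH_def)
      also have "norm \<dots> \<le> (\<Sum>b\<in>Basis. norm ((v' \<bullet> b) *\<^sub>R DDH d u b v'))" by (rule norm_sum)
      also have "\<dots> \<le> (\<Sum>b\<in>Basis. norm v' * (\<Sum>b'\<in>Basis. norm v' * M b b'))"
      proof (rule sum_mono)
        fix b :: 'e assume b: "b \<in> Basis"
        have "norm (DDH d u b v') \<le> (\<Sum>b'\<in>Basis. norm ((v' \<bullet> b') *\<^sub>R DDH d u b b'))"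
          unfolding e1 by (rule norm_sum)
        also have "\<dots> \<le> (\<Sum>b'\<in>Basis. norm v' * M b b')"
        proof (rule sum_mono)
          fix b' :: 'e assume b': "b' \<in> Basis"
          have "norm (DDH d u b b') \<le> M b b'" using O2(3)[OF u(3)] b b' by (auto intro: less_imp_le)
          then show "norm ((v' \<bullet> b') *\<^sub>R DDH d u b b') \<le> norm v' * M b b'"
            using Basis_le_norm[OF b', of v'] by (simp add: mult_mono)
        qed
        finally show "norm ((v' \<bullet> b) *\<^sub>R DDH d u b v') \<le> norm v' * (\<Sum>b'\<in>Basis. norm v' * M b b')"
          using Basis_le_norm[OF b, of v'] by (simp add: mult_mono)
      qed
      also have "\<dots> = K0 * (norm v')\<^sup>2"
        by (simp add: K0_def sum_distrib_left sum_distrib_right power2_eq_square mult_ac)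
      finally show ?thesis .
    qed
    also have "\<dots> = K * (\<mu> / 2 * norm v')\<^sup>2" using \<mu> by (simp add: K_def power_mult_distrib power_divide)
    also have "\<dots> \<le> K * (norm (DH d u v'))\<^sup>2"
      using lower \<mu> K0 by (intro mult_left_mono power_mono) (auto simp: K_def)
    finally show "\<exists>w. norm (DDH d' (snd d' x) v v + DH d' (snd d' x) w) \<le> K * (norm (DH d' (snd d' x) v))\<^sup>2"
      using vw by metis
  qed
  moreover have "openin X W" unfolding W_def by (rule chart_preimage_open[OF d(1)]) (use O1(1) O2(1) in auto)
  moreover have "x0 \<in> W" using d(2) O1(2) O2(2) by (simp add: W_def u0_def)
  ultimately show ?thesis by blast
qed

lemma curv_bounded_on_balls: "\<exists>K. \<forall>x\<in>topspace X. norm (h x) \<le> R \<longrightarrow> curv_bounded x K"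
proof -
  let ?C = "{x \<in> topspace X. norm (h x) \<le> R}"
  define \<U> where "\<U> = {W. openin X W \<and> (\<exists>K. \<forall>x\<in>W. curv_bounded x K)}"
  have "?C \<subseteq> \<Union>\<U>" using curv_bounded_local unfolding \<U>_def by blast
  moreover have "\<And>U. U \<in> \<U> \<Longrightarrow> openin X U" by (simp add: \<U>_def)
  ultimately obtain \<F> where F: "finite \<F>" "\<F> \<subseteq> \<U>" "?C \<subseteq> \<Union>\<F>"
    using compactinD[OF proper_h[of R], of \<U>] by metis
  have "\<forall>W\<in>\<F>. \<exists>K. \<forall>x\<in>W. curv_bounded x K" using F(2) by (auto simp: \<U>_def)
  then obtain k where k: "\<forall>W\<in>\<F>. \<forall>x\<in>W. curv_bounded x (k W)" by metis
  have "curv_bounded x (\<Sum>W\<in>\<F>. \<bar>k W\<bar>)" if "x \<in> ?C" for x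
  proof -
    from that F(3) obtain W where W: "W \<in> \<F>" "x \<in> W" by blast
    have "k W \<le> (\<Sum>W\<in>\<F>. \<bar>k W\<bar>)" using member_le_sum[OF W(1), of "\<lambda>W. \<bar>k W\<bar>"] F(1) by simp
    then show ?thesis using k W curv_bounded_mono by blast
  qed
  then show ?thesis by blast
qed

lemma oscillating_immersion:
  assumes \<delta>: "\<delta> > 0"
  defines "c \<equiv> 3 * real DIM('e) / (real DIM('e) + 2)"
  shows "\<exists>(n::nat) (\<Phi> :: nat \<Rightarrow> 'f \<Rightarrow> real). (\<forall>i. smooth_on UNIV (\<Phi> i)) \<and> (\<forall>y. (\<Sum>i<n. (\<Phi> i y)\<^sup>2) = 1) \<and>
     (\<forall>d\<in>A. \<forall>u\<in>chart_image d. \<forall>v. \<exists>w G1 G2.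
       (\<forall>i. jet2 (\<lambda>s. \<Phi> i (h (chart_inv d (u + s *\<^sub>R v + (s\<^sup>2 / 2) *\<^sub>R w)))) (G1 i) (G2 i)) \<and>
       (\<Sum>i<n. (G2 i)\<^sup>2) \<le> (c + \<delta>) * (\<Sum>i<n. (G1 i)\<^sup>2)\<^sup>2 \<and> (v \<noteq> 0 \<longrightarrow> (\<Sum>i<n. (G1 i)\<^sup>2) > 0))"
proof -
  obtain T :: "'f \<Rightarrow> 'f \<Rightarrow> 'e" where lin: "\<And>y. linear (T y)" and con: "\<And>y v. norm (T y v) \<le> norm v"
    and iso: "\<And>x \<xi>. x \<in> topspace X \<Longrightarrow> \<xi> \<in> tangent (h x) \<Longrightarrow> norm (T (h x) \<xi>) = norm \<xi>"
    using tangent_contraction_exists by blast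
  have "\<forall>k::nat. \<exists>K. \<forall>x\<in>topspace X. norm (h x) \<le> real k \<longrightarrow> curv_bounded x K"
    using curv_bounded_on_balls by blast
  from choice[OF this] obtain K where K: "\<And>k x. x \<in> topspace X \<Longrightarrow> norm (h x) \<le> real k \<Longrightarrow> curv_bounded x (K k)" by blast
  define B where "B y = (\<Sum>k\<le>nat \<lceil>norm y\<rceil>. \<bar>K k\<bar>)" for y :: 'f
  have Bc: "curv_bounded x (B (h x))" if x: "x \<in> topspace X" for x
  proof -
    have "norm (h x) \<le> real (nat \<lceil>norm (h x)\<rceil>)" by linarith
    then have "curv_bounded x (K (nat \<lceil>norm (h x)\<rceil>))" by (rule K[OF x])
    moreover have "K (nat \<lceil>norm (h x)\<rceil>) \<le> B (h x)"
      unfolding B_def using member_le_sum[of "nat \<lceil>norm (h x)\<rceil>" "{..nat \<lceil>norm (h x)\<rceil>}" "\<lambda>k. \<bar>K k\<bar>"] by simp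
    ultimately show ?thesis by (rule curv_bounded_mono)
  qed
  have bnd: "\<exists>b. \<forall>y\<in>h ` topspace X. norm y \<le> R \<longrightarrow> B y \<le> b" for R
  proof (intro exI ballI impI)
    fix y :: 'f assume "norm y \<le> R"
    then have "nat \<lceil>norm y\<rceil> \<le> nat \<lceil>R\<rceil>" by (intro nat_mono ceiling_mono)
    then show "B y \<le> (\<Sum>k\<le>nat \<lceil>R\<rceil>. \<bar>K k\<bar>)"
      unfolding B_def by (intro sum_mono2) simp_all
  qed
  have "\<exists>(n::nat) (\<Phi> :: nat \<Rightarrow> 'f \<Rightarrow> real). (\<forall>i. smooth_on UNIV (\<Phi> i)) \<and> (\<forall>y. (\<Sum>i<n. (\<Phi> i y)\<^sup>2) = 1) \<and>
     (\<forall>y\<in>h ` topspace X. \<forall>\<xi>\<in>tangent y. \<forall>\<eta> \<gamma>. norm \<eta> \<le> B y * (norm \<xi>)\<^sup>2 \<longrightarrow> jet2 \<gamma> \<xi> \<eta> \<longrightarrow> \<gamma> 0 = y \<longrightarrow>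
       (\<exists>G1 G2. (\<forall>i. jet2 (\<lambda>t. \<Phi> i (\<gamma> t)) (G1 i) (G2 i)) \<and>
          (\<Sum>i<n. (G2 i)\<^sup>2) \<le> (c + \<delta>) * (\<Sum>i<n. (G1 i)\<^sup>2)\<^sup>2 \<and> (\<xi> \<noteq> 0 \<longrightarrow> (\<Sum>i<n. (G1 i)\<^sup>2) > 0)))"
    unfolding c_def
  proof (rule oscillating_map[where T=T])
    show "\<exists>d>0. \<forall>y\<in>h ` topspace X. \<forall>y'\<in>h ` topspace X. norm y \<le> R \<longrightarrow> dist y y' \<le> d \<longrightarrow>
       (\<forall>\<xi>\<in>tangent y. (1 - \<epsilon>) * norm \<xi> \<le> norm (T y' \<xi>))" if "\<epsilon> > 0" for \<epsilon> R
      by (rule nearby_tangents[where T=T]) (use lin con iso that in auto)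
  qed (use lin con bnd \<delta> in auto)
  then obtain n :: nat and \<Phi> :: "nat \<Rightarrow> 'f \<Rightarrow> real" where osc: "(\<forall>i. smooth_on UNIV (\<Phi> i)) \<and> (\<forall>y. (\<Sum>i<n. (\<Phi> i y)\<^sup>2) = 1) \<and>
     (\<forall>y\<in>h ` topspace X. \<forall>\<xi>\<in>tangent y. \<forall>\<eta> \<gamma>. norm \<eta> \<le> B y * (norm \<xi>)\<^sup>2 \<longrightarrow> jet2 \<gamma> \<xi> \<eta> \<longrightarrow> \<gamma> 0 = y \<longrightarrow>
       (\<exists>G1 G2. (\<forall>i. jet2 (\<lambda>t. \<Phi> i (\<gamma> t)) (G1 i) (G2 i)) \<and>
          (\<Sum>i<n. (G2 i)\<^sup>2) \<le> (c + \<delta>) * (\<Sum>i<n. (G1 i)\<^sup>2)\<^sup>2 \<and> (\<xi> \<noteq> 0 \<longrightarrow> (\<Sum>i<n. (G1 i)\<^sup>2) > 0)))"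
    by (elim exE) (rule that)
  have \<Phi>: "smooth_on UNIV (\<Phi> i)" "(\<Sum>i<n. (\<Phi> i y)\<^sup>2) = 1" for i y using osc by auto
  note \<Phi>3 = conjunct2[OF conjunct2[OF osc], rule_format]
  show ?thesis
  proof (intro exI[of _ n] exI[of _ \<Phi>] conjI allI ballI \<Phi>(1,2))
    fix d u v assume d: "d \<in> A" and u: "u \<in> chart_image d"
    define x where "x = chart_inv d u"
    have xd: "x \<in> fst d" "snd d x = u" using chart_inv_in[OF u] chart_inv_right[OF u] by (simp_all add: x_def)
    have x: "x \<in> topspace X" using xd chart_dom_subset[OF d] by blast
    obtain w where w: "norm (DDH d u v v + DH d u w) \<le> B (h x) * (norm (DH d u v))\<^sup>2"
      using Bc[OF x] d xd unfolding curv_bounded_def by blast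
    define \<gamma> where "\<gamma> s = u + s *\<^sub>R v + (s\<^sup>2 / 2) *\<^sub>R w" for s :: real
    have \<gamma>0: "\<gamma> 0 = u" by (simp add: \<gamma>_def)
    have "jet2 \<gamma> v w" unfolding \<gamma>_def[abs_def] by (rule jet2_parabola)
    then have j: "jet2 (\<lambda>s. H d (\<gamma> s)) (DH d u v) (DDH d u v v + DH d u w)"
      using jet_H[OF d, of \<gamma>] u \<gamma>0 by simp
    have tan: "DH d u v \<in> tangent (h x)" using tangent_eq[OF d xd(1)] xd(2) by auto
    have H0: "H d (\<gamma> 0) = h x" by (simp add: \<gamma>0 H_def x_def)
    obtain G1 G2 where G: "\<forall>i. jet2 (\<lambda>s. \<Phi> i (H d (\<gamma> s))) (G1 i) (G2 i)"
      "(\<Sum>i<n. (G2 i)\<^sup>2) \<le> (c + \<delta>) * (\<Sum>i<n. (G1 i)\<^sup>2)\<^sup>2" "DH d u v \<noteq> 0 \<longrightarrow> (\<Sum>i<n. (G1 i)\<^sup>2) > 0"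
      using \<Phi>3[OF imageI[OF x] tan w j H0] by (elim exE conjE) (rule that)
    have "v \<noteq> 0 \<longrightarrow> DH d u v \<noteq> 0"
      using linear_injective_0[OF linear_DH[OF d u]] inj_DH[OF d u] by blast
    with G have res: "(\<forall>i. jet2 (\<lambda>s. \<Phi> i (h (chart_inv d (u + s *\<^sub>R v + (s\<^sup>2 / 2) *\<^sub>R w)))) (G1 i) (G2 i)) \<and>
       (\<Sum>i<n. (G2 i)\<^sup>2) \<le> (c + \<delta>) * (\<Sum>i<n. (G1 i)\<^sup>2)\<^sup>2 \<and> (v \<noteq> 0 \<longrightarrow> (\<Sum>i<n. (G1 i)\<^sup>2) > 0)"
      by (auto simp: H_def \<gamma>_def)
    show "\<exists>w G1 G2. (\<forall>i. jet2 (\<lambda>s. \<Phi> i (h (chart_inv d (u + s *\<^sub>R v + (s\<^sup>2 / 2) *\<^sub>R w)))) (G1 i) (G2 i)) \<and>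
       (\<Sum>i<n. (G2 i)\<^sup>2) \<le> (c + \<delta>) * (\<Sum>i<n. (G1 i)\<^sup>2)\<^sup>2 \<and> (v \<noteq> 0 \<longrightarrow> (\<Sum>i<n. (G1 i)\<^sup>2) > 0)"
      by (rule exI[of _ w], rule exI[of _ G1], rule exI[of _ G2], rule res)
  qed
qed

end

section \<open>The second fundamental form in \<open>\<real>\<^sup>N\<close>\<close>

lemma inner_N_add_left: "inner_N N (\<lambda>i. x i + y i) z = inner_N N x z + inner_N N y z"
  by (simp add: inner_N_def distrib_right sum.distrib)

lemma inner_N_diff_left: "inner_N N (\<lambda>i. x i - y i) z = inner_N N x z - inner_N N y z"
  by (simp add: inner_N_def left_diff_distrib sum_subtractf)

lemma inner_N_commute: "inner_N N x y = inner_N N y x"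
  by (simp add: inner_N_def mult.commute)

lemma inner_N_nonneg: "inner_N N x x \<ge> 0"
  by (simp add: inner_N_def sum_nonneg)

lemma inner_N_eq_0: "inner_N N x x = 0 \<Longrightarrow> i < N \<Longrightarrow> x i = 0"
  by (simp add: inner_N_def sum_nonneg_eq_0_iff)

text \<open>The normal part is the shortest vector among those that differ from \<open>y\<close> by a tangential one.\<close>

lemma norm_normal_part_le:
  fixes D :: "'e::euclidean_space \<Rightarrow> nat \<Rightarrow> real"
  assumes lin: "\<And>i. linear (\<lambda>v. D v i)" and zero: "\<And>v i. N \<le> i \<Longrightarrow> D v i = 0" and inj: "inj D"
    and y: "\<And>i. N \<le> i \<Longrightarrow> y i = 0"
  shows "normal_part N (range D) y \<in> topspace (Euclidean_space N)"
    and "norm_N N (normal_part N (range D) y) \<le> norm_N N (\<lambda>i. y i + D w i)"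
proof -
  have L: "linear (\<lambda>v. inner_N N z (D v))" for z
    by (rule linearI) (simp_all add: inner_N_def linear_add[OF lin] linear_scale[OF lin] distrib_left sum.distrib sum_distrib_left mult_ac)
  have Lb: "inner_N N z (D v) = (\<Sum>b\<in>Basis. (v \<bullet> b) * inner_N N z (D b))" for z v
  proof -
    have "inner_N N z (D (\<Sum>b\<in>Basis. (v \<bullet> b) *\<^sub>R b)) = (\<Sum>b\<in>Basis. (v \<bullet> b) * inner_N N z (D b))"
      using linear_sum[OF L, of z "\<lambda>b. (v \<bullet> b) *\<^sub>R b" Basis] linear_scale[OF L, of z] by simp
    then show ?thesis by (simp only: euclidean_representation)
  qed
  have D0: "D v = D v'" if "inner_N N (D (v - v')) (D (v - v')) = 0" for v v'
  proof
    fix i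
    have "D (v - v') i = 0" using inner_N_eq_0[OF that] zero by (cases "i < N") auto
    then show "D v i = D v' i" using linear_diff[OF lin] by simp
  qed
  define G where "G v = (\<Sum>b\<in>Basis. inner_N N (D v) (D b) *\<^sub>R b)" for v
  have Gb: "G v \<bullet> b = inner_N N (D v) (D b)" if "b \<in> Basis" for v b
    using that by (simp add: G_def)
  have linG: "linear G"
  proof (rule linearI)
    have LL: "linear (\<lambda>v. inner_N N (D v) z)" for z using L[of z] by (simp add: inner_N_commute)
    show "G (a + b) = G a + G b" for a b
      by (simp add: G_def linear_add[OF LL] scaleR_left.add sum.distrib)
    show "G (r *\<^sub>R b) = r *\<^sub>R G b" for r b
      by (simp add: G_def linear_scale[OF LL] scaleR_sum_right)
  qed
  have "v = 0" if "G v = 0" for v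
  proof -
    have "inner_N N (D v) (D b) = 0" if "b \<in> Basis" for b using Gb[OF that, of v] \<open>G v = 0\<close> by simp
    then have "inner_N N (D v) (D v) = 0" by (subst Lb) simp
    then have "inner_N N (D (v - 0)) (D (v - 0)) = 0" by (simp only: diff_zero)
    then have "D v = D 0" by (rule D0)
    then show ?thesis by (rule injD[OF inj])
  qed
  then have "surj G" using linG linear_injective_0 linear_injective_imp_surjective by blast
  then obtain v where v: "G v = (\<Sum>b\<in>Basis. inner_N N y (D b) *\<^sub>R b)" by (metis surjD)
  have "inner_N N (D v) (D b) = inner_N N y (D b)" if "b \<in> Basis" for b
    using Gb[OF that, of v] v that by simp
  then have orth0: "inner_N N (D v) (D z) = inner_N N y (D z)" for z
    by (subst (1 2) Lb) simp
  define n where "n i = y i - D v i" for i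
  have orth: "inner_N N n (D z) = 0" for z
    unfolding n_def inner_N_diff_left using orth0 by simp
  have nE: "n \<in> topspace (Euclidean_space N)"
    using y zero by (simp add: n_def topspace_Euclidean_space)
  have np: "normal_part N (range D) y = n"
    unfolding normal_part_def
  proof (rule the_equality)
    show "n \<in> topspace (Euclidean_space N) \<and> (\<forall>t\<in>range D. inner_N N n t = 0) \<and> (\<exists>t\<in>range D. y = (\<lambda>i. n i + t i))"
    proof (intro conjI nE ballI)
      show "\<exists>t\<in>range D. y = (\<lambda>i. n i + t i)" by (rule bexI[of _ "D v"]) (simp_all add: n_def)
    qed (use orth in auto)
    fix n' assume n': "n' \<in> topspace (Euclidean_space N) \<and> (\<forall>t\<in>range D. inner_N N n' t = 0) \<and> (\<exists>t\<in>range D. y = (\<lambda>i. n' i + t i))"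
    then obtain v' where v': "y = (\<lambda>i. n' i + D v' i)" by auto
    have diff: "D (v' - v) = (\<lambda>i. n i - n' i)"
    proof
      fix i have "y i = n' i + D v' i" using v' by (rule fun_cong)
      then show "D (v' - v) i = n i - n' i" by (simp add: n_def linear_diff[OF lin])
    qed
    have "inner_N N (D (v' - v)) (D (v' - v)) = inner_N N n (D (v' - v)) - inner_N N n' (D (v' - v))"
      by (subst (1) diff) (rule inner_N_diff_left)
    also have "\<dots> = 0" using orth n' by simp
    finally have "D v' = D v" by (rule D0)
    then show "n' = n" using v' by (auto simp: n_def fun_eq_iff)
  qed
  then show "normal_part N (range D) y \<in> topspace (Euclidean_space N)" using nE by simp
  have "inner_N N n n \<le> inner_N N (\<lambda>i. y i + D w i) (\<lambda>i. y i + D w i)"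
  proof -
    have eq: "(\<lambda>i. y i + D w i) = (\<lambda>i. n i + D (v + w) i)" by (simp add: n_def linear_add[OF lin])
    have "inner_N N (\<lambda>i. n i + D (v + w) i) (\<lambda>i. n i + D (v + w) i) = inner_N N n n + 2 * inner_N N n (D (v + w)) + inner_N N (D (v + w)) (D (v + w))"
      unfolding inner_N_add_left
      by (subst (1 2) inner_N_commute) (simp add: inner_N_add_left inner_N_commute)
    then show ?thesis using orth inner_N_nonneg[of N "D (v + w)"] by (simp add: eq)
  qed
  then show "norm_N N (normal_part N (range D) y) \<le> norm_N N (\<lambda>i. y i + D w i)"
    by (simp add: norm_N_def np)
qed

text \<open>The vectors involved have no component in the additional direction.\<close>

lemma normal_part_Suc:
  assumes "\<And>t. t \<in> T \<Longrightarrow> t N = 0" "y N = 0"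
  shows "normal_part (Suc N) T y = normal_part N T y"
proof -
  have "(n \<in> topspace (Euclidean_space (Suc N)) \<and> (\<forall>t\<in>T. inner_N (Suc N) n t = 0) \<and> (\<exists>t\<in>T. y = (\<lambda>i. n i + t i))) =
    (n \<in> topspace (Euclidean_space N) \<and> (\<forall>t\<in>T. inner_N N n t = 0) \<and> (\<exists>t\<in>T. y = (\<lambda>i. n i + t i)))" for n
  proof -
    have "inner_N (Suc N) n t = inner_N N n t" if "t \<in> T" for t
      using assms(1)[OF that] by (simp add: inner_N_def)
    moreover have "n N = 0" if "t \<in> T" "y = (\<lambda>i. n i + t i)" for t
      using fun_cong[OF that(2), of N] assms(1)[OF that(1)] assms(2) by simp
    moreover have "n \<in> topspace (Euclidean_space N) \<longleftrightarrow> n \<in> topspace (Euclidean_space (Suc N)) \<and> n N = 0"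
      by (auto simp: topspace_Euclidean_space) (metis Suc_leI le_neq_implies_less)
    ultimately show ?thesis by (auto cong: ball_cong)
  qed
  then show ?thesis unfolding normal_part_def by (intro arg_cong[of _ _ The]) auto
qed

section \<open>Monotonicity in the dimension of the ball\<close>

lemma dir_deriv_eq_0:
  assumes "open S" "u \<in> S" "\<And>p. p \<in> S \<Longrightarrow> F p i = 0"
  shows "dir_deriv F u v i = 0"
proof -
  have "((\<lambda>p. F p i) has_derivative (\<lambda>_. 0)) (at u)"
    using has_derivative_transform_within_open[OF has_derivative_const[of "0::real"] assms(1,2), of "\<lambda>p. F p i"] assms(3) by simp
  from fun_cong[OF frechet_derivative_at[OF this], of v] show ?thesis
    unfolding dir_deriv_def by (rule sym)
qed

lemma dir_deriv2_eq_0: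
  assumes "open S" "u \<in> S" "\<And>p. p \<in> S \<Longrightarrow> F p i = 0"
  shows "dir_deriv2 F u v w i = 0"
proof -
  have "dir_deriv F p v i = 0" if "p \<in> S" for p
    by (rule dir_deriv_eq_0[where S=S, OF assms(1) that]) (rule assms(3))
  then show ?thesis
    unfolding dir_deriv2_def by (intro dir_deriv_eq_0[where S=S, OF assms(1,2)])
qed

context manifold begin

lemma local_rep_eq_0:
  assumes "immersion X A N (unit_ball N) f" "c \<in> A" "p \<in> chart_image c" "N \<le> i"
  shows "local_rep c f p i = 0"
proof -
  have "chart_inv c p \<in> topspace X" using chart_inv_in[OF assms(3)] chart_dom_subset[OF assms(2)] by blast
  then have "f (chart_inv c p) \<in> topspace (Euclidean_space N)" using assms(1) by (auto simp: immersion_def)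
  then show ?thesis using assms(4) by (simp add: local_rep_def topspace_Euclidean_space)
qed

lemma immersion_Suc:
  assumes "immersion X A N (unit_ball N) f"
  shows "immersion X A (Suc N) (unit_ball (Suc N)) f" and "curv_perp A (Suc N) f \<le> curv_perp A N f"
proof -
  have "unit_ball N \<subseteq> unit_ball (Suc N)"
    by (auto simp: unit_ball_def topspace_Euclidean_space norm_N_def inner_N_def)
  moreover have "smooth_on (chart_image c) (\<lambda>u. local_rep c f u N)" if c: "c \<in> A" for c
    by (rule smooth_on_cong[OF chart_image_open[OF c] _ smooth_on_const[OF chart_image_open[OF c], of 0]])
      (simp add: local_rep_eq_0[OF assms c])
  ultimately show "immersion X A (Suc N) (unit_ball (Suc N)) f"
    using assms unfolding immersion_def by (auto simp: unit_ball_def less_Suc_eq)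
  have "norm_N (Suc N) (second_fundamental_form (Suc N) (local_rep c f) u v v) = norm_N N (second_fundamental_form N (local_rep c f) u v v)
      \<and> norm_N (Suc N) (dir_deriv (local_rep c f) u v) = norm_N N (dir_deriv (local_rep c f) u v)"
    if c: "c \<in> A" and u: "u \<in> chart_image c" for c u v
  proof -
    have z: "local_rep c f p N = 0" if "p \<in> chart_image c" for p by (rule local_rep_eq_0[OF assms c that]) simp
    have d1: "dir_deriv (local_rep c f) u v N = 0" for v by (rule dir_deriv_eq_0[where S="chart_image c", OF chart_image_open[OF c] u]) (rule z)
    have d2: "dir_deriv2 (local_rep c f) u v v N = 0" by (rule dir_deriv2_eq_0[where S="chart_image c", OF chart_image_open[OF c] u]) (rule z)
    have sf: "second_fundamental_form (Suc N) (local_rep c f) u v v = second_fundamental_form N (local_rep c f) u v v"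
      unfolding second_fundamental_form_def by (rule normal_part_Suc) (use d1 d2 in auto)
    have lin: "linear (\<lambda>v. dir_deriv (local_rep c f) u v i)" for i
    proof (cases "i < N")
      case True
      then have "smooth_on (chart_image c) (\<lambda>u. local_rep c f u i)" using assms c by (simp add: immersion_def)
      then show ?thesis unfolding dir_deriv_def
        by (intro linear_frechet_derivative smooth_on_imp_differentiable[OF _ u])
    next
      case False
      then have "dir_deriv (local_rep c f) u v i = 0" for v
        by (intro dir_deriv_eq_0[where S="chart_image c", OF chart_image_open[OF c] u] local_rep_eq_0[OF assms c]) auto
      then show ?thesis by (simp add: linear_zero)
    qed
    have d0: "dir_deriv (local_rep c f) u v i = 0" "dir_deriv2 (local_rep c f) u v v i = 0" if "N \<le> i" for v i
      using local_rep_eq_0[OF assms c _ that]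
      by (intro dir_deriv_eq_0[where S="chart_image c", OF chart_image_open[OF c] u]
          dir_deriv2_eq_0[where S="chart_image c", OF chart_image_open[OF c] u]; simp)+
    have "inj (dir_deriv (local_rep c f) u)" using assms c u unfolding immersion_def by blast
    then have "second_fundamental_form N (local_rep c f) u v v \<in> topspace (Euclidean_space N)"
      unfolding second_fundamental_form_def by (intro norm_normal_part_le(1)[OF lin] d0)
    then have sfN: "second_fundamental_form N (local_rep c f) u v v N = 0" by (simp add: topspace_Euclidean_space)
    show ?thesis unfolding sf using sfN d1 by (simp add: norm_N_def inner_N_def)
  qed
  note same = this
  show "curv_perp A (Suc N) f \<le> curv_perp A N f"
    unfolding curv_perp_def
  proof (rule Sup_subset_mono, rule subsetI, elim CollectE exE conjE)
    fix a c u v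
    assume a: "a = ennreal (norm_N (Suc N) (second_fundamental_form (Suc N) (local_rep c f) u v v))"
      and c: "c \<in> A" and u: "u \<in> chart_image c" and v: "norm_N (Suc N) (dir_deriv (local_rep c f) u v) = 1"
    have "a = ennreal (norm_N N (second_fundamental_form N (local_rep c f) u v v)) \<and>
       c \<in> A \<and> u \<in> chart_image c \<and> norm_N N (dir_deriv (local_rep c f) u v) = 1"
      using a c u v same[OF c u, of v] by simp
    then show "a \<in> {ennreal (norm_N N (second_fundamental_form N (local_rep c f) u v v)) | c u v.
        c \<in> A \<and> u \<in> chart_image c \<and> norm_N N (dir_deriv (local_rep c f) u v) = 1}" by blast
  qed
qed

lemma min_curv_perp_Suc: "min_curv_perp X A (Suc N) (unit_ball (Suc N)) \<le> min_curv_perp X A N (unit_ball N)"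
  unfolding min_curv_perp_def
proof (rule INF_mono)
  fix f assume "f \<in> {f. immersion X A N (unit_ball N) f}"
  then have "immersion X A N (unit_ball N) f" by simp
  from immersion_Suc[OF this]
  show "\<exists>g\<in>{f. immersion X A (Suc N) (unit_ball (Suc N)) f}. curv_perp A (Suc N) g \<le> curv_perp A N f"
    by (intro bexI[of _ f]) simp_all
qed

end

section \<open>The immersions and the bound\<close>

context proper_embedding begin

text \<open>The acceleration \<open>w\<close> of the parabola only adds a tangential vector to the second derivative of the
  immersion, and normal parts are shortest.\<close>

lemma low_curvature_immersion:
  assumes "\<delta> > 0"
  shows "\<exists>n. \<forall>N\<ge>n. min_curv_perp X A N (unit_ball N) \<le> ennreal (sqrt (3 * real DIM('e) / (real DIM('e) + 2) + \<delta>))"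
proof -
  define k where "k = 3 * real DIM('e) / (real DIM('e) + 2) + \<delta>"
  have ex: "\<exists>(n::nat) (\<Phi> :: nat \<Rightarrow> 'f \<Rightarrow> real). (\<forall>i. smooth_on UNIV (\<Phi> i)) \<and> (\<forall>y. (\<Sum>i<n. (\<Phi> i y)\<^sup>2) = 1) \<and>
     (\<forall>d\<in>A. \<forall>u\<in>chart_image d. \<forall>v. \<exists>w G1 G2.
       (\<forall>i. jet2 (\<lambda>s. \<Phi> i (h (chart_inv d (u + s *\<^sub>R v + (s\<^sup>2 / 2) *\<^sub>R w)))) (G1 i) (G2 i)) \<and>
       (\<Sum>i<n. (G2 i)\<^sup>2) \<le> k * (\<Sum>i<n. (G1 i)\<^sup>2)\<^sup>2 \<and> (v \<noteq> 0 \<longrightarrow> (\<Sum>i<n. (G1 i)\<^sup>2) > 0))"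
    unfolding k_def by (rule oscillating_immersion[OF assms])
  then obtain n :: nat and \<Phi> :: "nat \<Rightarrow> 'f \<Rightarrow> real" where \<Phi>: "\<And>i. smooth_on UNIV (\<Phi> i)" "\<And>y. (\<Sum>i<n. (\<Phi> i y)\<^sup>2) = 1"
    and jets: "\<forall>d\<in>A. \<forall>u\<in>chart_image d. \<forall>v. \<exists>w G1 G2.
       (\<forall>i. jet2 (\<lambda>s. \<Phi> i (h (chart_inv d (u + s *\<^sub>R v + (s\<^sup>2 / 2) *\<^sub>R w)))) (G1 i) (G2 i)) \<and>
       (\<Sum>i<n. (G2 i)\<^sup>2) \<le> k * (\<Sum>i<n. (G1 i)\<^sup>2)\<^sup>2 \<and> (v \<noteq> 0 \<longrightarrow> (\<Sum>i<n. (G1 i)\<^sup>2) > 0)"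
    by (elim exE conjE) (rule that, (erule spec)+)
  define f where "f x i = (if i < n then \<Phi> i (h x) else 0)" for x i
  have "min_curv_perp X A N (unit_ball N) \<le> ennreal (sqrt k)" if N: "n \<le> N" for N
  proof -
    have sumN: "(\<Sum>i<N. g i) = (\<Sum>i<n. g i)" if "\<And>i. n \<le> i \<Longrightarrow> g i = 0" for g :: "nat \<Rightarrow> real"
      by (rule sum.mono_neutral_right) (use N that in auto)
    have sm: "smooth_on (chart_image c) (\<lambda>u. local_rep c f u i)" if c: "c \<in> A" for c i
    proof (cases "i < n")
      case True
      have "smooth_on (chart_image c) (\<lambda>u. \<Phi> i (H c u))"
        by (rule smooth_on_compose[OF chart_image_open[OF c] open_UNIV _ smooth_H[OF c] \<Phi>(1)]) simp
      then show ?thesis using True by (simp add: local_rep_def f_def H_def)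
    next
      case False
      then show ?thesis using smooth_on_const[OF chart_image_open[OF c]] by (simp add: local_rep_def f_def)
    qed
    have zero: "dir_deriv (local_rep c f) u v i = 0" "dir_deriv2 (local_rep c f) u v v i = 0"
      if "c \<in> A" "u \<in> chart_image c" "n \<le> i" for c u v i
      using that(3) by (intro dir_deriv_eq_0[where S="chart_image c", OF chart_image_open[OF that(1)] that(2)]
          dir_deriv2_eq_0[where S="chart_image c", OF chart_image_open[OF that(1)] that(2)]; simp add: local_rep_def f_def)+
    have lin: "linear (\<lambda>v. dir_deriv (local_rep c f) u v i)" if "c \<in> A" "u \<in> chart_image c" for c u i
      unfolding dir_deriv_def using smooth_on_imp_differentiable[OF sm[OF that(1)] that(2)]
      by (intro linear_frechet_derivative)
    have main: "\<exists>w. (\<Sum>i<n. (dir_deriv2 (local_rep c f) u v v i + dir_deriv (local_rep c f) u w i)\<^sup>2)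
         \<le> k * (\<Sum>i<n. (dir_deriv (local_rep c f) u v i)\<^sup>2)\<^sup>2 \<and>
        (v \<noteq> 0 \<longrightarrow> (\<Sum>i<n. (dir_deriv (local_rep c f) u v i)\<^sup>2) > 0)" if c: "c \<in> A" and u: "u \<in> chart_image c" for c u v
    proof -
      obtain w G1 G2 where G: "\<And>i. jet2 (\<lambda>s. \<Phi> i (h (chart_inv c (u + s *\<^sub>R v + (s\<^sup>2 / 2) *\<^sub>R w)))) (G1 i) (G2 i)"
       and G12: "(\<Sum>i<n. (G2 i)\<^sup>2) \<le> k * (\<Sum>i<n. (G1 i)\<^sup>2)\<^sup>2" "v \<noteq> 0 \<longrightarrow> (\<Sum>i<n. (G1 i)\<^sup>2) > 0"
        using jets[rule_format, OF c u, of v] by (elim exE conjE) (rule that, erule spec)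
      have "G1 i = dir_deriv (local_rep c f) u v i \<and> G2 i = dir_deriv2 (local_rep c f) u v v i + dir_deriv (local_rep c f) u w i"
        if i: "i < n" for i
      proof -
        have "jet2 (\<lambda>s. local_rep c f (u + s *\<^sub>R v + (s\<^sup>2 / 2) *\<^sub>R w) i) (dir_deriv (local_rep c f) u v i)
           (dir_deriv2 (local_rep c f) u v v i + dir_deriv (local_rep c f) u w i)"
          using jet2_smooth_compose[OF sm[OF c] chart_image_open[OF c] _ jet2_parabola, of u v w i] u
          by (simp add: dir_deriv_def dir_deriv2_def)
        moreover have "(\<lambda>s. local_rep c f (u + s *\<^sub>R v + (s\<^sup>2 / 2) *\<^sub>R w) i) = (\<lambda>s. \<Phi> i (h (chart_inv c (u + s *\<^sub>R v + (s\<^sup>2 / 2) *\<^sub>R w))))"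
          using i by (simp add: local_rep_def f_def)
        ultimately show ?thesis using jet2_unique[OF G[of i]] by simp
      qed
      then have "(\<Sum>i<n. (G1 i)\<^sup>2) = (\<Sum>i<n. (dir_deriv (local_rep c f) u v i)\<^sup>2)"
        and "(\<Sum>i<n. (G2 i)\<^sup>2) = (\<Sum>i<n. (dir_deriv2 (local_rep c f) u v v i + dir_deriv (local_rep c f) u w i)\<^sup>2)"
        by (auto intro!: sum.cong)
      then show ?thesis using G12 by (intro exI[of _ w]) simp
    qed
    have inj: "inj (dir_deriv (local_rep c f) u)" if c: "c \<in> A" and u: "u \<in> chart_image c" for c u
    proof (rule injI)
      fix v v' assume "dir_deriv (local_rep c f) u v = dir_deriv (local_rep c f) u v'"
      then have "dir_deriv (local_rep c f) u (v - v') i = 0" for i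
        using linear_diff[OF lin[OF c u]] by simp
      then show "v = v'" using main[OF c u, of "v - v'"] by auto
    qed
    have imm: "immersion X A N (unit_ball N) f"
      unfolding immersion_def
    proof (intro conjI ballI allI impI inj)
      show "unit_ball N \<subseteq> topspace (Euclidean_space N)" by (auto simp: unit_ball_def)
      have "norm_N N (f x) = 1" for x
        using sumN[of "\<lambda>i. (f x i)\<^sup>2"] \<Phi>(2)[of "h x"] by (simp add: norm_N_def inner_N_def f_def power2_eq_square)
      then show "f ` topspace X \<subseteq> unit_ball N" using N by (auto simp: unit_ball_def topspace_Euclidean_space f_def)
    qed (use sm in auto)
    have "curv_perp A N f \<le> ennreal (sqrt k)"
      unfolding curv_perp_def
    proof (rule Sup_least, elim CollectE exE conjE)
      fix z c u v assume z: "z = ennreal (norm_N N (second_fundamental_form N (local_rep c f) u v v))"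
        and c: "c \<in> A" and u: "u \<in> chart_image c" and v: "norm_N N (dir_deriv (local_rep c f) u v) = 1"
      obtain w where w: "(\<Sum>i<n. (dir_deriv2 (local_rep c f) u v v i + dir_deriv (local_rep c f) u w i)\<^sup>2)
         \<le> k * (\<Sum>i<n. (dir_deriv (local_rep c f) u v i)\<^sup>2)\<^sup>2" using main[OF c u, of v] by blast
      have "(\<Sum>i<n. (dir_deriv (local_rep c f) u v i)\<^sup>2) = 1"
        using v sumN[of "\<lambda>i. (dir_deriv (local_rep c f) u v i)\<^sup>2"] zero[OF c u]
        by (simp add: norm_N_def inner_N_def power2_eq_square)
      with w have w': "(\<Sum>i<n. (dir_deriv2 (local_rep c f) u v v i + dir_deriv (local_rep c f) u w i)\<^sup>2) \<le> k" by simp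
      have "norm_N N (second_fundamental_form N (local_rep c f) u v v)
          \<le> norm_N N (\<lambda>i. dir_deriv2 (local_rep c f) u v v i + dir_deriv (local_rep c f) u w i)"
        unfolding second_fundamental_form_def
        by (rule norm_normal_part_le(2)[OF lin[OF c u] _ inj[OF c u]]) (use zero[OF c u] N in auto)
      also have "\<dots> \<le> sqrt k"
        using w' sumN[of "\<lambda>i. (dir_deriv2 (local_rep c f) u v v i + dir_deriv (local_rep c f) u w i)\<^sup>2"] zero[OF c u]
        by (simp add: norm_N_def inner_N_def power2_eq_square)
      finally show "z \<le> ennreal (sqrt k)" unfolding z by (rule ennreal_leI)
    qed
    moreover have "min_curv_perp X A N (unit_ball N) \<le> curv_perp A N f"
      unfolding min_curv_perp_def by (rule INF_lower) (use imm in simp)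
    ultimately show ?thesis by (rule order_trans[rotated])
  qed
  then show ?thesis unfolding k_def by blast
qed

end

text \<open>Its option type has one more element than the dimension of \<open>'e\<close>, and indexes the colours.\<close>

typedef (overloaded) 'e basis_index = "Basis :: 'e::euclidean_space set"
  using nonempty_Basis by blast

instance basis_index :: (euclidean_space) finite
proof
  show "finite (UNIV :: 'a basis_index set)"
    unfolding type_definition.univ[OF type_definition_basis_index] by simp
qed

lemma card_basis_index: "CARD('e::euclidean_space basis_index option) = Suc DIM('e)"
proof -
  have "CARD('e basis_index) = DIM('e)" by (rule type_definition.card[OF type_definition_basis_index])
  then show ?thesis by (simp add: card_UNIV_option)
qed

lemma (in manifold) proper_embedding_exists:
  "\<exists>h :: 'a \<Rightarrow> ((real \<times> real \<times> 'e) ^ ('e basis_index option)) \<times> real. proper_embedding X A h"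
proof (cases "topspace X = {}")
  case True
  have dom: "fst c = {}" if "c \<in> A" for c using chart_dom_subset[OF that] True by blast
  have "proper_embedding X A (\<lambda>_ :: 'a. 0 :: ((real \<times> real \<times> 'e) ^ ('e basis_index option)) \<times> real)"
  proof unfold_locales
    show "smooth_fun A (topspace X) (\<lambda>_. 0 :: ((real \<times> real \<times> 'e) ^ ('e basis_index option)) \<times> real)"
      by (rule smooth_fun_const) simp
  qed (use True dom in auto)
  then show ?thesis by (rule exI[where P="\<lambda>h. proper_embedding X A h"])
next
  case False
  obtain c p s where "\<And>i::nat. c i \<in> A" "\<And>i. s i > 0" "\<And>i. cball (p i) (3 * s i) \<subseteq> chart_image (c i)"
    "topspace X = (\<Union>i. {x \<in> fst (c i). dist (p i) (snd (c i) x) < s i})"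
    by (rule countable_coordinate_balls[OF False]) (rule that)
  then interpret ball_cover X A c p s by unfold_locales
  obtain h :: "'a \<Rightarrow> ((real \<times> real \<times> 'e) ^ ('e basis_index option)) \<times> real" where
    "smooth_fun A (topspace X) h" "inj_on h (topspace X)"
    "\<forall>d\<in>A. \<forall>u\<in>chart_image d. inj (frechet_derivative (\<lambda>u. h (chart_inv d u)) (at u))"
    "\<forall>R. compactin X {x \<in> topspace X. norm (h x) \<le> R}"
    using blockwise_embedding[where 'k = "'e basis_index option"] card_basis_index[where 'e = 'e] by auto
  then have "proper_embedding X A h" by unfold_locales auto
  then show ?thesis by (rule exI[where P="\<lambda>h. proper_embedding X A h"])
qed

text \<open>The minimal curvatures decrease with \<open>N\<close>, whence the limit; the bound for it is strictly smaller
  than the first one if \<open>m \<ge> 2\<close>.\<close>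

theorem mainTheorem4:
  fixes X :: "'a topology" and A :: "('a, 'e::euclidean_space) chart set" and m :: nat
  assumes "smooth_manifold X A" and "DIM('e) = m"
  shows "(2 \<le> m \<longrightarrow>
            (\<exists>N0. \<forall>N\<ge>N0. min_curv_perp X A N (unit_ball N)
                     < ennreal (sqrt (3 * (2 * real m - 1) / (2 * real m + 1)))))
       \<and> convergent (\<lambda>N. min_curv_perp X A N (unit_ball N))
       \<and> lim (\<lambda>N. min_curv_perp X A N (unit_ball N)) \<le> ennreal (sqrt (3 * real m / (real m + 2)))
       \<and> sqrt (3 * real m / (real m + 2)) = sqrt (3 - 6 / (real m + 2))"
proof -
  interpret manifold X A by unfold_locales (rule assms(1))
  obtain h :: "'a \<Rightarrow> ((real \<times> real \<times> 'e) ^ ('e basis_index option)) \<times> real" where "proper_embedding X A h"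
    using proper_embedding_exists by blast
  then interpret proper_embedding X A h .
  define M where "M N = min_curv_perp X A N (unit_ball N)" for N
  define k where "k = 3 * real m / (real m + 2)"
  have bound: "\<exists>n. \<forall>N\<ge>n. M N \<le> ennreal (sqrt (k + \<delta>))" if "\<delta> > 0" for \<delta>
    using low_curvature_immersion[OF that] assms(2) by (simp add: M_def k_def)
  have "decseq M" unfolding decseq_Suc_iff M_def using min_curv_perp_Suc by blast
  then have lim: "M \<longlonglongrightarrow> (INF N. M N)" by (rule LIMSEQ_INF)
  have "(INF N. M N) \<le> ennreal (sqrt k)"
  proof (rule LIMSEQ_le_const)
    have "(\<lambda>j. sqrt (k + inverse (real (Suc j)))) \<longlonglongrightarrow> sqrt (k + 0)"
      by (intro tendsto_intros LIMSEQ_inverse_real_of_nat)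
    then show "(\<lambda>j. ennreal (sqrt (k + inverse (real (Suc j))))) \<longlonglongrightarrow> ennreal (sqrt k)"
      by (intro tendsto_ennrealI) simp
    have "(INF N. M N) \<le> ennreal (sqrt (k + inverse (real (Suc j))))" for j
    proof -
      obtain n where "\<forall>N\<ge>n. M N \<le> ennreal (sqrt (k + inverse (real (Suc j))))"
        using bound[of "inverse (real (Suc j))"] by auto
      then show ?thesis by (meson INF_lower UNIV_I order_refl order_trans)
    qed
    then show "\<exists>N. \<forall>j\<ge>N. (INF N. M N) \<le> ennreal (sqrt (k + inverse (real (Suc j))))" by blast
  qed
  moreover have "lim M = (INF N. M N)" using lim by (rule limI)
  ultimately have l: "lim M \<le> ennreal (sqrt k)" by simp
  have "\<exists>N0. \<forall>N\<ge>N0. M N < ennreal (sqrt (3 * (2 * real m - 1) / (2 * real m + 1)))" if m: "2 \<le> m"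
  proof -
    define K where "K = 3 * (2 * real m - 1) / (2 * real m + 1)"
    have "k < K"
    proof -
      have "3 * real m * (2 * real m + 1) < 3 * (2 * real m - 1) * (real m + 2)" using m by (simp add: algebra_simps)
      then show ?thesis unfolding k_def K_def by (simp add: divide_less_eq less_divide_eq mult_ac)
    qed
    then obtain n where n: "\<forall>N\<ge>n. M N \<le> ennreal (sqrt (k + (K - k) / 2))" using bound[of "(K - k) / 2"] by auto
    have "k \<ge> 0" by (simp add: k_def)
    have "sqrt (k + (K - k) / 2) < sqrt K" using \<open>k < K\<close> by (simp add: field_simps)
    then have "ennreal (sqrt (k + (K - k) / 2)) < ennreal (sqrt K)"
      using \<open>k < K\<close> \<open>k \<ge> 0\<close> by (intro ennreal_lessI) auto
    then show ?thesis unfolding K_def[symmetric] using n le_less_trans by blast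
  qed
  moreover have "3 * real m / (real m + 2) = 3 - 6 / (real m + 2)"
  proof -
    have e: "3 - 6 / (real m + 2) = (3 * (real m + 2) - 6) / (real m + 2)"
      unfolding diff_divide_distrib by (simp add: nonzero_mult_div_cancel_right del: distrib_left_numeral)
    have n: "3 * (real m + 2) - 6 = 3 * real m" by simp
    show ?thesis unfolding e n ..
  qed
  moreover have "convergent M" using lim by (rule convergentI)
  ultimately show ?thesis using l by (simp add: M_def[abs_def] k_def)
qed

end
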